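(* Let $(H,V,a)$ be a triple with $a$ a bounded, $V$-coercive sesquilinear form on $V$ (as specified in the context), let $A$ be the induced Lax--Milgram operator, and let $0<T<\infty$. For $u_0\in H$ and $f\in L_2(0,T;V^* )$, let $u$ be the unique solution in $$X=L_2(0,T;V)\cap C([0,T];H)\cap H^1(0,T;V^* )$$ of the Cauchy problem $$\partial_tu+Au=f\ \text{ in }\mathcal{D}'(0,T;V^* ),\qquad u(0)=u_0\ \text{ in }H .$$ Then $u$ is given by Duhamel's formula $$u(t)=e^{-tA}u_0+\int_0^te^{-(t-s)A}f(s)\,ds\qquad\text{for }0\le t\le T,$$ and each of the three terms belongs to $X$ (as a function of $t$).
   Context: Setting: $V\hookrightarrow H\hookrightarrow V^*$ is a Gelfand triple of separable, densely and continuously injected complex Hilbert spaces with norms $\|\cdot\|$, $|\cdot|$, $\|\cdot\|_*$, respectively; $V^*$ is the antidual of $V$ (with dual norm), $(\,\cdot\,|\,\cdot\,)$ is the inner product of $H$ and $\langle\cdot,\cdot\rangle$ is the duality of $V^*$ and $V$. There are constants $C_1,C_2>0$ with $\|v\|_*\le C_1|v|\le C_2\|v\|$ for $v\in V$. The sesquilinear form $a(\cdot,\cdot)$ on $V$ is bounded and $V$-coercive: there are constants $C_3,C_4>0$ and $k\in\mathbb{R}$ such that for all $u,v\in V$ $$|a(u,v)|\le C_3\|u\|\,\|v\|,\qquad \operatorname{Re}a(v,v)\ge C_4\|v\|^2-k|v|^2 .$$ The Lax--Milgram operator $A$ is the unbounded operator in $H$ whose domain $D(A)$ consists of those $u\in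 V$ for which there is $f\in H$ with $a(u,v)=(f|v)$ for all $v\in V$; then $Au=f$. It has a unique extension $A\in\mathbb{B}(V,V^* )$, given by $\langle Au,v\rangle=a(u,v)$ for $u,v\in V$. Semigroups: $-A$ generates an analytic semigroup $e^{-tA}$ in $\mathbb{B}(H)$, which extends to an analytic semigroup on $V^*$, also written $e^{-tA}$, generated by minus the extension $A$ regarded as an unbounded operator in $V^*$ with domain $V$. The integral is a Bochner integral in $V^*$. Spaces: $\mathcal{D}'(0,T;V^* )$ is the space of continuous linear maps $C_0^\infty(]0,T[)\to V^*$ (vector distributions), and $\partial_tu$ is the distributional derivative. $H^1(0,T;V^* )=\{u\in L_2(0,T;V^* )\mid \partial_tu\in L_2(0,T;V^* )\}$. It is known (Lions--Magenes) that for all $u_0\in H$, $f\in L_2(0,T;V^* )$ the Cauchy problem has a unique solution in $X$. *)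

theory Defs
  imports "HOL-Analysis.Analysis"
begin

section \<open>Complex Hilbert spaces\<close>

class complex_vector = real_vector +
  fixes scaleC :: "complex \<Rightarrow> 'a \<Rightarrow> 'a" (infixr \<open>*\<^sub>C\<close> 75)
  assumes scaleC_add_right: "c *\<^sub>C (x + y) = c *\<^sub>C x + c *\<^sub>C y"
    and scaleC_add_left: "(c + d) *\<^sub>C x = c *\<^sub>C x + d *\<^sub>C x"
    and scaleC_scaleC: "c *\<^sub>C d *\<^sub>C x = (c * d) *\<^sub>C x"
    and scaleC_of_real: "complex_of_real r *\<^sub>C x = r *\<^sub>R x"

class complex_normed_vector = complex_vector + real_normed_vector +
  assumes norm_scaleC: "norm (c *\<^sub>C x) = cmod c * norm x"

text \<open>The inner product is linear in the first and antilinear in the second argument.\<close>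

class complex_inner = complex_normed_vector +
  fixes cinner :: "'a \<Rightarrow> 'a \<Rightarrow> complex"
  assumes cinner_add_left: "cinner (x + y) z = cinner x z + cinner y z"
    and cinner_scaleC_left: "cinner (c *\<^sub>C x) y = c * cinner x y"
    and cinner_commute: "cinner x y = cnj (cinner y x)"
    and cinner_self: "cinner x x = complex_of_real ((norm x)\<^sup>2)"

class complex_hilbert = complex_inner + complete_space
begin
subclass banach ..
end

definition bounded_clinear :: "('a::complex_normed_vector \<Rightarrow> 'b::complex_normed_vector) \<Rightarrow> bool" where
  "bounded_clinear F \<longleftrightarrow> bounded_linear F \<and> (\<forall>c x. F (c *\<^sub>C x) = c *\<^sub>C F x)"

definition bounded_antilinear :: "('a::complex_normed_vector \<Rightarrow> complex) \<Rightarrow> bool" where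
  "bounded_antilinear F \<longleftrightarrow> bounded_linear F \<and> (\<forall>c x. F (c *\<^sub>C x) = cnj c * F x)"


section \<open>The antidual space\<close>

text \<open>The norm on the antidual is the operator norm inherited from
  the space of bounded real-linear maps.\<close>

typedef (overloaded) 'a antidual =
  "{\<phi> :: 'a::complex_normed_vector \<Rightarrow>\<^sub>L complex. bounded_antilinear (blinfun_apply \<phi>)}"
  by (rule exI[of _ 0])
    (simp add: bounded_antilinear_def zero_blinfun.rep_eq bounded_linear_zero)

setup_lifting type_definition_antidual

lift_definition pairing :: "'a::complex_normed_vector antidual \<Rightarrow> 'a \<Rightarrow> complex"
  is "\<lambda>\<phi> v. blinfun_apply \<phi> v" .

definition mk_antidual :: "('a::complex_normed_vector \<Rightarrow> complex) \<Rightarrow> 'a antidual" where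
  "mk_antidual F = Abs_antidual (Blinfun F)"

lemma pairing_mk_antidual:
  "bounded_antilinear F \<Longrightarrow> pairing (mk_antidual F) v = F v"
  unfolding mk_antidual_def pairing.rep_eq
  by (subst Abs_antidual_inverse)
    (auto simp: bounded_antilinear_def bounded_linear_Blinfun_apply)

lemma antidual_eqI: "(\<And>v. pairing \<phi> v = pairing \<psi> v) \<Longrightarrow> \<phi> = \<psi>"
  by transfer (rule blinfun_eqI)

instantiation antidual :: (complex_normed_vector) complex_normed_vector
begin

lift_definition zero_antidual :: "'a antidual" is 0
  by (simp add: bounded_antilinear_def zero_blinfun.rep_eq bounded_linear_zero)
lift_definition plus_antidual :: "'a antidual \<Rightarrow> 'a antidual \<Rightarrow> 'a antidual" is "(+)"
  by (auto simp: bounded_antilinear_def plus_blinfun.rep_eq bounded_linear_add algebra_simps)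
lift_definition minus_antidual :: "'a antidual \<Rightarrow> 'a antidual \<Rightarrow> 'a antidual" is "(-)"
  by (auto simp: bounded_antilinear_def minus_blinfun.rep_eq bounded_linear_sub algebra_simps)
lift_definition uminus_antidual :: "'a antidual \<Rightarrow> 'a antidual" is "uminus"
  by (auto simp: bounded_antilinear_def uminus_blinfun.rep_eq bounded_linear_minus algebra_simps)
lift_definition scaleR_antidual :: "real \<Rightarrow> 'a antidual \<Rightarrow> 'a antidual" is "(*\<^sub>R)"
  by (auto simp: bounded_antilinear_def scaleR_blinfun.rep_eq
      intro: bounded_linear_const_scaleR)
lift_definition norm_antidual :: "'a antidual \<Rightarrow> real" is norm .
lift_definition scaleC_antidual :: "complex \<Rightarrow> 'a antidual \<Rightarrow> 'a antidual"
  is "\<lambda>c \<phi>. blinfun_compose (blinfun_mult_right c) \<phi>"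
  by (auto simp: bounded_antilinear_def blinfun.bounded_linear_right)

definition dist_antidual :: "'a antidual \<Rightarrow> 'a antidual \<Rightarrow> real" where
  "dist_antidual x y = norm (x - y)"
definition sgn_antidual :: "'a antidual \<Rightarrow> 'a antidual" where
  "sgn_antidual x = inverse (norm x) *\<^sub>R x"
definition uniformity_antidual :: "('a antidual \<times> 'a antidual) filter" where
  "uniformity_antidual = (INF e\<in>{0<..}. principal {(x, y). dist x y < e})"
definition open_antidual :: "'a antidual set \<Rightarrow> bool" where
  "open_antidual U = (\<forall>x\<in>U. \<forall>\<^sub>F (x', y) in uniformity. x' = x \<longrightarrow> y \<in> U)"

instance
proof
  show "dist x y = norm (x - y)" for x y :: "'a antidual" by (rule dist_antidual_def)
  show "sgn x = inverse (norm x) *\<^sub>R x" for x :: "'a antidual" by (rule sgn_antidual_def)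
  show "(uniformity :: ('a antidual \<times> 'a antidual) filter)
      = (INF e\<in>{0<..}. principal {(x, y). dist x y < e})"
    by (rule uniformity_antidual_def)
  show "open U = (\<forall>x\<in>U. \<forall>\<^sub>F (x', y) in uniformity. x' = x \<longrightarrow> y \<in> U)" for U :: "'a antidual set"
    by (rule open_antidual_def)
  show "norm (c *\<^sub>C x) = cmod c * norm x" for c and x :: "'a antidual"
  proof (transfer, goal_cases)
    case (1 c \<phi>)
    have "norm (blinfun_mult_right c o\<^sub>L \<phi>) \<le> cmod c * norm \<phi>" for c and \<phi> :: "'a \<Rightarrow>\<^sub>L complex"
      by (rule norm_blinfun_bound)
        (auto simp: norm_mult mult.assoc intro!: mult_left_mono norm_blinfun)
    note le = this
    show ?case
    proof (cases "c = 0")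
      case True
      then have "blinfun_mult_right c o\<^sub>L \<phi> = 0" by (intro blinfun_eqI) simp
      then show ?thesis using True by simp
    next
      case False
      have "\<phi> = blinfun_mult_right (inverse c) o\<^sub>L (blinfun_mult_right c o\<^sub>L \<phi>)"
        using False by (intro blinfun_eqI) simp
      then have "norm \<phi> \<le> cmod (inverse c) * norm (blinfun_mult_right c o\<^sub>L \<phi>)"
        using le by metis
      then have "cmod c * norm \<phi> \<le> norm (blinfun_mult_right c o\<^sub>L \<phi>)"
        using False by (simp add: norm_divide field_simps)
      then show ?thesis using le[of c \<phi>] by simp
    qed
  qed
  fix x y z :: "'a antidual" and c d :: complex and r r' :: real
  show "x + y + z = x + (y + z)" by transfer simp
  show "x + y = y + x" by transfer simp
  show "0 + x = x" by transfer simp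
  show "- x + x = 0" by transfer simp
  show "x - y = x + - y" by transfer simp
  show "r *\<^sub>R (x + y) = r *\<^sub>R x + r *\<^sub>R y" by transfer (rule scaleR_add_right)
  show "(r + r') *\<^sub>R x = r *\<^sub>R x + r' *\<^sub>R x" by transfer (rule scaleR_add_left)
  show "r *\<^sub>R r' *\<^sub>R x = (r * r') *\<^sub>R x" by transfer simp
  show "1 *\<^sub>R x = x" by transfer simp
  show "(norm x = 0) = (x = 0)" by transfer simp
  show "norm (x + y) \<le> norm x + norm y" by transfer (rule norm_triangle_ineq)
  show "norm (r *\<^sub>R x) = \<bar>r\<bar> * norm x" by transfer simp
  show "c *\<^sub>C (x + y) = c *\<^sub>C x + c *\<^sub>C y"
    by transfer (auto intro!: blinfun_eqI simp: blinfun.bilinear_simps algebra_simps)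
  show "(c + d) *\<^sub>C x = c *\<^sub>C x + d *\<^sub>C x"
    by transfer (auto intro!: blinfun_eqI simp: blinfun.bilinear_simps algebra_simps)
  show "c *\<^sub>C d *\<^sub>C x = (c * d) *\<^sub>C x"
    by transfer (auto intro!: blinfun_eqI simp: blinfun.bilinear_simps algebra_simps)
  show "complex_of_real r *\<^sub>C x = r *\<^sub>R x"
    by transfer (auto intro!: blinfun_eqI simp: blinfun.bilinear_simps scaleR_conv_of_real)
qed

end

lemma pairing_add: "pairing (\<phi> + \<psi>) v = pairing \<phi> v + pairing \<psi> v"
  by transfer (simp add: blinfun.bilinear_simps)

lemma pairing_scaleC: "pairing (c *\<^sub>C \<phi>) v = c * pairing \<phi> v"
  by transfer simp

lemma norm_antidual: "norm \<phi> = (SUP v. cmod (pairing \<phi> v) / norm v)"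
  by transfer (simp add: norm_blinfun.rep_eq onorm_def)

instance antidual :: (complex_normed_vector) banach
proof
  fix X :: "nat \<Rightarrow> 'a antidual"
  assume "Cauchy X"
  have dist_Rep: "dist (Rep_antidual x) (Rep_antidual y) = dist x y" for x y :: "'a antidual"
    by (simp add: dist_norm norm_antidual.rep_eq minus_antidual.rep_eq)
  have "Cauchy (\<lambda>n. Rep_antidual (X n))"
    using \<open>Cauchy X\<close> by (simp add: Cauchy_def dist_Rep)
  then obtain L where L: "(\<lambda>n. Rep_antidual (X n)) \<longlonglongrightarrow> L"
    using Cauchy_convergent convergent_def by blast
  have lim: "(\<lambda>n. Rep_antidual (X n) v) \<longlonglongrightarrow> L v" for v
    by (intro blinfun.tendsto L tendsto_const)
  have "L (c *\<^sub>C v) = cnj c * L v" for c v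
  proof (rule LIMSEQ_unique[OF lim])
    have "Rep_antidual (X n) (c *\<^sub>C v) = cnj c * Rep_antidual (X n) v" for n
      using Rep_antidual[of "X n"] by (simp add: bounded_antilinear_def)
    then show "(\<lambda>n. Rep_antidual (X n) (c *\<^sub>C v)) \<longlonglongrightarrow> cnj c * L v"
      by (simp add: lim tendsto_mult_left)
  qed
  then have "Rep_antidual (Abs_antidual L) = L"
    by (simp add: Abs_antidual_inverse bounded_antilinear_def blinfun.bounded_linear_right)
  then have "X \<longlonglongrightarrow> Abs_antidual L"
    using L by (simp add: tendsto_iff dist_Rep[symmetric])
  then show "convergent X" by (auto simp: convergent_def)
qed


section \<open>Separability of the antidual\<close>

lemma cinner_zero_left: "cinner 0 (x::'a::complex_inner) = 0"
  using cinner_add_left[of 0 0 x] by simp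

lemma cinner_add_right: "cinner (x::'a::complex_inner) (y + z) = cinner x y + cinner x z"
  by (metis cinner_add_left cinner_commute complex_cnj_add)

lemma cinner_scaleC_right: "cinner (x::'a::complex_inner) (c *\<^sub>C y) = cnj c * cinner x y"
  by (metis cinner_commute cinner_scaleC_left complex_cnj_mult)

lemma cinner_scaleR_left: "cinner (r *\<^sub>R (x::'a::complex_inner)) y = r *\<^sub>R cinner x y"
  by (metis cinner_scaleC_left scaleC_of_real scaleR_conv_of_real)

lemma cinner_scaleR_right: "cinner (x::'a::complex_inner) (r *\<^sub>R y) = r *\<^sub>R cinner x y"
  by (metis cinner_scaleC_right complex_cnj_complex_of_real scaleC_of_real scaleR_conv_of_real)

lemma norm_add_square:
  "(norm (x + y))\<^sup>2 = (norm x)\<^sup>2 + 2 * Re (cinner (x::'a::complex_inner) y) + (norm y)\<^sup>2"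
proof -
  have "complex_of_real ((norm (x + y))\<^sup>2)
      = cinner x x + cinner x y + cnj (cinner x y) + cinner y y"
    by (simp add: cinner_self[symmetric] cinner_add_left cinner_add_right
        cinner_commute[symmetric] algebra_simps del: of_real_power)
  then have "Re (complex_of_real ((norm (x + y))\<^sup>2))
      = Re (cinner x x + cinner x y + cnj (cinner x y) + cinner y y)" by (rule arg_cong)
  then show ?thesis by (simp add: cinner_self del: of_real_power)
qed

lemma quadratic_nonneg_bound:
  fixes N b \<delta> :: real
  assumes "\<And>t. t\<^sup>2 * N\<^sup>2 + 2 * t * b + \<delta>\<^sup>2 \<ge> 0" "N \<ge> 0" "\<delta> > 0"
  shows "\<bar>b\<bar> \<le> \<delta> * N"
proof (cases "N = 0")
  case True
  show ?thesis
  proof (rule ccontr)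
    assume "\<not> ?thesis"
    then have "b \<noteq> 0" using True by auto
    then have "2 * (- \<delta>\<^sup>2 / b) * b + \<delta>\<^sup>2 = - \<delta>\<^sup>2" by (simp add: field_simps)
    then show False using assms(1)[of "- \<delta>\<^sup>2 / b"] True assms(3) by auto
  qed
next
  case False
  have "(b / N\<^sup>2)\<^sup>2 * N\<^sup>2 + 2 * (- b / N\<^sup>2) * b + \<delta>\<^sup>2 = \<delta>\<^sup>2 - b\<^sup>2 / N\<^sup>2"
    using False by (simp add: field_simps power2_eq_square)
  then have "b\<^sup>2 \<le> (\<delta> * N)\<^sup>2"
    using assms(1)[of "- b / N\<^sup>2"] False by (simp add: power_mult_distrib field_simps)
  then show ?thesis
    using assms abs_le_square_iff[of b "\<delta> * N"] by (simp add: abs_mult)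
qed

lemma abs_Re_cinner_le: "\<bar>Re (cinner u v)\<bar> \<le> norm u * norm (v::'a::complex_inner)"
proof (cases "u = 0")
  case True then show ?thesis by (simp add: cinner_zero_left)
next
  case False
  show ?thesis
  proof (rule quadratic_nonneg_bound)
    fix t :: real
    have "0 \<le> (norm (u + t *\<^sub>R v))\<^sup>2" by simp
    then show "t\<^sup>2 * (norm v)\<^sup>2 + 2 * t * Re (cinner u v) + (norm u)\<^sup>2 \<ge> 0"
      unfolding norm_add_square by (simp add: cinner_scaleR_right power_mult_distrib)
  qed (use False in auto)
qed

lemma cmod_cinner_le: "cmod (cinner w v) \<le> 2 * norm w * norm (v::'a::complex_inner)"
proof -
  have "cmod (cinner w v) \<le> \<bar>Re (cinner w v)\<bar> + \<bar>Im (cinner w v)\<bar>" by (rule cmod_le)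
  also have "Im (cinner w v) = Re (cinner w (\<i> *\<^sub>C v))"
    by (simp add: cinner_scaleC_right)
  finally show ?thesis
    using abs_Re_cinner_le[of w v] abs_Re_cinner_le[of w "\<i> *\<^sub>C v"] by (simp add: norm_scaleC)
qed

lemma bounded_antilinear_cinner: "bounded_antilinear (cinner (w::'a::complex_inner))"
proof -
  have "bounded_linear (cinner w)"
    by (rule bounded_linear_intro[where K = "2 * norm w"])
      (use cmod_cinner_le[of w] in \<open>auto simp: cinner_add_right cinner_scaleR_right mult.commute mult.left_commute\<close>)
  then show ?thesis by (simp add: bounded_antilinear_def cinner_scaleC_right)
qed

lemma pairing_add_right: "pairing \<phi> (x + y) = pairing \<phi> x + pairing \<phi> y"
  by transfer (simp add: blinfun.bilinear_simps)

lemma pairing_scaleR_right: "pairing \<phi> (r *\<^sub>R x) = r *\<^sub>R pairing \<phi> x"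
  by transfer (simp add: blinfun.bilinear_simps)

lemma pairing_scaleC_right: "pairing \<phi> (c *\<^sub>C x) = cnj c * pairing \<phi> x"
  by transfer (simp add: bounded_antilinear_def)

lemma norm_pairing: "cmod (pairing \<phi> x) \<le> norm \<phi> * norm x"
  by transfer (rule norm_blinfun)

lemma norm_antidual_bound:
  "0 \<le> b \<Longrightarrow> (\<And>x. cmod (pairing \<phi> x) \<le> b * norm x) \<Longrightarrow> norm \<phi> \<le> b"
  by transfer (rule norm_blinfun_bound)

lemma pairing_diff: "pairing (\<phi> - \<psi>) v = pairing \<phi> v - pairing \<psi> v"
  by transfer (simp add: blinfun.bilinear_simps)

lemma antidual_dense:
  fixes \<phi> :: "'a::complex_inner antidual"
  assumes "e > 0"
  shows "\<exists>w. norm (\<phi> - mk_antidual (cinner w)) \<le> e"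
proof -
  define F where "F = (\<lambda>x. (norm x)\<^sup>2 - 2 * Re (pairing \<phi> x))"
  have "- (norm \<phi>)\<^sup>2 \<le> F x" for x
  proof -
    have "Re (pairing \<phi> x) \<le> norm \<phi> * norm x"
      using norm_pairing[of \<phi> x] complex_Re_le_cmod order_trans by blast
    moreover have "0 \<le> (norm x - norm \<phi>)\<^sup>2" by simp
    ultimately show ?thesis by (simp add: F_def power2_diff algebra_simps)
  qed
  then have bdd: "bdd_below (range F)" by (auto simp: bdd_below_def)
  define d where "d = e / 2"
  have d: "d > 0" using assms by (simp add: d_def)
  then have "(INF x. F x) < (INF x. F x) + d\<^sup>2" by simp
  then obtain w where w: "F w < (INF x. F x) + d\<^sup>2"
    using cINF_less_iff[OF _ bdd] by blast
  have ge: "F w - d\<^sup>2 \<le> F x" for x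
    using w cINF_lower[OF bdd, of x] by simp
  have re: "\<bar>Re (cinner w v - pairing \<phi> v)\<bar> \<le> d * norm v" for v
  proof (rule quadratic_nonneg_bound)
    fix t :: real
    show "t\<^sup>2 * (norm v)\<^sup>2 + 2 * t * Re (cinner w v - pairing \<phi> v) + d\<^sup>2 \<ge> 0"
      using ge[of "w + t *\<^sub>R v"]
      by (simp add: F_def norm_add_square cinner_scaleR_right pairing_add_right
          pairing_scaleR_right power_mult_distrib algebra_simps)
  qed (use d in auto)
  have "norm (\<phi> - mk_antidual (cinner w)) \<le> e"
  proof (rule norm_antidual_bound)
    fix v
    let ?z = "cinner w v - pairing \<phi> v"
    have "cmod ?z \<le> \<bar>Re ?z\<bar> + \<bar>Im ?z\<bar>" by (rule cmod_le)
    also have "Im ?z = Re (cinner w (\<i> *\<^sub>C v) - pairing \<phi> (\<i> *\<^sub>C v))"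
      by (simp add: cinner_scaleC_right pairing_scaleC_right)
    finally have "cmod ?z \<le> e * norm v"
      using re[of v] re[of "\<i> *\<^sub>C v"] by (simp add: norm_scaleC d_def)
    then show "cmod (pairing (\<phi> - mk_antidual (cinner w)) v) \<le> e * norm v"
      by (simp add: pairing_diff pairing_mk_antidual bounded_antilinear_cinner norm_minus_commute)
  qed (use assms in simp)
  then show ?thesis ..
qed

lemma mk_antidual_cinner_diff:
  "norm (mk_antidual (cinner (w::'a::complex_inner)) - mk_antidual (cinner w')) \<le> 2 * norm (w - w')"
proof (rule norm_antidual_bound)
  fix v
  have "cinner w v - cinner w' v = cinner (w - w') v"
    using cinner_add_left[of "w - w'" w' v] by simp
  then show "cmod (pairing (mk_antidual (cinner w) - mk_antidual (cinner w')) v)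
      \<le> 2 * norm (w - w') * norm v"
    using cmod_cinner_le[of "w - w'" v]
    by (simp add: pairing_diff pairing_mk_antidual bounded_antilinear_cinner)
qed simp

instance antidual :: ("{complex_inner, second_countable_topology}") second_countable_topology
proof
  obtain D :: "'a set" where D: "countable D" "\<And>U. open U \<Longrightarrow> U \<noteq> {} \<Longrightarrow> \<exists>d\<in>D. d \<in> U"
    using countable_dense_setE by blast
  define B where "B = (\<lambda>(w, n). ball (mk_antidual (cinner w)) (inverse (real (Suc n)))) ` (D \<times> UNIV)"
  have "countable B" using D(1) by (simp add: B_def)
  moreover have "topological_basis B"
  proof (rule topological_basisI)
    show "open b" if "b \<in> B" for b using that by (auto simp: B_def)
  next
    fix U :: "'a antidual set" and x
    assume "open U" "x \<in> U"
    then obtain e where e: "e > 0" "ball x e \<subseteq> U" by (meson openE)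
    then obtain n where n: "inverse (real (Suc n)) < e / 2"
      using reals_Archimedean[of "e / 2"] by auto
    define r where "r = inverse (real (Suc n))"
    have r: "r > 0" by (simp add: r_def)
    obtain w where w: "norm (x - mk_antidual (cinner w)) \<le> r / 2"
      using antidual_dense[of "r / 2" x] r by auto
    obtain d where d: "d \<in> D" "d \<in> ball w (r / 4)"
      using D(2)[of "ball w (r / 4)"] r by auto
    have "norm (x - mk_antidual (cinner d)) \<le> norm (x - mk_antidual (cinner w))
        + norm (mk_antidual (cinner w) - mk_antidual (cinner d))"
      using norm_triangle_ineq[of "x - mk_antidual (cinner w)"
          "mk_antidual (cinner w) - mk_antidual (cinner d)"] by simp
    also have "\<dots> < r"
      using w d(2) mk_antidual_cinner_diff[of w d] by (simp add: dist_norm)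
    finally have near: "dist (mk_antidual (cinner d)) x < r"
      by (simp add: dist_norm norm_minus_commute)
    have "ball (mk_antidual (cinner d)) r \<subseteq> ball x e"
    proof
      fix y assume "y \<in> ball (mk_antidual (cinner d)) r"
      then have "dist x y < r + r"
        using near dist_triangle[of x y "mk_antidual (cinner d)"] by (simp add: dist_commute)
      then show "y \<in> ball x e" using n by (simp add: r_def)
    qed
    moreover have "ball (mk_antidual (cinner d)) r \<in> B"
      using d(1) by (auto simp: B_def r_def)
    ultimately show "\<exists>B'\<in>B. x \<in> B' \<and> B' \<subseteq> U"
      using near e(2) by (meson mem_ball order_trans)
  qed
  ultimately show "\<exists>B::'a antidual set set. countable B \<and> open = generate_topology B"
    using topological_basis_imp_subbasis by blast
qed


section \<open>Gelfand triples and Lax--Milgram operators\<close>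

text \<open>The space \<open>V\<close> is identified with a subspace of \<open>H\<close> via \<open>j\<close>, and \<open>H\<close> with a subspace
  of the antidual of \<open>V\<close> via \<open>\<lambda>h. (h | j _)\<close>. Boundedness, injectivity and density of the second
  embedding follow from the corresponding properties of the first.\<close>

definition gelfand_triple ::
  "('v::{complex_hilbert, second_countable_topology} \<Rightarrow> 'h::{complex_hilbert, second_countable_topology}) \<Rightarrow> bool"
  where
  "gelfand_triple j \<longleftrightarrow> bounded_clinear j \<and> inj j \<and> closure (range j) = UNIV"

definition emb_H :: "('v::complex_hilbert \<Rightarrow> 'h::complex_hilbert) \<Rightarrow> 'h \<Rightarrow> 'v antidual" where
  "emb_H j h = mk_antidual (\<lambda>v. cinner h (j v))"

definition emb_V :: "('v::complex_hilbert \<Rightarrow> 'h::complex_hilbert) \<Rightarrow> 'v \<Rightarrow> 'v antidual" where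
  "emb_V j v = emb_H j (j v)"

definition sesquilinear :: "('v::complex_vector \<Rightarrow> 'v \<Rightarrow> complex) \<Rightarrow> bool" where
  "sesquilinear a \<longleftrightarrow>
    (\<forall>u u' v. a (u + u') v = a u v + a u' v) \<and> (\<forall>c u v. a (c *\<^sub>C u) v = c * a u v) \<and>
    (\<forall>u v v'. a u (v + v') = a u v + a u v') \<and> (\<forall>c u v. a u (c *\<^sub>C v) = cnj c * a u v)"

definition bounded_form :: "('v::complex_normed_vector \<Rightarrow> 'v \<Rightarrow> complex) \<Rightarrow> bool" where
  "bounded_form a \<longleftrightarrow> (\<exists>C>0. \<forall>u v. cmod (a u v) \<le> C * norm u * norm v)"

definition coercive_form ::
  "('v::complex_hilbert \<Rightarrow> 'h::complex_hilbert) \<Rightarrow> ('v \<Rightarrow> 'v \<Rightarrow> complex) \<Rightarrow> bool" where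
  "coercive_form j a \<longleftrightarrow>
    (\<exists>C>0. \<exists>k::real. \<forall>v. Re (a v v) \<ge> C * (norm v)\<^sup>2 - k * (norm (j v))\<^sup>2)"

text \<open>Unbounded operators are represented by their graphs.\<close>

definition lax_milgram ::
  "('v::complex_hilbert \<Rightarrow> 'h::complex_hilbert) \<Rightarrow> ('v \<Rightarrow> 'v \<Rightarrow> complex) \<Rightarrow> ('h \<times> 'h) set" where
  "lax_milgram j a = {(j u, f) | u f. \<forall>v. a u v = cinner f (j v)}"

definition lax_milgram_ext :: "('v::complex_hilbert \<Rightarrow> 'v \<Rightarrow> complex) \<Rightarrow> 'v \<Rightarrow> 'v antidual" where
  "lax_milgram_ext a u = mk_antidual (a u)"

definition lax_milgram_ext_graph ::
  "('v::complex_hilbert \<Rightarrow> 'h::complex_hilbert) \<Rightarrow> ('v \<Rightarrow> 'v \<Rightarrow> complex)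
    \<Rightarrow> ('v antidual \<times> 'v antidual) set" where
  "lax_milgram_ext_graph j a = {(emb_V j u, lax_milgram_ext a u) | u. True}"


section \<open>Semigroups\<close>

definition C0_semigroup :: "(real \<Rightarrow> 'b::complex_normed_vector \<Rightarrow> 'b) \<Rightarrow> bool" where
  "C0_semigroup S \<longleftrightarrow>
    (\<forall>t\<ge>0. bounded_clinear (S t)) \<and> (\<forall>x. S 0 x = x) \<and>
    (\<forall>s\<ge>0. \<forall>t\<ge>0. \<forall>x. S (s + t) x = S s (S t x)) \<and>
    (\<forall>x. ((\<lambda>t. S t x) \<longlongrightarrow> x) (at_right 0))"

definition generator :: "(real \<Rightarrow> 'b::real_normed_vector \<Rightarrow> 'b) \<Rightarrow> ('b \<times> 'b) set" where
  "generator S = {(x, y). ((\<lambda>h. (S h x - x) /\<^sub>R h) \<longlongrightarrow> y) (at_right 0)}"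

text \<open>\<open>exp_minus A t\<close> is the operator \<open>e\<^sup>-\<^sup>t\<^sup>A\<close> for \<open>t \<ge> 0\<close>. A strongly continuous semigroup is
  determined on \<open>[0,\<infinity>[\<close> by its generator, so the choice is immaterial; analyticity is a
  property of this semigroup, and not needed to single it out.\<close>

definition exp_minus :: "('b::complex_normed_vector \<times> 'b) set \<Rightarrow> real \<Rightarrow> 'b \<Rightarrow> 'b" where
  "exp_minus A = (SOME S. C0_semigroup S \<and> generator S = {(x, - y) | x y. (x, y) \<in> A})"


section \<open>Vector distributions and the solution space\<close>

definition test_function :: "real \<Rightarrow> (real \<Rightarrow> complex) \<Rightarrow> bool" where
  "test_function T \<phi> \<longleftrightarrow>
    (\<exists>D. D 0 = \<phi> \<and> (\<forall>k t. (D k has_vector_derivative D (Suc k) t) (at t))) \<and>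
    (\<exists>c d. 0 < c \<and> d < T \<and> (\<forall>t. t \<notin> {c..d} \<longrightarrow> \<phi> t = 0))"

definition L2 :: "real \<Rightarrow> (real \<Rightarrow> 'b::{banach, second_countable_topology}) set" where
  "L2 T = {g. g \<in> borel_measurable (lebesgue_on {0<..<T}) \<and>
    integrable (lebesgue_on {0<..<T}) (\<lambda>t. (norm (g t))\<^sup>2)}"

text \<open>A vector distribution is rendered by its values on test functions; two distributions on
  \<open>]0,T[\<close> are equal iff they agree on all test functions. Functions in \<open>L2 T\<close> are
  identified with the regular distributions they induce.\<close>

definition regular_distr ::
  "real \<Rightarrow> (real \<Rightarrow> 'b::{complex_normed_vector, banach, second_countable_topology})
    \<Rightarrow> (real \<Rightarrow> complex) \<Rightarrow> 'b" where
  "regular_distr T g \<phi> = (LINT t|lebesgue_on {0<..<T}. \<phi> t *\<^sub>C g t)"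

definition distr_deriv ::
  "((real \<Rightarrow> complex) \<Rightarrow> 'b::real_normed_vector) \<Rightarrow> (real \<Rightarrow> complex) \<Rightarrow> 'b" where
  "distr_deriv \<Lambda> \<phi> = - \<Lambda> (\<lambda>t. vector_derivative \<phi> (at t))"

definition H1 ::
  "real \<Rightarrow> (real \<Rightarrow> 'b::{complex_normed_vector, banach, second_countable_topology}) set" where
  "H1 T = {u \<in> L2 T. \<exists>g\<in>L2 T. \<forall>\<phi>. test_function T \<phi> \<longrightarrow>
    distr_deriv (regular_distr T u) \<phi> = regular_distr T g \<phi>}"

text \<open>All functions are regarded as functions with values in the antidual of \<open>V\<close>.\<close>

definition X_space ::
  "('v::{complex_hilbert, second_countable_topology} \<Rightarrow> 'h::{complex_hilbert, second_countable_topology})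
    \<Rightarrow> real \<Rightarrow> (real \<Rightarrow> 'v antidual) set" where
  "X_space j T =
    {u. \<exists>v\<in>L2 T. AE t in lebesgue_on {0<..<T}. u t = emb_V j (v t)} \<inter>
    {u. \<exists>h. continuous_on {0..T} h \<and> (\<forall>t\<in>{0..T}. u t = emb_H j (h t))} \<inter>
    H1 T"

text \<open>For \<open>u\<close> in \<open>X_space j T\<close> the value \<open>u t\<close> lies in the range of \<open>emb_V j\<close> for almost
  every \<open>t\<close> only; on the remaining null set the function \<open>Au\<close> below is arbitrary.\<close>

definition cauchy_solution ::
  "('v::{complex_hilbert, second_countable_topology} \<Rightarrow> 'h::{complex_hilbert, second_countable_topology})
    \<Rightarrow> ('v \<Rightarrow> 'v \<Rightarrow> complex) \<Rightarrow> real \<Rightarrow> (real \<Rightarrow> 'v antidual) \<Rightarrow> 'h \<Rightarrow> (real \<Rightarrow> 'v antidual) \<Rightarrow> bool" where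
  "cauchy_solution j a T f u\<^sub>0 u \<longleftrightarrow>
    (\<forall>\<phi>. test_function T \<phi> \<longrightarrow>
      distr_deriv (regular_distr T u) \<phi>
        + regular_distr T (\<lambda>t. lax_milgram_ext a (inv (emb_V j) (u t))) \<phi>
      = regular_distr T f \<phi>) \<and>
    u 0 = emb_H j u\<^sub>0"

end

theory Submission
  imports Defs
begin

text \<open>
  Both semigroups are obtained from the backward Euler scheme. If the powers of the resolvents
  \<open>J\<^sub>p = (1 + p A)\<^sup>-\<^sup>1\<close> are uniformly bounded, the dyadic approximations \<open>J\<^sub>p\<^sup>n\<close> with \<open>p = 2\<^sup>-\<^sup>k\<close>
  converge because \<open>J\<^sub>2\<^sub>p - J\<^sub>p\<^sup>2 = p\<^sup>2 J\<^sub>2\<^sub>p J\<^sub>p\<^sup>2 A\<^sup>2\<close>. After the shift \<open>A \<mapsto> A + k\<close> the resolvents are contractions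
  in \<open>H\<close>; in the antidual of \<open>V\<close> a discrete energy estimate bounds their powers.

  A solution \<open>u\<close> is the indefinite integral of \<open>g = f - A u\<close>. As \<open>u(s)\<close> lies in \<open>V\<close> for almost every \<open>s\<close> only,
  \<open>s \<mapsto> e\<^sup>-\<^sup>(\<^sup>t\<^sup>-\<^sup>s\<^sup>)\<^sup>A u(s)\<close> cannot be differentiated pointwise. With \<open>R = (k + A)\<^sup>-\<^sup>1\<close>, however,
  \<open>s \<mapsto> e\<^sup>-\<^sup>(\<^sup>t\<^sup>-\<^sup>s\<^sup>)\<^sup>A R\<close> is Lipschitz continuous and strongly differentiable, so integration by parts gives
  Duhamel's formula with \<open>R\<close> applied to both sides, and \<open>R\<close> is injective and commutes with the semigroup.

  For \<open>u\<^sub>0\<close> in the domain of \<open>A\<close> the energy identity bounds the \<open>L\<^sub>2(0,T;V)\<close> norm of \<open>e\<^sup>-\<^sup>t\<^sup>A u\<^sub>0\<close> by the norm of \<open>u\<^sub>0\<close> in \<open>H\<close>;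
  writing a general \<open>u\<^sub>0\<close> as a rapidly convergent series of such elements puts \<open>e\<^sup>-\<^sup>t\<^sup>A u\<^sub>0\<close> into \<open>X\<close>. The integral
  term then belongs to \<open>X\<close> as a difference.
\<close>

section \<open>Strongly continuous semigroups\<close>

text \<open>\<open>exp_minus\<close> is a choice, so nothing is known about it until some strongly
  continuous semigroup with exactly the prescribed generator has been exhibited; generation is
  therefore proved for \<open>lax_milgram j a\<close> and for
  \<open>lax_milgram_ext_graph j a\<close>. The obstacle is the antidual: testing with the solution
  itself bounds the resolvent in H, but not in the dual norm with constant 1, and a constant above 1
  for a single resolvent says nothing useful about its powers. Hence \<open>resolvent_family\<close>
  asks for one bound M on all powers; H is the case M = 1. Step sizes are dyadic so that only
  neighbouring levels have to be compared: one level costs O(2^(-k)) on the domain of the squared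
  operator, which is summable over k, and the power bound extends the limit from this dense set to
  the whole space. The two semigroups are constructed independently; that they agree on H
  (\<open>emb_H_S_H\<close>) comes from uniqueness of orbits and density of the domain. For the
  resolvent R the shift k itself is admissible, because \<open>form k 1\<close> is already
  coercive.\<close>

lemma uniform_boundedness:
  fixes F :: "nat \<Rightarrow> 'a::banach \<Rightarrow> 'b::real_normed_vector"
  assumes lin: "\<And>n. bounded_linear (F n)" and bdd: "\<And>x. \<exists>K. \<forall>n. norm (F n x) \<le> K"
  shows "\<exists>K. \<forall>n x. norm (F n x) \<le> K * norm x"
proof -
  define E where "E K = {x. \<forall>n. norm (F n x) \<le> real K}" for K :: nat
  have cl: "closed (E K)" for K
  proof -
    have "E K = (\<Inter>n. {x. norm (F n x) \<le> real K})" by (auto simp: E_def)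
    moreover have "closed {x. norm (F n x) \<le> real K}" for n
      by (intro closed_Collect_le continuous_intros linear_continuous_on[OF lin])
    ultimately show ?thesis by auto
  qed
  have un: "(\<Union>K. E K) = UNIV"
  proof -
    have "x \<in> (\<Union>K. E K)" for x
    proof -
      obtain C where C: "\<And>n. norm (F n x) \<le> C" using bdd by blast
      obtain K :: nat where "C \<le> K" using real_arch_simple by blast
      then have "x \<in> E K" using C order_trans by (fastforce simp: E_def)
      then show ?thesis by blast
    qed
    then show ?thesis by auto
  qed
  have "\<exists>K. interior (E K) \<noteq> {}"
  proof (rule ccontr)
    assume "\<not> ?thesis"
    then have "euclidean interior_of \<Union>(range E) = {}"
      using Met_TC.metric_Baire_category_alt[where 'a = 'a, of "range E"] cl
      by (auto simp: complete_UNIV)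
    then show False using un by simp
  qed
  then obtain K x where "x \<in> interior (E K)" by auto
  then obtain e where e: "e > 0" "cball x e \<subseteq> E K"
    by (meson interior_subset mem_interior_cball order_trans)
  have "norm (F n y) \<le> (2 * K / e) * norm y" for n y
  proof (cases "y = 0")
    case True then show ?thesis using lin[of n] by (simp add: linear_simps)
  next
    case False
    \<comment> \<open>Both \<open>x + z\<close> and \<open>x\<close> lie in the ball inside
      \<open>E K\<close>; subtracting them gives the factor 2.\<close>
    define z where "z = (e / norm y) *\<^sub>R y"
    have nz: "norm z = e" using False e by (simp add: z_def)
    interpret bounded_linear "F n" by (rule lin)
    have "F n z = F n (x + z) - F n x" by (simp add: add)
    moreover have "norm (F n (x + z)) \<le> K" "norm (F n x) \<le> K"
      using e nz by (auto simp: E_def subset_iff dist_norm)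
    ultimately have "norm (F n z) \<le> 2 * K"
      using norm_triangle_ineq4[of "F n (x + z)" "F n x"] by simp
    moreover have "norm (F n z) = e / norm y * norm (F n y)"
      using False e by (simp add: z_def scaleR)
    ultimately show ?thesis using False e by (simp add: field_simps)
  qed
  then show ?thesis by blast
qed

lemma tendsto_zero_dense:
  fixes F :: "'i \<Rightarrow> 'a::real_normed_vector \<Rightarrow> 'b::real_normed_vector"
  assumes lin: "\<And>i. bounded_linear (F i)" and bdd: "\<forall>\<^sub>F i in G. \<forall>x. norm (F i x) \<le> M * norm x"
    and dense: "closure D = UNIV" and lim: "\<And>x. x \<in> D \<Longrightarrow> ((\<lambda>i. F i x) \<longlongrightarrow> 0) G"
  shows "((\<lambda>i. F i x) \<longlongrightarrow> 0) G"
proof (rule tendstoI)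
  fix e :: real assume e: "e > 0"
  \<comment> \<open>\<open>M\<close> may be zero or negative; \<open>N\<close> is a positive bound
    by which e can be divided.\<close>
  define N where "N = \<bar>M\<bar> + 1"
  have N: "N > 0" "M \<le> N" by (auto simp: N_def)
  have "x \<in> closure D" using dense by simp
  then obtain d where d: "d \<in> D" "dist d x < e / 2 / N"
    using e N unfolding closure_approachable by (metis half_gt_zero divide_pos_pos)
  have "\<forall>\<^sub>F i in G. dist (F i d) 0 < e / 2" using tendstoD[OF lim[OF d(1)], of "e / 2"] e by simp
  then show "\<forall>\<^sub>F i in G. dist (F i x) 0 < e"
    using bdd
  proof eventually_elim
    case (elim i)
    interpret bounded_linear "F i" by (rule lin)
    have "norm (F i x) \<le> norm (F i d) + norm (F i (x - d))"
      using norm_triangle_ineq[of "F i d" "F i (x - d)"] by (simp add: diff)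
    also have "norm (F i (x - d)) \<le> N * norm (x - d)"
      using elim(2) N by (meson mult_right_mono norm_ge_zero order_trans)
    also have "\<dots> < N * (e / 2 / N)"
      using d N by (intro mult_strict_left_mono) (auto simp: dist_norm norm_minus_commute)
    finally show ?case using elim(1) N by simp
  qed
qed

text \<open>With difference quotients as plain limits, joint continuity of a semigroup in time and
  vector (\<open>tendsto_S\<close>) can be applied inside a derivative.\<close>

lemma has_vector_derivative_quotient:
  "(f has_vector_derivative D) (at x within S) \<longleftrightarrow>
    ((\<lambda>y. (f y - f x) /\<^sub>R (y - x)) \<longlongrightarrow> D) (at x within S)"
proof -
  have "(f has_vector_derivative D) (at x within S) \<longleftrightarrow>
    ((\<lambda>y. (f y - f x - (y - x) *\<^sub>R D) /\<^sub>R norm (y - x)) \<longlongrightarrow> 0) (at x within S)"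
    unfolding has_vector_derivative_def has_derivative_at_within
    by (simp add: bounded_linear_scaleR_left)
  also have "\<dots> \<longleftrightarrow> ((\<lambda>y. norm ((f y - f x - (y - x) *\<^sub>R D) /\<^sub>R norm (y - x))) \<longlongrightarrow> 0) (at x within S)"
    by (rule tendsto_norm_zero_iff[symmetric])
  also have "\<dots> \<longleftrightarrow> ((\<lambda>y. norm ((f y - f x) /\<^sub>R (y - x) - D)) \<longlongrightarrow> 0) (at x within S)"
  proof (rule tendsto_cong, unfold eventually_at_filter, intro always_eventually allI impI)
    fix y assume "y \<noteq> x"
    then have "(f y - f x) /\<^sub>R (y - x) - D = (f y - f x - (y - x) *\<^sub>R D) /\<^sub>R (y - x)"
      by (simp add: scaleR_diff_right)
    then show "norm ((f y - f x - (y - x) *\<^sub>R D) /\<^sub>R norm (y - x)) = norm ((f y - f x) /\<^sub>R (y - x) - D)"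
      by simp
  qed
  also have "\<dots> \<longleftrightarrow> ((\<lambda>y. (f y - f x) /\<^sub>R (y - x)) \<longlongrightarrow> D) (at x within S)"
    by (simp add: tendsto_norm_zero_iff LIM_zero_iff)
  finally show ?thesis .
qed

section \<open>Boundedness, continuity and differentiability of orbits\<close>

locale c0 =
  fixes S :: "real \<Rightarrow> 'b::{complex_normed_vector,banach} \<Rightarrow> 'b"
  assumes c0: "C0_semigroup S"
begin

lemma bounded_clinear: "0 \<le> t \<Longrightarrow> bounded_clinear (S t)"
  and S_0 [simp]: "S 0 x = x"
  and S_add: "0 \<le> s \<Longrightarrow> 0 \<le> t \<Longrightarrow> S (s + t) x = S s (S t x)"
  and lim_0: "((\<lambda>t. S t x) \<longlongrightarrow> x) (at_right 0)"
  using c0 unfolding C0_semigroup_def by blast+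

lemma lin: "0 \<le> t \<Longrightarrow> bounded_linear (S t)"
  using bounded_clinear by (simp add: bounded_clinear_def)

text \<open>Otherwise the operators are unbounded along some times tending to 0, although strong
  continuity bounds every single orbit along those times; this contradicts
  \<open>uniform_boundedness\<close>.\<close>

lemma bounded_near_0: "\<exists>\<delta>>0. \<exists>K. \<forall>t\<in>{0..\<delta>}. \<forall>x. norm (S t x) \<le> K * norm x"
proof (rule ccontr)
  assume "\<not> ?thesis"
  then have "\<exists>t x. t \<in> {0..1 / real (Suc n)} \<and> norm (S t x) > real n * norm x" for n
    by (meson not_le of_nat_0_less_iff zero_less_Suc zero_less_divide_1_iff)
  then obtain t where t: "\<And>n. t n \<in> {0..1 / real (Suc n)}"
    and big: "\<And>n. \<exists>x. norm (S (t n) x) > real n * norm x"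
    by metis
  have t0: "t \<longlonglongrightarrow> 0"
    by (rule tendsto_sandwich[OF _ _ tendsto_const LIMSEQ_Suc[OF lim_1_over_n]]) (use t in auto)
  have "\<exists>K. \<forall>n. norm (S (t n) x) \<le> K" for x
  proof -
    \<comment> \<open>The times \<open>t n\<close> may equal 0, so the point 0 has to be included in
      the continuity statement.\<close>
    have "((\<lambda>r. S r x) \<longlongrightarrow> x) (at 0 within {0..})"
      using lim_0[of x] by (simp add: at_within_Ici_at_right)
    then have "continuous (at 0 within {0..}) (\<lambda>r. S r x)" by (simp add: continuous_within)
    then have "(\<lambda>n. S (t n) x) \<longlonglongrightarrow> S 0 x"
      by (rule continuous_within_tendsto_compose') (use t t0 in auto)
    then show ?thesis using convergent_imp_Bseq[of "\<lambda>n. S (t n) x"]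
      by (auto simp: convergent_def Bseq_def)
  qed
  then obtain K where K: "\<And>n x. norm (S (t n) x) \<le> K * norm x"
    using uniform_boundedness[of "\<lambda>n. S (t n)"] t lin by force
  obtain n :: nat where n: "K \<le> n" using real_arch_simple by blast
  obtain x where "norm (S (t n) x) > real n * norm x" using big by blast
  moreover have "K * norm x \<le> real n * norm x" using n by (rule mult_right_mono) simp
  ultimately show False using K[of n x] by linarith
qed

lemma bound: "\<exists>K\<ge>1. \<forall>t\<in>{0..T}. \<forall>x. norm (S t x) \<le> K * norm x"
proof -
  obtain \<delta> L where d: "\<delta> > 0" and L: "\<And>t x. t \<in> {0..\<delta>} \<Longrightarrow> norm (S t x) \<le> L * norm x"
    using bounded_near_0 by blast
  define K where "K = max L 1"
  have K: "K \<ge> 1" and KL: "norm (S t x) \<le> K * norm x" if "t \<in> {0..\<delta>}" for t x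
    using L[OF that, of x] mult_right_mono[of L K "norm x"] by (auto simp: K_def)
  have K1: "K \<ge> 1" by (simp add: K_def)
  have *: "\<forall>t\<in>{0..n * \<delta>}. \<forall>x. norm (S t x) \<le> K ^ n * norm x" for n :: nat
  proof (induction n)
    case 0 then show ?case by auto
  next
    case (Suc n)
    show ?case
    proof (intro ballI allI)
      fix t x assume t: "t \<in> {0..Suc n * \<delta>}"
      show "norm (S t x) \<le> K ^ Suc n * norm x"
      proof (cases "t \<le> \<delta>")
        case True
        have "norm (S t x) \<le> K * norm x" using KL t True by auto
        also have "\<dots> \<le> K ^ Suc n * norm x"
          using K1 power_increasing[of 1 "Suc n" K] by (intro mult_right_mono) auto
        finally show ?thesis .
      next
        case False
        then have "S t x = S (t - \<delta>) (S \<delta> x)" using S_add[of "t - \<delta>" \<delta> x] d by simp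
        also have "norm \<dots> \<le> K ^ n * norm (S \<delta> x)"
          using Suc[rule_format, of "t - \<delta>" "S \<delta> x"] False t by (simp add: algebra_simps)
        also have "\<dots> \<le> K ^ n * (K * norm x)"
          using KL[of \<delta> x] d K1 by (intro mult_left_mono) auto
        finally show ?thesis by (simp add: algebra_simps)
      qed
    qed
  qed
  obtain n :: nat where "T / \<delta> \<le> n" using real_arch_simple by blast
  then have "T \<le> n * \<delta>" using d by (simp add: field_simps)
  then show ?thesis using *[of n] K1 by (intro exI[of _ "K ^ n"]) auto
qed

text \<open>Factoring out the earlier of the two times reduces continuity at any time, from either
  side, to right continuity at 0.\<close>

lemma orbit_diff:
  assumes "\<And>t x. t \<in> {0..T} \<Longrightarrow> norm (S t x) \<le> K * norm x" "s \<in> {0..T}" "t \<in> {0..T}"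
  shows "norm (S t x - S s x) \<le> K * norm (S \<bar>t - s\<bar> x - x)"
proof -
  have *: "norm (S t x - S s x) \<le> K * norm (S \<bar>t - s\<bar> x - x)"
    if "s \<le> t" "s \<in> {0..T}" "t \<in> {0..T}" for s t
  proof -
    have "S t x - S s x = S s (S (t - s) x - x)"
      using S_add[of s "t - s" x] that lin[of s] by (simp add: linear_simps)
    then show ?thesis using assms(1)[of s "S (t - s) x - x"] that by simp
  qed
  show ?thesis
  proof (cases "s \<le> t")
    case True then show ?thesis using * assms by blast
  next
    case False
    then show ?thesis using *[of t s] assms by (simp add: norm_minus_commute abs_minus_commute)
  qed
qed

text \<open>Time and vector vary together. This joint continuity is what the uniform bound on
  compact time intervals buys, and it replaces operator norm continuity in all later product
  rules.\<close>

lemma tendsto_S: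
  assumes \<tau>: "(\<tau> \<longlongrightarrow> t) F" "\<forall>\<^sub>F r in F. 0 \<le> \<tau> r" "0 \<le> t" and \<xi>: "(\<xi> \<longlongrightarrow> x) F"
  shows "((\<lambda>r. S (\<tau> r) (\<xi> r)) \<longlongrightarrow> S t x) F"
proof -
  obtain K where K: "K \<ge> 1" "\<And>s x. s \<in> {0..t+1} \<Longrightarrow> norm (S s x) \<le> K * norm x"
    using bound[of "t + 1"] by blast
  \<comment> \<open>The modulus turns the limit from the right into a two-sided one, so that
    \<open>\<tau> r\<close> may approach \<open>t\<close> from either side.\<close>
  have "((\<lambda>r. S \<bar>r\<bar> x) \<longlongrightarrow> x) (at 0)"
    by (rule filterlim_compose[OF lim_0]) (auto simp: filterlim_at eventually_at_filter intro!: tendsto_eq_intros)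
  then have "isCont (\<lambda>r. S \<bar>r\<bar> x) 0" by (simp add: isCont_def)
  moreover have "((\<lambda>r. \<tau> r - t) \<longlongrightarrow> 0) F" using \<tau>(1) by (simp add: LIM_zero_iff)
  ultimately have "((\<lambda>r. S \<bar>\<tau> r - t\<bar> x) \<longlongrightarrow> S \<bar>0\<bar> x) F" by (rule isCont_tendsto_compose)
  then have 1: "((\<lambda>r. S \<bar>\<tau> r - t\<bar> x - x) \<longlongrightarrow> 0) F" by (simp add: LIM_zero_iff)
  have "((\<lambda>r. K * norm (\<xi> r - x) + K * norm (S \<bar>\<tau> r - t\<bar> x - x)) \<longlongrightarrow> K * norm (x - x) + K * norm (0::'b)) F"
    by (intro tendsto_intros \<xi> 1)
  then have lim: "((\<lambda>r. K * norm (\<xi> r - x) + K * norm (S \<bar>\<tau> r - t\<bar> x - x)) \<longlongrightarrow> 0) F" by simp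
  have "\<forall>\<^sub>F r in F. dist (\<tau> r) t < 1" using tendstoD[OF \<tau>(1), of 1] by simp
  then have "\<forall>\<^sub>F r in F. norm (S (\<tau> r) (\<xi> r) - S t x) \<le> K * norm (\<xi> r - x) + K * norm (S \<bar>\<tau> r - t\<bar> x - x)"
    using \<tau>(2)
  proof eventually_elim
    case (elim r)
    then have r: "\<tau> r \<in> {0..t+1}" by (auto simp: dist_real_def)
    have "S (\<tau> r) (\<xi> r) - S t x = S (\<tau> r) (\<xi> r - x) + (S (\<tau> r) x - S t x)"
      using lin[of "\<tau> r"] r by (simp add: linear_simps)
    also have "norm \<dots> \<le> K * norm (\<xi> r - x) + K * norm (S \<bar>\<tau> r - t\<bar> x - x)"
      using K(2)[OF r] orbit_diff[of "t + 1" K t "\<tau> r" x] K(2) r \<tau>(3)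
      by (intro norm_triangle_mono) auto
    finally show ?case .
  qed
  then have "((\<lambda>r. S (\<tau> r) (\<xi> r) - S t x) \<longlongrightarrow> 0) F" using lim by (rule Lim_null_comparison)
  then show ?thesis by (rule LIM_zero_cancel)
qed

lemma continuous_orbit: "continuous_on {0..} (\<lambda>t. S t x)"
  unfolding continuous_on_def by (auto intro!: tendsto_S tendsto_intros simp: eventually_at_filter)

lemma generator_S:
  assumes "(x, y) \<in> generator S" "0 \<le> t" shows "(S t x, S t y) \<in> generator S"
proof -
  interpret St: bounded_linear "S t" by (rule lin) fact
  have "((\<lambda>h. S t ((S h x - x) /\<^sub>R h)) \<longlongrightarrow> S t y) (at_right 0)"
    using assms by (intro St.tendsto) (simp add: generator_def)
  moreover have "\<forall>\<^sub>F h in at_right 0. S t ((S h x - x) /\<^sub>R h) = (S h (S t x) - S t x) /\<^sub>R h"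
    unfolding eventually_at_filter
  proof (intro always_eventually allI impI)
    fix h :: real assume "h \<in> {0<..}"
    then show "S t ((S h x - x) /\<^sub>R h) = (S h (S t x) - S t x) /\<^sub>R h"
      using S_add[of t h x] S_add[of h t x] assms
      by (simp add: St.scaleR St.diff add.commute)
  qed
  ultimately show ?thesis
    by (simp add: generator_def) (rule Lim_transform_eventually)
qed

text \<open>For \<open>r\<close> on either side of \<open>t\<close> the difference quotient is
  \<open>S (min r t)\<close> applied to the quotient at 0 with increment |r - t|. Thus the one-sided
  limit in \<open>generator\<close> yields a two-sided derivative.\<close>

lemma deriv_S:
  assumes "(x, y) \<in> generator S" "0 \<le> t"
  shows "((\<lambda>t. S t x) has_vector_derivative S t y) (at t within {0..})"
  unfolding has_vector_derivative_quotient
proof (rule Lim_transform_eventually)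
  have "((\<lambda>r. \<bar>r - t\<bar>) \<longlongrightarrow> 0) (at t within {0..})"
    by (auto intro!: tendsto_eq_intros)
  then have "LIM r at t within {0..}. \<bar>r - t\<bar> :> at_right 0"
    by (auto simp: filterlim_at eventually_at_filter)
  then have "((\<lambda>r. (S \<bar>r - t\<bar> x - x) /\<^sub>R \<bar>r - t\<bar>) \<longlongrightarrow> y) (at t within {0..})"
    using assms filterlim_compose by (fastforce simp: generator_def)
  moreover have "((\<lambda>r. min r t) \<longlongrightarrow> t) (at t within {0..})"
    by (auto intro!: tendsto_eq_intros)
  ultimately show "((\<lambda>r. S (min r t) ((S \<bar>r - t\<bar> x - x) /\<^sub>R \<bar>r - t\<bar>)) \<longlongrightarrow> S t y) (at t within {0..})"
    using assms by (intro tendsto_S) (auto simp: eventually_at_filter)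
  show "\<forall>\<^sub>F r in at t within {0..}. S (min r t) ((S \<bar>r - t\<bar> x - x) /\<^sub>R \<bar>r - t\<bar>) = (S r x - S t x) /\<^sub>R (r - t)"
    unfolding eventually_at_filter
  proof (intro always_eventually allI impI)
    fix r :: real assume r: "r \<noteq> t" "r \<in> {0..}"
    interpret M: bounded_linear "S (min r t)" using r assms by (intro lin) auto
    show "S (min r t) ((S \<bar>r - t\<bar> x - x) /\<^sub>R \<bar>r - t\<bar>) = (S r x - S t x) /\<^sub>R (r - t)"
    proof (cases "r < t")
      case True
      interpret N: bounded_linear "S r" using r by (intro lin) auto
      have "S t x = S r (S (t - r) x)" using S_add[of r "t - r" x] True r by simp
      moreover have "inverse (t - r) = - inverse (r - t)" using True nonzero_inverse_minus_eq[of "r - t"] by simp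
      ultimately show ?thesis using True
        by (simp add: min_def N.scaleR N.diff scaleR_diff_right)
    next
      case False
      have "S r x = S t (S (r - t) x)" using S_add[of t "r - t" x] False assms by simp
      then show ?thesis using False r M.scaleR M.diff by (simp add: min_def)
    qed
  qed
qed

text \<open>The function s -> S (t - s) (y s) has derivative zero, so its values at 0 and t agree.
  As \<open>S\<close> is only strongly continuous, the product rule is carried out on difference
  quotients.\<close>

lemma orbit_unique:
  assumes "0 \<le> t"
    and deriv: "\<And>s. s \<in> {0..t} \<Longrightarrow> (y has_vector_derivative y' s) (at s within {0..t})"
    and gen: "\<And>s. s \<in> {0..t} \<Longrightarrow> (y s, y' s) \<in> generator S"
  shows "y t = S t (y 0)"
proof -
  have "((\<lambda>s. S (t - s) (y s)) has_vector_derivative 0) (at s within {0..t})" if s: "s \<in> {0..t}" for s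
    unfolding has_vector_derivative_quotient
  proof (rule Lim_transform_eventually)
    have 1: "((\<lambda>r. S (t - r) ((y r - y s) /\<^sub>R (r - s))) \<longlongrightarrow> S (t - s) (y' s)) (at s within {0..t})"
      using deriv[OF s] s
      by (intro tendsto_S) (auto simp: has_vector_derivative_quotient eventually_at_filter intro!: tendsto_intros)
    have "((\<lambda>\<sigma>. S \<sigma> (y s)) has_vector_derivative S (t - s) (y' s)) (at (t - s) within (\<lambda>r. t - r) ` {0..t})"
      by (rule has_vector_derivative_within_subset[OF deriv_S[OF gen[OF s]]]) (use s in auto)
    moreover have "((\<lambda>r. t - r) has_vector_derivative -1) (at s within {0..t})"
      by (auto intro!: derivative_eq_intros)
    ultimately have "((\<lambda>r. S (t - r) (y s)) has_vector_derivative - S (t - s) (y' s)) (at s within {0..t})"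
      using vector_diff_chain_within[of "\<lambda>r. t - r" "-1" s "{0..t}"] by (auto simp: o_def)
    then have 2: "((\<lambda>r. (S (t - r) (y s) - S (t - s) (y s)) /\<^sub>R (r - s)) \<longlongrightarrow> - S (t - s) (y' s)) (at s within {0..t})"
      by (simp add: has_vector_derivative_quotient)
    show "((\<lambda>r. S (t - r) ((y r - y s) /\<^sub>R (r - s)) + (S (t - r) (y s) - S (t - s) (y s)) /\<^sub>R (r - s))
        \<longlongrightarrow> 0) (at s within {0..t})"
      using tendsto_add[OF 1 2] by simp
    show "\<forall>\<^sub>F r in at s within {0..t}. S (t - r) ((y r - y s) /\<^sub>R (r - s)) + (S (t - r) (y s) - S (t - s) (y s)) /\<^sub>R (r - s)
        = (S (t - r) (y r) - S (t - s) (y s)) /\<^sub>R (r - s)"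
      unfolding eventually_at_filter
    proof (intro always_eventually allI impI)
      fix r :: real assume r: "r \<in> {0..t}"
      interpret M: bounded_linear "S (t - r)" using r by (intro lin) auto
      show "S (t - r) ((y r - y s) /\<^sub>R (r - s)) + (S (t - r) (y s) - S (t - s) (y s)) /\<^sub>R (r - s)
        = (S (t - r) (y r) - S (t - s) (y s)) /\<^sub>R (r - s)"
        by (simp add: M.scaleR M.diff scaleR_diff_right)
    qed
  qed
  then obtain c where "\<And>s. s \<in> {0..t} \<Longrightarrow> S (t - s) (y s) = c"
    by (rule has_vector_derivative_zero_constant[rotated]) auto
  from this[of 0] this[of t] show ?thesis using assms(1) by simp
qed

text \<open>The first two hypotheses say that \<open>R\<close> is a right and a left inverse of l
  minus the generator; the generator commutes with \<open>S t\<close> on its domain, hence so does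
  its resolvent.\<close>

lemma resolvent_commute:
  assumes "\<And>x. (R x, l *\<^sub>R R x - x) \<in> generator S"
    and "\<And>x y. (x, y) \<in> generator S \<Longrightarrow> R (l *\<^sub>R x - y) = x" and "0 \<le> t"
  shows "S t (R x) = R (S t x)"
proof -
  interpret St: bounded_linear "S t" by (rule lin) fact
  have "(S t (R x), S t (l *\<^sub>R R x - x)) \<in> generator S" by (intro generator_S assms)
  then have "R (l *\<^sub>R S t (R x) - S t (l *\<^sub>R R x - x)) = S t (R x)" by (rule assms(2))
  then show ?thesis by (simp add: St.diff St.scaleR)
qed

end

section \<open>Exponential rescaling of semigroups and generators\<close>

lemma C0_semigroup_exp_shift:
  fixes S :: "real \<Rightarrow> 'b::{complex_normed_vector,banach} \<Rightarrow> 'b"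
  assumes "C0_semigroup S"
  shows "C0_semigroup (\<lambda>t x. exp (k * t) *\<^sub>R S t x)"
proof -
  interpret c0 S by unfold_locales fact
  have scale: "exp (k * t) *\<^sub>R (c *\<^sub>C x) = c *\<^sub>C (exp (k * t) *\<^sub>R x)" for t c and x :: 'b
    by (simp add: scaleC_of_real[symmetric] scaleC_scaleC mult.commute)
  have "((\<lambda>t. exp (k * t) *\<^sub>R S t x) \<longlongrightarrow> exp (k * 0) *\<^sub>R x) (at_right 0)" for x
    by (intro tendsto_intros lim_0)
  moreover have "bounded_clinear (\<lambda>x. exp (k * t) *\<^sub>R S t x)" if "0 \<le> t" for t
    using bounded_clinear[OF that]
    by (simp add: bounded_clinear_def scale bounded_linear_const_scaleR)
  moreover have "exp (k * (s + t)) *\<^sub>R S (s + t) x = exp (k * s) *\<^sub>R S s (exp (k * t) *\<^sub>R S t x)"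
    if "0 \<le> s" "0 \<le> t" for s t x
    using lin[OF that(1)] S_add[OF that] by (simp add: linear_simps exp_add distrib_left)
  ultimately show ?thesis by (simp add: C0_semigroup_def)
qed

lemma generator_exp_shift_subset:
  fixes S :: "real \<Rightarrow> 'b::{complex_normed_vector,banach} \<Rightarrow> 'b"
  assumes "C0_semigroup S" "(x, y) \<in> generator S"
  shows "(x, y + k *\<^sub>R x) \<in> generator (\<lambda>t x. exp (k * t) *\<^sub>R S t x)"
proof -
  interpret c0 S by unfold_locales fact
  have "((\<lambda>h. exp (k * h)) has_vector_derivative k) (at 0 within {0..})"
    by (auto intro!: derivative_eq_intros simp: has_real_derivative_iff_has_vector_derivative[symmetric])
  then have "((\<lambda>h. (exp (k * h) - 1) / h) \<longlongrightarrow> k) (at_right 0)"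
    by (simp add: has_vector_derivative_quotient at_within_Ici_at_right divide_inverse mult.commute)
  moreover have "((\<lambda>h. exp (k * h)) \<longlongrightarrow> exp (k * 0)) (at_right 0)" by (intro tendsto_intros)
  ultimately have "((\<lambda>h. exp (k * h) *\<^sub>R ((S h x - x) /\<^sub>R h) + ((exp (k * h) - 1) / h) *\<^sub>R x)
      \<longlongrightarrow> exp (k * 0) *\<^sub>R y + k *\<^sub>R x) (at_right 0)"
    using assms(2) by (intro tendsto_intros) (auto simp: generator_def)
  moreover have "exp (k * h) *\<^sub>R ((S h x - x) /\<^sub>R h) + ((exp (k * h) - 1) / h) *\<^sub>R x
      = (exp (k * h) *\<^sub>R S h x - x) /\<^sub>R h" for h
    by (simp add: algebra_simps divide_inverse scaleR_diff_right scaleR_diff_left)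
  ultimately show ?thesis by (simp add: generator_def)
qed

lemma generator_exp_shift:
  fixes S :: "real \<Rightarrow> 'b::{complex_normed_vector,banach} \<Rightarrow> 'b"
  assumes "C0_semigroup S"
  shows "generator (\<lambda>t x. exp (k * t) *\<^sub>R S t x) = {(x, y + k *\<^sub>R x) | x y. (x, y) \<in> generator S}"
    (is "generator ?S = ?G")
proof
  show "?G \<subseteq> generator ?S" using generator_exp_shift_subset[OF assms] by auto
  show "generator ?S \<subseteq> ?G"
  proof (clarify)
    fix x y assume "(x, y) \<in> generator ?S"
    \<comment> \<open>The reverse inclusion is the forward one applied to the rescaled semigroup
      with -k, which restores \<open>S\<close>.\<close>
    from generator_exp_shift_subset[OF C0_semigroup_exp_shift[OF assms] this, of "-k"]
    have "(x, y - k *\<^sub>R x) \<in> generator S" by (simp add: exp_minus)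
    then show "\<exists>x' y'. (x, y) = (x', y' + k *\<^sub>R x') \<and> (x', y') \<in> generator S"
      by (intro exI[of _ x] exI[of _ "y - k *\<^sub>R x"]) simp
  qed
qed

section \<open>Generation of semigroups by the backward Euler scheme\<close>

lemma bounded_linear_scaleC: "bounded_linear (\<lambda>x::'b::complex_normed_vector. c *\<^sub>C x)"
proof (rule bounded_linear_intro[where K = "cmod c"])
  show "c *\<^sub>C r *\<^sub>R x = r *\<^sub>R c *\<^sub>C x" for r and x :: 'b
    by (simp add: scaleC_of_real[symmetric] scaleC_scaleC mult.commute)
qed (auto simp: scaleC_add_right norm_scaleC mult.commute)

lemma bounded_clinear_limit:
  fixes F :: "nat \<Rightarrow> 'a::complex_normed_vector \<Rightarrow> 'b::complex_normed_vector"
  assumes F: "\<And>k. bounded_clinear (F k)" and bound: "\<And>k x. norm (F k x) \<le> M * norm x"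
    and lim: "\<And>x. (\<lambda>k. F k x) \<longlonglongrightarrow> L x"
  shows "bounded_clinear L" and "norm (L x) \<le> M * norm x"
proof -
  have le: "norm (L x) \<le> M * norm x" for x
    using LIMSEQ_le_const2[OF tendsto_norm[OF lim[of x]]] bound by blast
  show "norm (L x) \<le> M * norm x" by (rule le)
  have lin: "bounded_linear (F k)" for k using F by (simp add: bounded_clinear_def)
  have "bounded_linear L"
  proof (rule bounded_linear_intro)
    fix x y
    have "(\<lambda>k. F k (x + y)) \<longlonglongrightarrow> L x + L y"
      using tendsto_add[OF lim[of x] lim[of y]] by (simp add: linear_simps[OF lin])
    then show "L (x + y) = L x + L y" using LIMSEQ_unique lim by blast
  next
    fix r x
    have "(\<lambda>k. F k (r *\<^sub>R x)) \<longlonglongrightarrow> r *\<^sub>R L x"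
      using tendsto_scaleR[OF tendsto_const lim[of x], of r] by (simp add: linear_simps[OF lin])
    then show "L (r *\<^sub>R x) = r *\<^sub>R L x" using LIMSEQ_unique lim by blast
  qed (use le in \<open>simp add: mult.commute\<close>)
  moreover have "L (c *\<^sub>C x) = c *\<^sub>C L x" for c x
  proof -
    have "(\<lambda>k. F k (c *\<^sub>C x)) \<longlonglongrightarrow> c *\<^sub>C L x"
      using bounded_linear.tendsto[OF bounded_linear_scaleC lim[of x], of c] F
      by (simp add: bounded_clinear_def)
    then show ?thesis using LIMSEQ_unique lim by blast
  qed
  ultimately show "bounded_clinear L" by (simp add: bounded_clinear_def)
qed

lemma convergent_geometric_steps:
  fixes f :: "nat \<Rightarrow> 'a::banach"
  assumes "\<And>k. norm (f (Suc k) - f k) \<le> C * (1 / 2) ^ k"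
  shows "convergent f"
proof -
  have "summable (\<lambda>k. f (Suc k) - f k)"
    by (rule summable_comparison_test'[of "\<lambda>k. C * (1 / 2) ^ k"])
      (use assms in \<open>auto intro: summable_mult summable_geometric\<close>)
  then have "convergent (\<lambda>n. f n - f 0)"
    by (simp add: summable_iff_convergent sum_lessThan_telescope)
  then have "convergent (\<lambda>n. (f n - f 0) + f 0)" by (intro convergent_add convergent_const)
  then show ?thesis by simp
qed

text \<open>The power-bounded Hille-Yosida setting with G minus the generator: \<open>J h\<close> is
  (1 + h G)^(-1), where \<open>J_G\<close> and \<open>G_J\<close> express the right and the left
  inverse. One constant serves all powers and all step sizes.\<close>

locale resolvent_family =
  fixes G :: "('b::{complex_normed_vector,banach} \<times> 'b) set" and J :: "real \<Rightarrow> 'b \<Rightarrow> 'b" and M :: real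
  assumes clin_J: "0 < h \<Longrightarrow> bounded_clinear (J h)"
    and J_G: "0 < h \<Longrightarrow> (J h x, (x - J h x) /\<^sub>R h) \<in> G"
    and G_J: "0 < h \<Longrightarrow> (x, y) \<in> G \<Longrightarrow> J h (x + h *\<^sub>R y) = x"
    and norm_J_pow: "0 < h \<Longrightarrow> norm ((J h ^^ n) x) \<le> M * norm x"
    and M_ge_1: "1 \<le> M"
    and dense: "closure (Domain G) = UNIV"
begin

lemma clin_pow: "0 < h \<Longrightarrow> bounded_clinear (J h ^^ n)"
proof (induction n)
  case 0 then show ?case by (simp add: bounded_clinear_def id_def bounded_linear_ident)
next
  case (Suc n)
  then show ?case using clin_J[of h] bounded_linear_compose[of "J h" "J h ^^ n"]
    by (auto simp: bounded_clinear_def o_def)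
qed

lemma lin_pow: "0 < h \<Longrightarrow> bounded_linear (J h ^^ n)"
  using clin_pow by (simp add: bounded_clinear_def)

lemma lin_J: "0 < h \<Longrightarrow> bounded_linear (J h)"
  using clin_J by (simp add: bounded_clinear_def)

lemma norm_J: "0 < h \<Longrightarrow> norm (J h x) \<le> M * norm x"
  using norm_J_pow[of h 1 x] by simp

section \<open>Resolvent identities and estimates for powers\<close>

lemma J_mem:
  assumes "0 < h" "(x, y) \<in> G"
  shows J_diff: "x - J h x = h *\<^sub>R J h y" and "(J h x, J h y) \<in> G"
proof -
  have "J h x + h *\<^sub>R J h y = x"
    using G_J[OF assms] by (simp add: linear_simps[OF lin_J[OF assms(1)]])
  then show *: "x - J h x = h *\<^sub>R J h y" by (metis add_diff_cancel_left')
  show "(J h x, J h y) \<in> G" using J_G[OF assms(1), of x] assms(1) by (simp add: *)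
qed

text \<open>Applying \<open>J p\<close> to x = v + q w with w = G v stays inside the graph, so
  \<open>J p v\<close> solves the resolvent equation with right-hand side
  \<open>J p x\<close>.\<close>

lemma J_commute:
  assumes "0 < p" "0 < q" shows "J p (J q x) = J q (J p x)"
proof -
  define v w where "v = J q x" and "w = (x - v) /\<^sub>R q"
  have x: "x = v + q *\<^sub>R w" using assms by (simp add: w_def)
  have "(v, w) \<in> G" using J_G[OF assms(2), of x] by (simp add: v_def w_def)
  then have "J q (J p v + q *\<^sub>R J p w) = J p v" using G_J J_mem assms by blast
  then have "J q (J p x) = J p v"
    by (subst x) (simp add: linear_simps[OF lin_J[OF assms(1)]])
  then show ?thesis by (simp add: v_def)
qed

lemma double_step:
  assumes p: "0 < p" and "(x, y) \<in> G" "(y, z) \<in> G"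
  shows "J (2 * p) x - J p (J p x) = p\<^sup>2 *\<^sub>R J (2 * p) (J p (J p z))"
proof -
  interpret P: bounded_linear "J p" by (rule lin_J) fact
  interpret U: bounded_linear "J (2 * p)" by (rule lin_J) (use p in simp)
  \<comment> \<open>\<open>?s\<close> is (1 + 2pG) x, and adding
    \<open>p\<^sup>2 *\<^sub>R z\<close> turns it into (1 + pG)^2 x. Each is undone by its own
    resolvent, so the discrepancy of the two schemes is exactly the \<open>z\<close> term.\<close>
  let ?s = "x + (2 * p) *\<^sub>R y"
  have "J p (?s + p\<^sup>2 *\<^sub>R z) = J p (x + p *\<^sub>R y) + p *\<^sub>R J p (y + p *\<^sub>R z)"
    by (simp add: P.add P.scaleR scaleR_left_distrib[symmetric] power2_eq_square scaleR_add_right)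
  also have "\<dots> = x + p *\<^sub>R y" using assms G_J by simp
  finally have W: "J p (J p (?s + p\<^sup>2 *\<^sub>R z)) = x" using assms G_J by simp
  have "J (2 * p) ?s = x" using assms G_J by simp
  then have "J p (J p x) = J (2 * p) (J p (J p ?s))"
    using J_commute[of p "2 * p"] p by (metis mult_pos_pos zero_less_numeral)
  moreover have "J (2 * p) x = J (2 * p) (J p (J p ?s)) + p\<^sup>2 *\<^sub>R J (2 * p) (J p (J p z))"
    by (subst (1) W[symmetric]) (simp add: P.add P.scaleR U.add U.scaleR)
  ultimately show ?thesis by simp
qed

text \<open>The local errors of \<open>double_step\<close> are summed. The bound \<open>K\<close> is
  required along the even powers applied to \<open>z\<close> because this form is inherited by
  \<open>J p (J p z)\<close> with the same K; a bound on the norm of z alone would pick up a factor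
  M in every induction step.\<close>

lemma double_steps:
  assumes p: "0 < p"
  shows "(x, y) \<in> G \<Longrightarrow> (y, z) \<in> G \<Longrightarrow> (\<And>m. norm ((J p ^^ (2 * m)) z) \<le> K) \<Longrightarrow>
    norm ((J (2 * p) ^^ n) x - (J p ^^ (2 * n)) x) \<le> n * p\<^sup>2 * M * K"
proof (induction n arbitrary: x y z)
  case 0 then show ?case by simp
next
  case (Suc n)
  let ?W = "\<lambda>x. J p (J p x)"
  let ?U = "J (2 * p)"
  interpret Un: bounded_linear "?U ^^ n" by (rule lin_pow) (use p in simp)
  have W: "(J p ^^ (2 * Suc m)) v = (J p ^^ (2 * m)) (?W v)" for v m
    by (simp add: funpow_swap1)
  have U: "(?U ^^ Suc m) v = (?U ^^ m) (?U v)" for v m by (simp add: funpow_swap1)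
  have "norm ((J p ^^ (2 * m)) (?W z)) \<le> K" for m
    using Suc.prems(3)[of "Suc m"] by (simp only: W)
  then have "norm ((?U ^^ n) (?W x) - (J p ^^ (2 * n)) (?W x)) \<le> n * p\<^sup>2 * M * K"
    using Suc.prems(1,2) p by (intro Suc.IH[of "?W x" "?W y" "?W z"] J_mem)
  moreover have "(?U ^^ n) (?U x - ?W x) = p\<^sup>2 *\<^sub>R (?U ^^ Suc n) (?W z)"
    using double_step[OF p Suc.prems(1,2)] U by (simp add: Un.scaleR)
  moreover have "norm ((?U ^^ Suc n) (?W z)) \<le> M * norm (?W z)"
    using p by (intro norm_J_pow) simp
  moreover have "M * norm (?W z) \<le> M * K"
    using Suc.prems(3)[of 1] M_ge_1 by (intro mult_left_mono) (auto simp: numeral_2_eq_2)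
  ultimately have "norm ((?U ^^ n) (?U x - ?W x)) + norm ((?U ^^ n) (?W x) - (J p ^^ (2 * n)) (?W x))
      \<le> p\<^sup>2 * (M * K) + n * p\<^sup>2 * M * K"
    by (intro add_mono) (auto intro!: mult_left_mono)
  note le = this
  have eq: "(?U ^^ Suc n) x - (J p ^^ (2 * Suc n)) x
      = (?U ^^ n) (?U x - ?W x) + ((?U ^^ n) (?W x) - (J p ^^ (2 * n)) (?W x))"
    unfolding W U by (simp add: Un.diff)
  have "norm ((?U ^^ Suc n) x - (J p ^^ (2 * Suc n)) x) \<le> p\<^sup>2 * (M * K) + n * p\<^sup>2 * M * K"
    unfolding eq by (rule order_trans[OF norm_triangle_ineq le])
  also have "\<dots> = Suc n * p\<^sup>2 * M * K" by (simp add: algebra_simps)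
  finally show ?case .
qed

lemma one_step:
  assumes "0 < p" "(x, y) \<in> G"
  shows "(J p ^^ Suc n) x - (J p ^^ n) x = - (p *\<^sub>R (J p ^^ Suc n) y)"
proof -
  interpret bounded_linear "J p ^^ n" by (rule lin_pow) fact
  have "(J p ^^ Suc n) x - (J p ^^ n) x = (J p ^^ n) (- (p *\<^sub>R J p y))"
    using J_diff[OF assms] by (metis diff funpow_Suc_right comp_apply minus_diff_eq)
  then show ?thesis by (simp add: neg scaleR funpow_swap1)
qed

lemma pow_diff:
  assumes "0 < p" "(x, y) \<in> G"
  shows "norm ((J p ^^ n) x - x) \<le> n * p * M * norm y"
proof (induction n)
  case (Suc n)
  have "norm ((J p ^^ Suc n) x - (J p ^^ n) x) \<le> p * (M * norm y)"
    unfolding one_step[OF assms] norm_minus_cancel norm_scaleR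
    using assms(1) by (intro mult_mono norm_J_pow) auto
  then show ?case
    using Suc norm_triangle_ineq[of "(J p ^^ Suc n) x - (J p ^^ n) x" "(J p ^^ n) x - x"]
    by (simp add: algebra_simps)
qed simp

text \<open>First order Taylor expansion of the discrete orbit: step i contributes -p J^(i+1) y,
  which differs from -p y by at most p c. In the limit this identifies the generator.\<close>

lemma pow_diff_linear:
  assumes "0 < p" "(x, y) \<in> G" "\<And>i. i \<le> n \<Longrightarrow> norm ((J p ^^ i) y - y) \<le> c"
  shows "norm ((J p ^^ n) x - x + (n * p) *\<^sub>R y) \<le> n * p * c"
  using assms(3)
proof (induction n)
  case (Suc n)
  have "(J p ^^ Suc n) x - x + (Suc n * p) *\<^sub>R y
    = ((J p ^^ n) x - x + (n * p) *\<^sub>R y) + - (p *\<^sub>R ((J p ^^ Suc n) y - y))"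
    using one_step[OF assms(1,2), of n] by (simp add: algebra_simps)
  also have "norm \<dots> \<le> n * p * c + p * c"
  proof (rule norm_triangle_mono)
    show "norm ((J p ^^ n) x - x + (n * p) *\<^sub>R y) \<le> n * p * c" using Suc by simp
    show "norm (- (p *\<^sub>R ((J p ^^ Suc n) y - y))) \<le> p * c"
      unfolding norm_minus_cancel norm_scaleR
      using Suc.prems[of "Suc n"] assms(1) by (intro mult_mono) auto
  qed
  finally show ?case by (simp add: algebra_simps)
qed simp

text \<open>The range of \<open>J 1\<close> is the domain, hence dense, and a bounded operator with
  dense range maps dense sets to dense sets. So the range of the square of \<open>J 1\<close> is
  dense, and it lies in the domain of the square of G.\<close>

lemma dense_domain_square: "closure {x. \<exists>y z. (x, y) \<in> G \<and> (y, z) \<in> G} = UNIV"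
proof -
  have J2: "\<exists>y z. (J 1 (J 1 w), y) \<in> G \<and> (y, z) \<in> G" for w
  proof -
    have v: "(J 1 w, w - J 1 w) \<in> G" "(J 1 (J 1 w), J 1 w - J 1 (J 1 w)) \<in> G"
      using J_G[of 1 w] J_G[of 1 "J 1 w"] by simp_all
    have "J 1 w - J 1 (J 1 w) = J 1 (w - J 1 w)" using J_diff[OF _ v(1), of 1] by simp
    then show ?thesis using v(2) J_G[of 1 "w - J 1 w"] by auto
  qed
  have dom: "\<exists>w. x = J 1 w" if "x \<in> Domain G" for x
  proof -
    obtain y where "(x, y) \<in> G" using \<open>x \<in> Domain G\<close> by blast
    from G_J[OF zero_less_one this] show ?thesis by (intro exI) (rule sym)
  qed
  have "x \<in> closure {x. \<exists>y z. (x, y) \<in> G \<and> (y, z) \<in> G}" for x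
    unfolding closure_approachable
  proof (intro allI impI)
    fix e :: real assume e: "e > 0"
    have cl: "\<exists>w. dist (J 1 w) x < e" if "e > 0" for x e
    proof -
      have "x \<in> closure (Domain G)" using dense by simp
      then obtain d where "d \<in> Domain G" "dist d x < e"
        using \<open>e > 0\<close> unfolding closure_approachable by blast
      then show ?thesis using dom by blast
    qed
    obtain a where a: "dist (J 1 a) x < e / 2" using cl[of "e / 2" x] e by auto
    obtain b where b: "dist (J 1 b) a < e / (2 * M)" using cl[of "e / (2 * M)" a] e M_ge_1 by auto
    have "dist (J 1 (J 1 b)) (J 1 a) \<le> M * dist (J 1 b) a"
      using norm_J[of 1 "J 1 b - a"] by (simp add: dist_norm linear_simps[OF lin_J])
    also have "\<dots> < M * (e / (2 * M))" using b M_ge_1 by (intro mult_strict_left_mono) auto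
    finally have "dist (J 1 (J 1 b)) (J 1 a) < e / 2" using M_ge_1 by simp
    then have "dist (J 1 (J 1 b)) x < e" using a dist_triangle[of "J 1 (J 1 b)" x "J 1 a"] by simp
    then show "\<exists>y\<in>{x. \<exists>y z. (x, y) \<in> G \<and> (y, z) \<in> G}. dist y x < e" using J2 by blast
  qed
  then show ?thesis by auto
qed

section \<open>Dyadic Euler approximations and their limit\<close>

definition steps :: "nat \<Rightarrow> real \<Rightarrow> nat" where
  "steps k t = nat \<lfloor>t * 2 ^ k\<rfloor>"

definition euler :: "nat \<Rightarrow> real \<Rightarrow> 'b \<Rightarrow> 'b" where
  "euler k t = J (1 / 2 ^ k) ^^ steps k t"

definition sg :: "real \<Rightarrow> 'b \<Rightarrow> 'b" where
  "sg t x = lim (\<lambda>k. euler k t x)"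

lemma steps_le: "0 \<le> t \<Longrightarrow> real (steps k t) * (1 / 2 ^ k) \<le> t"
  and steps_ge: "0 \<le> t \<Longrightarrow> t - 1 / 2 ^ k \<le> real (steps k t) * (1 / 2 ^ k)"
proof -
  assume t: "0 \<le> t"
  have s: "real (steps k t) = of_int \<lfloor>t * 2 ^ k\<rfloor>" using t by (simp add: steps_def)
  have "real (steps k t) \<le> t * 2 ^ k" unfolding s by (rule of_int_floor_le)
  then show "real (steps k t) * (1 / 2 ^ k) \<le> t" by (simp add: field_simps)
  have "t * 2 ^ k \<le> real (steps k t) + 1" unfolding s by linarith
  then have "t \<le> (real (steps k t) + 1) / 2 ^ k" by (simp add: pos_le_divide_eq)
  then show "t - 1 / 2 ^ k \<le> real (steps k t) * (1 / 2 ^ k)" by (simp add: add_divide_distrib)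
qed

text \<open>Rounding loses at most one step of the finer grid. On the domain such a step moves the
  orbit by O(p) only (\<open>one_step\<close>), so it disappears in the limit;
  \<open>steps_add\<close> serves the semigroup law in the same way.\<close>

lemma steps_Suc:
  assumes "0 \<le> t" shows "steps (Suc k) t = 2 * steps k t \<or> steps (Suc k) t = Suc (2 * steps k t)"
proof -
  define m where "m = \<lfloor>t * 2 ^ k\<rfloor>"
  have m: "of_int m \<le> t * 2 ^ k" "t * 2 ^ k < of_int m + 1" "0 \<le> m"
    using assms unfolding m_def by (linarith, linarith, simp)
  have "2 * m \<le> \<lfloor>t * 2 ^ Suc k\<rfloor>" using m by (simp add: le_floor_iff)
  moreover have "\<lfloor>t * 2 ^ Suc k\<rfloor> < 2 * m + 2" using m by (simp add: floor_less_iff)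
  ultimately show ?thesis using m(3) unfolding steps_def m_def[symmetric] by linarith
qed

lemma steps_add:
  assumes "0 \<le> s" "0 \<le> t"
  shows "steps k (s + t) = steps k s + steps k t \<or> steps k (s + t) = Suc (steps k s + steps k t)"
proof -
  define m n where "m = \<lfloor>s * 2 ^ k\<rfloor>" and "n = \<lfloor>t * 2 ^ k\<rfloor>"
  have m: "of_int m \<le> s * 2 ^ k" "s * 2 ^ k < of_int m + 1" "0 \<le> m"
    using assms unfolding m_def by (linarith, linarith, simp)
  have n: "of_int n \<le> t * 2 ^ k" "t * 2 ^ k < of_int n + 1" "0 \<le> n"
    using assms unfolding n_def by (linarith, linarith, simp)
  have "m + n \<le> \<lfloor>(s + t) * 2 ^ k\<rfloor>" using m n by (simp add: le_floor_iff distrib_right)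
  moreover have "\<lfloor>(s + t) * 2 ^ k\<rfloor> < m + n + 2" using m n by (simp add: floor_less_iff distrib_right)
  ultimately show ?thesis using m(3) n(3) unfolding steps_def m_def[symmetric] n_def[symmetric] by linarith
qed

lemma clin_euler: "bounded_clinear (euler k t)"
  unfolding euler_def by (rule clin_pow) simp

lemma lin_euler: "bounded_linear (euler k t)"
  using clin_euler by (simp add: bounded_clinear_def)

lemma norm_euler: "norm (euler k t x) \<le> M * norm x"
  unfolding euler_def by (rule norm_J_pow) simp

text \<open>There are two sources of error: n doubled steps, each of order p^2 with n * 2p at most
  t, and one possible rounding step of order p. Together they are O(2^(-k)), summable over the
  levels.\<close>

lemma euler_refine:
  assumes "0 \<le> t" and xyz: "(x, y) \<in> G" "(y, z) \<in> G"
  shows "norm (euler (Suc k) t x - euler k t x) \<le> (t * M * (M * norm z) + M * norm y) * (1 / 2) ^ k"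
proof -
  define p :: real where "p = 1 / 2 ^ Suc k"
  define n where "n = steps k t"
  have p: "p > 0" "1 / 2 ^ k = 2 * p" by (auto simp: p_def)
  have np: "real n * (2 * p) \<le> t" using steps_le[OF assms(1), of k] by (simp add: n_def p)
  have "norm ((J (2 * p) ^^ n) x - (J p ^^ (2 * n)) x) \<le> n * p\<^sup>2 * M * (M * norm z)"
    by (rule double_steps[OF p(1) xyz norm_J_pow[OF p(1)]])
  also have "\<dots> = (n * (2 * p)) * (p / 2) * (M * (M * norm z))" by (simp add: power2_eq_square)
  also have "\<dots> \<le> t * p * (M * (M * norm z))"
    using np p M_ge_1 assms(1) by (intro mult_right_mono mult_mono) auto
  finally have 1: "norm ((J (2 * p) ^^ n) x - (J p ^^ (2 * n)) x) \<le> t * p * (M * (M * norm z))" .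
  have "norm ((J p ^^ Suc (2 * n)) x - (J p ^^ (2 * n)) x) \<le> p * (M * norm y)"
    unfolding one_step[OF p(1) xyz(1)] norm_minus_cancel norm_scaleR
    using p by (intro mult_mono norm_J_pow) auto
  moreover have "0 \<le> p * (M * norm y)" using p M_ge_1 by simp
  ultimately have 2: "norm (euler (Suc k) t x - (J p ^^ (2 * n)) x) \<le> p * (M * norm y)"
    using steps_Suc[OF assms(1), of k] unfolding euler_def n_def[symmetric] p_def[symmetric]
    by auto
  have "norm (euler (Suc k) t x - euler k t x) \<le> t * p * (M * (M * norm z)) + p * (M * norm y)"
    using 1 2 norm_triangle_ineq4[of "euler (Suc k) t x - (J p ^^ (2 * n)) x" "(J (2 * p) ^^ n) x - (J p ^^ (2 * n)) x"]
    by (simp add: euler_def n_def p(2))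
  also have "\<dots> = (t * M * (M * norm z) + M * norm y) * p" by (simp add: algebra_simps)
  also have "\<dots> \<le> (t * M * (M * norm z) + M * norm y) * (1 / 2) ^ k"
    using M_ge_1 assms(1) by (intro mult_left_mono) (auto simp: p_def power_one_over field_simps)
  finally show ?thesis .
qed

lemma euler_lim:
  assumes "0 \<le> t" shows "(\<lambda>k. euler k t x) \<longlonglongrightarrow> sg t x"
proof -
  have "Cauchy (\<lambda>k. euler k t x)"
  proof (rule metric_CauchyI)
    fix e :: real assume e: "e > 0"
    have "x \<in> closure {x. \<exists>y z. (x, y) \<in> G \<and> (y, z) \<in> G}" by (simp only: dense_domain_square UNIV_I)
    moreover have "e / (4 * M) > 0" using e M_ge_1 by simp
    ultimately obtain d y z where d: "(d, y) \<in> G" "(y, z) \<in> G" "dist d x < e / (4 * M)"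
      unfolding closure_approachable by blast
    have "convergent (\<lambda>k. euler k t d)"
      using euler_refine[OF assms d(1,2)] by (rule convergent_geometric_steps)
    then obtain N where N: "dist (euler m t d) (euler n t d) < e / 2" if "m \<ge> N" "n \<ge> N" for m n
      using metric_CauchyD[OF convergent_Cauchy, of _ "e / 2"] e by (meson half_gt_zero)
    have near: "dist (euler k t x) (euler k t d) < e / 4" for k
    proof -
      have "dist (euler k t x) (euler k t d) \<le> M * dist d x"
        using norm_euler[of k t "x - d"] by (simp add: dist_norm linear_simps[OF lin_euler] norm_minus_commute)
      also have "\<dots> < M * (e / (4 * M))" using d(3) M_ge_1 by (intro mult_strict_left_mono) auto
      finally show ?thesis using M_ge_1 by simp
    qed
    have "dist (euler m t x) (euler n t x) < e" if "m \<ge> N" "n \<ge> N" for m n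
    proof -
      have "dist (euler m t x) (euler n t x) \<le> dist (euler m t x) (euler m t d)
          + (dist (euler m t d) (euler n t d) + dist (euler n t d) (euler n t x))"
        by (meson dist_triangle dist_triangle_le add_left_mono order_trans)
      also have "\<dots> < e / 4 + (e / 2 + e / 4)"
        using near[of m] near[of n] N[OF that] by (simp add: dist_commute)
      finally show ?thesis by simp
    qed
    then show "\<exists>N. \<forall>m\<ge>N. \<forall>n\<ge>N. dist (euler m t x) (euler n t x) < e" by blast
  qed
  then show ?thesis unfolding sg_def by (simp add: Cauchy_convergent convergent_LIMSEQ_iff[symmetric])
qed

lemma clin_sg: "0 \<le> t \<Longrightarrow> bounded_clinear (sg t)"
  by (rule bounded_clinear_limit[of "\<lambda>k. euler k t" M]) (auto intro: clin_euler norm_euler euler_lim)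

lemma lin_sg: "0 \<le> t \<Longrightarrow> bounded_linear (sg t)"
  using clin_sg by (simp add: bounded_clinear_def)

lemma norm_sg: "0 \<le> t \<Longrightarrow> norm (sg t x) \<le> M * norm x"
  by (rule bounded_clinear_limit(2)[of "\<lambda>k. euler k t" M]) (auto intro: clin_euler norm_euler euler_lim)

lemma lim_inverse_power_2: "(\<lambda>k. 1 / 2 ^ k :: real) \<longlonglongrightarrow> 0"
  using LIMSEQ_power_zero[of "1 / 2 :: real"] by (simp add: power_one_over)

text \<open>Up to one rounding step the Euler schemes compose exactly. The remaining difference
  tends to 0 on the domain and, being uniformly bounded, everywhere.\<close>

lemma sg_add:
  assumes "0 \<le> s" "0 \<le> t" shows "sg (s + t) x = sg s (sg t x)"
proof -
  have "(\<lambda>k. M * norm (euler k t x - sg t x)) \<longlonglongrightarrow> M * norm (sg t x - sg t x)"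
    by (intro tendsto_intros euler_lim assms)
  then have "(\<lambda>k. M * norm (euler k t x - sg t x)) \<longlonglongrightarrow> 0" by simp
  then have "(\<lambda>k. euler k s (euler k t x - sg t x)) \<longlonglongrightarrow> 0"
    by (rule Lim_null_comparison[OF always_eventually, rotated]) (auto intro: norm_euler)
  from tendsto_add[OF this euler_lim[OF assms(1), of "sg t x"]]
  have 1: "(\<lambda>k. euler k s (euler k t x)) \<longlonglongrightarrow> sg s (sg t x)"
    by (simp add: linear_simps[OF lin_euler])
  have 2: "(\<lambda>k. euler k (s + t) x - euler k s (euler k t x)) \<longlonglongrightarrow> 0"
  proof (rule tendsto_zero_dense[where M = "M + M * M" and D = "Domain G"])
    show "bounded_linear (\<lambda>x. euler k (s + t) x - euler k s (euler k t x))" for k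
      by (intro bounded_linear_sub lin_euler bounded_linear_compose[OF lin_euler lin_euler])
    have "norm (euler k (s + t) x - euler k s (euler k t x)) \<le> M * norm x + M * (M * norm x)" for k x
      using norm_euler[of k "s + t" x] norm_euler[of k s "euler k t x"]
        mult_left_mono[OF norm_euler[of k t x], of M] M_ge_1
        norm_triangle_ineq4[of "euler k (s + t) x" "euler k s (euler k t x)"] by linarith
    then show "\<forall>\<^sub>F k in sequentially. \<forall>x. norm (euler k (s + t) x - euler k s (euler k t x)) \<le> (M + M * M) * norm x"
      by (simp add: algebra_simps)
    fix x assume "x \<in> Domain G"
    then obtain y where y: "(x, y) \<in> G" by blast
    have "norm (euler k (s + t) x - euler k s (euler k t x)) \<le> 1 / 2 ^ k * (M * norm y)" for k
    proof -
      define p :: real where "p = 1 / 2 ^ k"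
      define n where "n = steps k s + steps k t"
      have p: "p > 0" by (simp add: p_def)
      have "euler k s (euler k t x) = (J p ^^ n) x" by (simp add: euler_def n_def p_def funpow_add)
      moreover have "euler k (s + t) x = (J p ^^ n) x \<or> euler k (s + t) x = (J p ^^ Suc n) x"
        using steps_add[OF assms, of k] by (auto simp: euler_def n_def p_def)
      moreover have "norm ((J p ^^ Suc n) x - (J p ^^ n) x) \<le> p * (M * norm y)"
        unfolding one_step[OF p y] norm_minus_cancel norm_scaleR
        using p by (intro mult_mono norm_J_pow) auto
      moreover have "0 \<le> p * (M * norm y)" using p M_ge_1 by simp
      ultimately show ?thesis unfolding p_def by auto
    qed
    then have le: "\<forall>k. norm (euler k (s + t) x - euler k s (euler k t x)) \<le> 1 / 2 ^ k * (M * norm y)" by blast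
    have "(\<lambda>k. 1 / 2 ^ k * (M * norm y)) \<longlonglongrightarrow> 0"
      using tendsto_mult_right[OF lim_inverse_power_2] by simp
    then show "(\<lambda>k. euler k (s + t) x - euler k s (euler k t x)) \<longlonglongrightarrow> 0"
      by (rule Lim_null_comparison[OF always_eventually, rotated]) (rule le)
  qed (use dense in simp)
  have "(\<lambda>k. euler k (s + t) x) \<longlonglongrightarrow> sg s (sg t x)" using tendsto_add[OF 1 2] by simp
  then show ?thesis using LIMSEQ_unique euler_lim assms by (metis add_nonneg_nonneg)
qed

lemma sg_diff:
  assumes "0 \<le> t" "(x, y) \<in> G" shows "norm (sg t x - x) \<le> t * (M * norm y)"
proof (rule LIMSEQ_le_const2)
  show "(\<lambda>k. norm (euler k t x - x)) \<longlonglongrightarrow> norm (sg t x - x)"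
    by (intro tendsto_intros euler_lim assms)
  have "norm (euler k t x - x) \<le> (real (steps k t) * (1 / 2 ^ k)) * (M * norm y)" for k
    using pow_diff[of "1 / 2 ^ k" x y "steps k t"] assms unfolding euler_def by (simp add: mult.assoc)
  also have "\<dots> k \<le> t * (M * norm y)" for k
    using steps_le[OF assms(1), of k] M_ge_1 by (intro mult_right_mono) auto
  finally show "\<exists>N. \<forall>k\<ge>N. norm (euler k t x - x) \<le> t * (M * norm y)" by blast
qed

text \<open>Since \<open>y\<close> need not lie in the domain, it is compared with a point
  \<open>d\<close> that does. After division by t the first error term is small by density, the
  second by letting t tend to 0.\<close>

lemma sg_diff_linear:
  assumes "0 \<le> t" "(x, y) \<in> G" "(d, e) \<in> G"
  shows "norm (sg t x - x + t *\<^sub>R y) \<le> t * ((M + 1) * norm (y - d) + t * (M * norm e))"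
    (is "_ \<le> t * ?c")
proof (rule LIMSEQ_le)
  \<comment> \<open>The time actually reached by the Euler scheme at level k.\<close>
  define r where "r k = real (steps k t) * (1 / 2 ^ k)" for k
  have "r \<longlonglongrightarrow> t"
  proof (rule tendsto_sandwich)
    show "(\<lambda>k. t - 1 / 2 ^ k) \<longlonglongrightarrow> t" using tendsto_diff[OF tendsto_const lim_inverse_power_2, of t] by simp
  qed (use steps_le steps_ge assms in \<open>auto simp: r_def simp del: times_divide_eq_right\<close>)
  then show "(\<lambda>k. norm (euler k t x - x + r k *\<^sub>R y)) \<longlonglongrightarrow> norm (sg t x - x + t *\<^sub>R y)"
    by (intro tendsto_intros euler_lim assms)
  show "(\<lambda>k. r k * ?c) \<longlonglongrightarrow> t * ?c" by (intro tendsto_intros \<open>r \<longlonglongrightarrow> t\<close>)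
  have "norm (euler k t x - x + r k *\<^sub>R y) \<le> r k * ?c" for k
    unfolding euler_def r_def
  proof (rule pow_diff_linear)
    fix i assume i: "i \<le> steps k t"
    define p :: real where "p = 1 / 2 ^ k"
    have p: "p > 0" by (simp add: p_def)
    interpret Ji: bounded_linear "J p ^^ i" by (rule lin_pow) fact
    have ip: "real i * p \<le> t"
      using i steps_le[OF assms(1), of k] mult_right_mono[of "real i" "real (steps k t)" p] p
      by (simp add: p_def)
    have "(J p ^^ i) y - y = ((J p ^^ i) (y - d) - (y - d)) + ((J p ^^ i) d - d)" by (simp add: Ji.diff)
    also have "norm \<dots> \<le> (M + 1) * norm (y - d) + t * (M * norm e)"
    proof (rule norm_triangle_mono)
      show "norm ((J p ^^ i) (y - d) - (y - d)) \<le> (M + 1) * norm (y - d)"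
        using norm_triangle_ineq4[of "(J p ^^ i) (y - d)" "y - d"] norm_J_pow[OF p, of i "y - d"]
        by (simp add: algebra_simps)
      show "norm ((J p ^^ i) d - d) \<le> t * (M * norm e)"
        using order_trans[OF pow_diff[OF p assms(3), of i, unfolded mult.assoc[of _ M]]
            mult_right_mono[OF ip, of "M * norm e"]] M_ge_1 by simp
    qed
    finally show "norm ((J (1 / 2 ^ k) ^^ i) y - y) \<le> ?c" by (simp add: p_def)
  qed (use assms in auto)
  then show "\<exists>N. \<forall>k\<ge>N. norm (euler k t x - x + r k *\<^sub>R y) \<le> r k * ?c" by blast
qed

lemma C0_sg: "C0_semigroup sg"
proof -
  have "sg 0 x = x" for x by (simp add: sg_def euler_def steps_def)
  moreover have "((\<lambda>t. sg t x) \<longlongrightarrow> x) (at_right 0)" for x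
  proof -
    \<comment> \<open>\<open>tendsto_zero_dense\<close> wants linear operators at every index,
      negative t included; the modulus provides them.\<close>
    have "((\<lambda>t. sg \<bar>t\<bar> x - x) \<longlongrightarrow> 0) (at_right 0)"
    proof (rule tendsto_zero_dense[where M = "M + 1" and D = "Domain G"])
      show "bounded_linear (\<lambda>x. sg \<bar>t\<bar> x - x)" for t
        using lin_sg[of "\<bar>t\<bar>"] by (intro bounded_linear_sub bounded_linear_ident) auto
      have "norm (sg \<bar>t\<bar> x - x) \<le> (M + 1) * norm x" for t x
        using norm_sg[of "\<bar>t\<bar>" x] norm_triangle_ineq4[of "sg \<bar>t\<bar> x" x] by (simp add: algebra_simps)
      then show "\<forall>\<^sub>F t in at_right 0. \<forall>x. norm (sg \<bar>t\<bar> x - x) \<le> (M + 1) * norm x" by simp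
      fix x assume "x \<in> Domain G"
      then obtain y where y: "(x, y) \<in> G" by blast
      have "((\<lambda>t. \<bar>t\<bar> * (M * norm y)) \<longlongrightarrow> \<bar>0\<bar> * (M * norm y)) (at_right 0)"
        by (intro tendsto_intros)
      then have "((\<lambda>t. \<bar>t\<bar> * (M * norm y)) \<longlongrightarrow> 0) (at_right 0)" by simp
      then show "((\<lambda>t. sg \<bar>t\<bar> x - x) \<longlongrightarrow> 0) (at_right 0)"
        by (rule Lim_null_comparison[OF always_eventually, rotated]) (use sg_diff[OF _ y] in auto)
    qed (use dense in auto)
    moreover have "\<forall>\<^sub>F t in at_right 0. sg \<bar>t\<bar> x - x = sg t x - x"
      by (auto simp: eventually_at_filter)
    ultimately have "((\<lambda>t. sg t x - x) \<longlongrightarrow> 0) (at_right 0)" by (rule Lim_transform_eventually)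
    then show ?thesis by (rule LIM_zero_cancel)
  qed
  ultimately show ?thesis by (simp add: C0_semigroup_def clin_sg sg_add)
qed

section \<open>Identification of the generator\<close>

lemma generator_sg: "generator sg = {(x, - y) | x y. (x, y) \<in> G}"
proof
  interpret c0 sg by unfold_locales (rule C0_sg)
  have G: "(x, - y) \<in> generator sg" if xy: "(x, y) \<in> G" for x y
  proof -
    have "((\<lambda>h. (sg h x - x) /\<^sub>R h) \<longlongrightarrow> - y) (at_right 0)"
    proof (rule tendstoI)
      fix \<epsilon> :: real assume e: "\<epsilon> > 0"
      have "y \<in> closure (Domain G)" using dense by simp
      moreover have "\<epsilon> / (2 * (M + 1)) > 0" using e M_ge_1 by simp
      ultimately obtain d e' where d: "(d, e') \<in> G" "dist d y < \<epsilon> / (2 * (M + 1))"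
        unfolding closure_approachable by blast
      have "(M + 1) * norm (y - d) < (M + 1) * (\<epsilon> / (2 * (M + 1)))"
        using d(2) M_ge_1 by (intro mult_strict_left_mono) (auto simp: dist_norm norm_minus_commute)
      also have "\<dots> = \<epsilon> / 2" using M_ge_1 by (simp add: field_simps)
      finally have 1: "(M + 1) * norm (y - d) < \<epsilon> / 2" .
      have "((\<lambda>t. t * (M * norm e')) \<longlongrightarrow> 0 * (M * norm e')) (at_right 0)" by (intro tendsto_intros)
      then have "\<forall>\<^sub>F t in at_right 0. t * (M * norm e') < \<epsilon> / 2"
        by (rule order_tendstoD) (use e in simp)
      moreover have "\<forall>\<^sub>F t in at_right (0::real). t > 0" by (simp add: eventually_at_right_less)
      ultimately show "\<forall>\<^sub>F t in at_right 0. dist ((sg t x - x) /\<^sub>R t) (- y) < \<epsilon>"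
      proof eventually_elim
        case (elim t)
        have "(sg t x - x) /\<^sub>R t + y = (sg t x - x + t *\<^sub>R y) /\<^sub>R t" using elim by (simp add: scaleR_add_right)
        then have "norm ((sg t x - x) /\<^sub>R t + y) = norm ((sg t x - x + t *\<^sub>R y) /\<^sub>R t)" by (rule arg_cong)
        also have "\<dots> = norm (sg t x - x + t *\<^sub>R y) / t"
          unfolding norm_scaleR using elim(2) by (simp add: divide_inverse_commute)
        also have "\<dots> \<le> (M + 1) * norm (y - d) + t * (M * norm e')"
          using sg_diff_linear[OF _ xy d(1), of t] elim by (simp add: pos_divide_le_eq mult.commute)
        finally show ?case using 1 elim by (simp add: dist_norm)
      qed
    qed
    then show ?thesis by (simp add: generator_def)
  qed
  then show "{(x, - y) | x y. (x, y) \<in> G} \<subseteq> generator sg" by auto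
  show "generator sg \<subseteq> {(x, - y) | x y. (x, y) \<in> G}"
  proof (clarify)
    fix x y assume xy: "(x, y) \<in> generator sg"
    \<comment> \<open>\<open>x'\<close> is the point of the domain with (1 + G) x' = x - y. The
      difference \<open>d\<close> is then mapped to itself by the generator, and so is every
      multiple of it; hence exp(s) d is an orbit, which the bound on \<open>sg\<close> forbids
      unless d = 0.\<close>
    define x' d where "x' = J 1 (x - y)" and "d = x - x'"
    have x'G: "(x', (x - y) - x') \<in> G" using J_G[of 1 "x - y"] by (simp add: x'_def)
    have "((\<lambda>h. (sg h x - x) /\<^sub>R h - (sg h x' - x') /\<^sub>R h) \<longlongrightarrow> y - - ((x - y) - x')) (at_right 0)"
      using xy G[OF x'G] by (intro tendsto_diff) (auto simp: generator_def)
    moreover have "\<forall>\<^sub>F h in at_right 0. (sg h x - x) /\<^sub>R h - (sg h x' - x') /\<^sub>R h = (sg h d - d) /\<^sub>R h"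
      using eventually_at_right_less[of "0::real"]
    proof eventually_elim
      case (elim h)
      interpret H: bounded_linear "sg h" by (rule lin_sg) (use elim in simp)
      show ?case unfolding scaleR_diff_right[symmetric] d_def H.diff by (simp add: algebra_simps)
    qed
    ultimately have "((\<lambda>h. (sg h d - d) /\<^sub>R h) \<longlongrightarrow> y - - ((x - y) - x')) (at_right 0)"
      by (rule Lim_transform_eventually)
    then have d: "((\<lambda>h. (sg h d - d) /\<^sub>R h) \<longlongrightarrow> d) (at_right 0)" by (simp add: d_def)
    have "(r *\<^sub>R d, r *\<^sub>R d) \<in> generator sg" for r
    proof -
      have "((\<lambda>h. r *\<^sub>R ((sg h d - d) /\<^sub>R h)) \<longlongrightarrow> r *\<^sub>R d) (at_right 0)" by (intro tendsto_intros d)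
      moreover have "\<forall>\<^sub>F h in at_right 0. r *\<^sub>R ((sg h d - d) /\<^sub>R h) = (sg h (r *\<^sub>R d) - r *\<^sub>R d) /\<^sub>R h"
        using eventually_at_right_less[of "0::real"]
      proof eventually_elim
        case (elim h)
        interpret H: bounded_linear "sg h" by (rule lin_sg) (use elim in simp)
        show ?case unfolding H.scaleR by (simp add: scaleR_diff_right mult.commute)
      qed
      ultimately have "((\<lambda>h. (sg h (r *\<^sub>R d) - r *\<^sub>R d) /\<^sub>R h) \<longlongrightarrow> r *\<^sub>R d) (at_right 0)"
        by (rule Lim_transform_eventually)
      then show ?thesis by (simp add: generator_def)
    qed
    moreover have "((\<lambda>s. exp s *\<^sub>R d) has_vector_derivative exp s *\<^sub>R d) (at s within {0..M})" for s
      using has_vector_derivative_scaleR[of exp "exp s" s "{0..M}" "\<lambda>_. d" 0]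
      by (simp add: DERIV_exp[THEN DERIV_subset])
    \<comment> \<open>The time M suits the contradiction because exp M > M.\<close>
    ultimately have "exp M *\<^sub>R d = sg M (exp 0 *\<^sub>R d)"
      using M_ge_1
      by (intro orbit_unique[where y = "\<lambda>s. exp s *\<^sub>R d" and y' = "\<lambda>s. exp s *\<^sub>R d"]) auto
    then have "norm (exp M *\<^sub>R d) \<le> M * norm d" using norm_sg[of M d] M_ge_1 by simp
    then have "exp M * norm d \<le> M * norm d" by simp
    moreover have "M < exp M" using exp_ge_add_one_self[of M] by linarith
    ultimately have "d = 0" by (auto simp: mult_le_cancel_right)
    then have "(x, - y) \<in> G" using x'G by (simp add: d_def)
    then show "\<exists>x' y'. (x, y) = (x', - y') \<and> (x', y') \<in> G" by (intro exI[of _ x] exI[of _ "- y"]) simp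
  qed
qed

end

section \<open>Riesz representation and the Lax--Milgram lemma\<close>

lemma cinner_diff_left: "cinner (x - y) z = cinner x z - cinner (y::'a::complex_inner) z"
  using cinner_add_left[of "x - y" y z] by simp

lemma Re_cinner_commute: "Re (cinner x y) = Re (cinner y (x::'a::complex_inner))"
  by (subst cinner_commute) simp

lemma Re_cinner_self: "Re (cinner x x) = (norm (x::'a::complex_inner))\<^sup>2"
  by (simp add: cinner_self del: of_real_power)

text \<open>A minimizing sequence for the distance from x to S is almost orthogonal to S in its
  residuals. Differences of its members lie in S and can serve as test vectors, which makes the
  sequence Cauchy; the limit residual is z.\<close>

lemma exists_orthogonal:
  fixes S :: "'a::complex_hilbert set"
  assumes S: "subspace S" and x: "x \<notin> closure S"
  shows "\<exists>z. z \<noteq> 0 \<and> (\<forall>s\<in>S. Re (cinner z s) = 0)"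
proof -
  define F where "F p = (norm (x - p))\<^sup>2" for p
  define \<delta> :: "nat \<Rightarrow> real" where "\<delta> n = 1 / Suc n" for n
  have d: "\<delta> n > 0" for n by (simp add: \<delta>_def)
  have \<delta>0: "\<delta> \<longlonglongrightarrow> 0" unfolding \<delta>_def by (rule LIMSEQ_Suc[OF lim_1_over_n])
  have bdd: "bdd_below (F ` S)" by (rule bdd_belowI[of _ 0]) (auto simp: F_def)
  have ne: "S \<noteq> {}" using subspace_0[OF S] by blast
  \<comment> \<open>An excess of the square of \<open>\<delta> n\<close> over the infimum becomes
    the linear error \<open>\<delta> n\<close> in \<open>near\<close>, through
    \<open>quadratic_nonneg_bound\<close>.\<close>
  have "\<exists>p\<in>S. F p < (INF p\<in>S. F p) + (\<delta> n)\<^sup>2" for n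
    using d[of n] by (subst cINF_less_iff[OF ne bdd, symmetric]) simp
  then obtain p where p: "\<And>n. p n \<in> S" and Fp: "\<And>n. F (p n) < (INF p\<in>S. F p) + (\<delta> n)\<^sup>2"
    by metis
  have near: "\<bar>Re (cinner (x - p n) s)\<bar> \<le> \<delta> n * norm s" if s: "s \<in> S" for n s
  proof (rule quadratic_nonneg_bound)
    fix t :: real
    have "p n - t *\<^sub>R s \<in> S" using S s p by (simp add: subspace_diff subspace_scale)
    then have "(INF p\<in>S. F p) \<le> F (p n - t *\<^sub>R s)" by (rule cINF_lower[OF bdd])
    also have "F (p n - t *\<^sub>R s) = F (p n) + 2 * t * Re (cinner (x - p n) s) + t\<^sup>2 * (norm s)\<^sup>2"
      using norm_add_square[of "x - p n" "t *\<^sub>R s"]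
      by (simp add: F_def cinner_scaleR_right power_mult_distrib algebra_simps)
    finally show "t\<^sup>2 * (norm s)\<^sup>2 + 2 * t * Re (cinner (x - p n) s) + (\<delta> n)\<^sup>2 \<ge> 0"
      using Fp[of n] by linarith
  qed (use d in auto)
  have pp: "norm (p m - p n) \<le> \<delta> m + \<delta> n" for m n
  proof (cases "p m = p n")
    case False
    have s: "p m - p n \<in> S" using S p by (simp add: subspace_diff)
    have "(norm (p m - p n))\<^sup>2 = Re (cinner (x - p n) (p m - p n)) - Re (cinner (x - p m) (p m - p n))"
      by (simp add: Re_cinner_self[symmetric] cinner_diff_left)
    also have "\<dots> \<le> (\<delta> m + \<delta> n) * norm (p m - p n)"
      using near[OF s, of n] near[OF s, of m] by (simp add: algebra_simps)
    finally show ?thesis using False by (simp add: power2_eq_square)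
  qed (use d[of m] d[of n] in simp)
  have "Cauchy p"
  proof (rule metric_CauchyI)
    fix e :: real assume "e > 0"
    then have "\<forall>\<^sub>F n in sequentially. \<delta> n < e / 2" using order_tendstoD(2)[OF \<delta>0, of "e / 2"] by simp
    then obtain N where N: "\<And>n. n \<ge> N \<Longrightarrow> \<delta> n < e / 2" by (auto simp: eventually_sequentially)
    have "dist (p m) (p n) < e" if "m \<ge> N" "n \<ge> N" for m n
      using pp[of m n] N[OF that(1)] N[OF that(2)] by (simp add: dist_norm)
    then show "\<exists>N. \<forall>m\<ge>N. \<forall>n\<ge>N. dist (p m) (p n) < e" by blast
  qed
  then obtain q where q: "p \<longlonglongrightarrow> q" by (auto simp: Cauchy_convergent_iff convergent_def)
  have "q \<in> closure S" using closure_sequential p q by blast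
  then have "x - q \<noteq> 0" using x by auto
  moreover have "Re (cinner (x - q) s) = 0" if s: "s \<in> S" for s
  proof -
    have "(\<lambda>n. \<delta> n * norm s + norm (p n - q) * norm s) \<longlonglongrightarrow> 0 * norm s + norm (q - q) * norm s"
      by (intro tendsto_intros \<delta>0 q)
    moreover have "\<bar>Re (cinner (x - q) s)\<bar> \<le> \<delta> n * norm s + norm (p n - q) * norm s" for n
    proof -
      have "Re (cinner (x - q) s) = Re (cinner (x - p n) s) + Re (cinner (p n - q) s)"
        by (simp add: cinner_diff_left)
      then show ?thesis using near[OF s, of n] abs_Re_cinner_le[of "p n - q" s] by linarith
    qed
    ultimately have "\<bar>Re (cinner (x - q) s)\<bar> \<le> 0"
      by (intro LIMSEQ_le_const) auto
    then show ?thesis by simp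
  qed
  ultimately show ?thesis by blast
qed

lemma closure_eq_UNIV_if_orthogonal_trivial:
  fixes S :: "'a::complex_hilbert set"
  assumes "subspace S" and "\<And>z. (\<And>s. s \<in> S \<Longrightarrow> Re (cinner z s) = 0) \<Longrightarrow> z = 0"
  shows "closure S = UNIV"
  using exists_orthogonal[OF assms(1)] assms(2) by blast

lemma cinner_eq_0_all: "(\<And>v. Re (cinner w v) = 0) \<Longrightarrow> (w::'a::complex_inner) = 0"
  using Re_cinner_self[of w] by simp

lemma bounded_antilinearI:
  assumes "\<And>u v. F (u + v) = F u + F v" "\<And>c u. F (c *\<^sub>C u) = cnj c * F u"
    and "\<And>u. cmod (F u) \<le> K * norm u"
  shows "bounded_antilinear F"
  unfolding bounded_antilinear_def
proof
  show "bounded_linear F"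
  proof (rule bounded_linear_intro[of _ K])
    show "F (r *\<^sub>R x) = r *\<^sub>R F x" for r x
      using assms(2)[of "complex_of_real r" x] by (simp add: scaleC_of_real scaleR_conv_of_real)
  qed (use assms in \<open>auto simp: mult.commute\<close>)
qed (use assms in auto)

lemma bounded_linear_mk_antidual:
  assumes anti: "\<And>u. bounded_antilinear (F u)"
    and "\<And>u u' v. F (u + u') v = F u v + F u' v" "\<And>r u v. F (r *\<^sub>R u) v = r *\<^sub>R F u v"
    and "\<And>u v. cmod (F u v) \<le> K * norm u * norm v" and "0 \<le> K"
  shows "bounded_linear (\<lambda>u. mk_antidual (F u))"
proof (rule bounded_linear_intro[of _ K])
  show "mk_antidual (F (u + u')) = mk_antidual (F u) + mk_antidual (F u')" for u u'
    by (rule antidual_eqI) (simp add: pairing_add pairing_mk_antidual anti assms)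
  show "mk_antidual (F (r *\<^sub>R u)) = r *\<^sub>R mk_antidual (F u)" for r u
    by (rule antidual_eqI)
      (simp add: pairing_scaleC pairing_mk_antidual anti assms scaleC_of_real[symmetric] scaleR_conv_of_real)
  show "norm (mk_antidual (F u)) \<le> norm u * K" for u
    using assms by (intro norm_antidual_bound) (auto simp: pairing_mk_antidual mult.commute)
qed

lemma norm_le_mk_antidual_cinner: "norm w \<le> norm (mk_antidual (cinner (w::'a::complex_inner)))"
proof (cases "w = 0")
  case False
  have "(norm w)\<^sup>2 = cmod (pairing (mk_antidual (cinner w)) w)"
    by (simp add: pairing_mk_antidual bounded_antilinear_cinner cinner_self norm_power)
  also have "\<dots> \<le> norm (mk_antidual (cinner w)) * norm w" by (rule norm_pairing)
  finally show ?thesis using False by (simp add: power2_eq_square)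
qed simp

text \<open>The map sending w to its functional is bounded below, so its range is complete and hence
  closed; \<open>antidual_dense\<close> says that the range is dense.\<close>

lemma riesz_exists: "\<exists>w. \<forall>v. pairing \<phi> v = cinner (w::'a::complex_hilbert) v"
proof -
  let ?\<iota> = "\<lambda>w::'a. mk_antidual (cinner w)"
  have lin: "bounded_linear ?\<iota>"
    \<comment> \<open>The 2 stems from \<open>cmod_cinner_le\<close>, which bounds real and
      imaginary part separately.\<close>
    by (rule bounded_linear_mk_antidual[where K = 2])
      (auto simp: bounded_antilinear_cinner cinner_add_left cinner_scaleR_left cmod_cinner_le)
  have "complete (range ?\<iota>)"
    using complete_isometric_image[OF zero_less_one subspace_UNIV lin] norm_le_mk_antidual_cinner complete_UNIV
    by auto
  moreover have "closure (range ?\<iota>) = UNIV"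
  proof -
    have "\<exists>y\<in>range ?\<iota>. dist y \<psi> < e" if "e > 0" for \<psi> e
    proof -
      obtain w where "norm (\<psi> - ?\<iota> w) \<le> e / 2" using antidual_dense[of "e / 2" \<psi>] \<open>e > 0\<close> by auto
      then have "dist (?\<iota> w) \<psi> < e" using that by (simp add: dist_norm norm_minus_commute)
      then show ?thesis by blast
    qed
    then show ?thesis unfolding closure_approachable set_eq_iff by blast
  qed
  ultimately have "\<phi> \<in> range ?\<iota>" by (metis UNIV_I closure_closed complete_imp_closed)
  then show ?thesis by (auto simp: pairing_mk_antidual bounded_antilinear_cinner)
qed

definition riesz :: "'a::complex_hilbert antidual \<Rightarrow> 'a" where
  "riesz \<phi> = (SOME w. \<forall>v. pairing \<phi> v = cinner w v)"

lemma cinner_riesz: "cinner (riesz \<phi>) v = pairing \<phi> v"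
proof -
  have "\<forall>v. pairing \<phi> v = cinner (riesz \<phi>) v"
    unfolding riesz_def by (rule someI_ex[OF riesz_exists])
  then show ?thesis by simp
qed

lemma riesz_eqI: "(\<And>v. pairing \<phi> v = cinner w v) \<Longrightarrow> riesz \<phi> = w"
  using cinner_eq_0_all[of "riesz \<phi> - w"] by (simp add: cinner_diff_left cinner_riesz)

lemma pairing_scaleR: "pairing (r *\<^sub>R \<phi>) v = r *\<^sub>R pairing \<phi> v"
  using pairing_scaleC[of "complex_of_real r" \<phi> v] by (simp add: scaleC_of_real scaleR_conv_of_real)

lemma bounded_linear_riesz: "bounded_linear riesz"
proof (rule bounded_linear_intro[of _ 1])
  show "riesz (\<phi> + \<psi>) = riesz \<phi> + riesz \<psi>" for \<phi> \<psi> :: "'a antidual"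
    by (rule riesz_eqI) (simp add: pairing_add cinner_add_left cinner_riesz)
  show "riesz (r *\<^sub>R \<phi>) = r *\<^sub>R riesz \<phi>" for r and \<phi> :: "'a antidual"
    by (rule riesz_eqI) (simp add: pairing_scaleR cinner_scaleR_left cinner_riesz)
  show "norm (riesz \<phi>) \<le> norm \<phi> * 1" for \<phi> :: "'a antidual"
  proof -
    have "mk_antidual (cinner (riesz \<phi>)) = \<phi>"
      by (rule antidual_eqI) (simp add: pairing_mk_antidual bounded_antilinear_cinner cinner_riesz)
    then show ?thesis using norm_le_mk_antidual_cinner[of "riesz \<phi>"] by simp
  qed
qed

lemma norm_le_riesz: "norm \<phi> \<le> 2 * norm (riesz \<phi>)"
  by (rule norm_antidual_bound) (use cmod_cinner_le in \<open>auto simp: cinner_riesz[symmetric]\<close>)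

lemma sesquilinearD:
  assumes "sesquilinear a"
  shows "a (u + u') v = a u v + a u' v" "a (c *\<^sub>C u) v = c * a u v"
    "a u (v + v') = a u v + a u v'" "a u (c *\<^sub>C v) = cnj c * a u v"
    "a (r *\<^sub>R u) v = r *\<^sub>R a u v" "a u (r *\<^sub>R v) = r *\<^sub>R a u v"
    "a (u - u') v = a u v - a u' v"
proof -
  show 1: "a (u + u') v = a u v + a u' v" "a (c *\<^sub>C u) v = c * a u v"
    "a u (v + v') = a u v + a u v'" "a u (c *\<^sub>C v) = cnj c * a u v" for u u' v v' c
    using assms unfolding sesquilinear_def by blast+
  show "a (r *\<^sub>R u) v = r *\<^sub>R a u v" "a u (r *\<^sub>R v) = r *\<^sub>R a u v"
    using 1(2)[of "complex_of_real r" u v] 1(4)[of u "complex_of_real r" v]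
    by (simp_all add: scaleC_of_real scaleR_conv_of_real)
  show "a (u - u') v = a u v - a u' v"
    using 1(1)[of "u - u'" u' v] by simp
qed

text \<open>\<open>L\<close> represents b through the inner product. Coercivity is used twice: it
  bounds \<open>L\<close> from below, so the range is closed, and tested at a z orthogonal to the
  range it forces z = 0, so the range is dense.\<close>

lemma lax_milgram_lemma:
  fixes b :: "'v::complex_hilbert \<Rightarrow> 'v \<Rightarrow> complex"
  assumes b: "sesquilinear b" and bound: "\<And>u v. cmod (b u v) \<le> K * norm u * norm v"
    and c: "c > 0" and coercive: "\<And>v. Re (b v v) \<ge> c * (norm v)\<^sup>2"
  shows "\<exists>u. \<forall>v. b u v = pairing \<phi> v"
proof -
  note bD = sesquilinearD[OF b]
  have anti: "bounded_antilinear (b u)" for u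
    using bound[of u] by (intro bounded_antilinearI[where K = "K * norm u"]) (auto simp: bD)
  have bound': "cmod (b u v) \<le> \<bar>K\<bar> * norm u * norm v" for u v
    using bound[of u v] mult_right_mono[OF mult_right_mono[OF abs_ge_self[of K], of "norm u"], of "norm v"]
    by simp
  define L where "L u = riesz (mk_antidual (b u))" for u
  have L: "cinner (L u) v = b u v" for u v
    by (simp add: L_def cinner_riesz pairing_mk_antidual anti)
  have lin: "bounded_linear L" unfolding L_def
    by (rule bounded_linear_compose[OF bounded_linear_riesz bounded_linear_mk_antidual[where K = "\<bar>K\<bar>"]])
      (use anti bound' in \<open>auto simp: bD\<close>)
  have lower: "c * norm u \<le> norm (L u)" for u
  proof (cases "u = 0")
    case False
    have "c * (norm u)\<^sup>2 \<le> norm (L u) * norm u"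
      using coercive[of u] abs_Re_cinner_le[of "L u" u] by (simp add: L)
    then show ?thesis using False by (simp add: power2_eq_square)
  qed simp
  have "closed (range L)"
    using complete_isometric_image[OF c subspace_UNIV lin] lower complete_UNIV complete_imp_closed by auto
  moreover have "closure (range L) = UNIV"
  proof (rule closure_eq_UNIV_if_orthogonal_trivial)
    show "subspace (range L)"
      using lin by (simp add: bounded_linear.linear linear_subspace_image)
    fix z assume "\<And>s. s \<in> range L \<Longrightarrow> Re (cinner z s) = 0"
    then have "Re (cinner (L z) z) = 0" using Re_cinner_commute by (metis rangeI)
    then have "c * (norm z)\<^sup>2 \<le> 0" using coercive[of z] by (simp add: L)
    then show "z = 0" using c by (simp add: mult_le_0_iff)
  qed
  ultimately obtain u where "riesz \<phi> = L u" by (metis UNIV_I closure_closed imageE)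
  then show ?thesis using L cinner_riesz by metis
qed

section \<open>Resolvents of the Lax--Milgram operators\<close>

locale gelfand_form =
  fixes j :: "'v::{complex_hilbert, second_countable_topology}
      \<Rightarrow> 'h::{complex_hilbert, second_countable_topology}"
    and a :: "'v \<Rightarrow> 'v \<Rightarrow> complex"
    and Ca c k Cj :: real
  assumes clin_j: "bounded_clinear j" and inj_j: "inj j" and dense_j: "closure (range j) = UNIV"
    and sesq: "sesquilinear a"
    and bound_a: "\<And>u v. cmod (a u v) \<le> Ca * norm u * norm v" and Ca: "0 < Ca"
    and c: "0 < c" and k: "0 \<le> k"
    and coercive: "\<And>v. Re (a v v) \<ge> c * (norm v)\<^sup>2 - k * (norm (j v))\<^sup>2"
    and Cj: "0 < Cj" and norm_j: "\<And>v. norm (j v) \<le> Cj * norm v"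
begin

lemma lin_j: "bounded_linear j" and j_scaleC: "j (s *\<^sub>C v) = s *\<^sub>C j v"
  using clin_j by (auto simp: bounded_clinear_def)

sublocale j: bounded_linear j by (rule lin_j)

lemmas a = sesquilinearD[OF sesq]

lemma cmod_cinner_j: "cmod (cinner x (j v)) \<le> (2 * Cj * norm x) * norm v"
proof -
  have "cmod (cinner x (j v)) \<le> 2 * norm x * norm (j v)" by (rule cmod_cinner_le)
  also have "\<dots> \<le> 2 * norm x * (Cj * norm v)" by (intro mult_left_mono norm_j) auto
  finally show ?thesis by (simp add: mult_ac)
qed

lemma pairing_emb_H [simp]: "pairing (emb_H j x) v = cinner x (j v)"
  unfolding emb_H_def
  by (intro pairing_mk_antidual bounded_antilinearI[where K = "2 * Cj * norm x"])
    (auto simp: j.add j_scaleC cinner_add_right cinner_scaleC_right cmod_cinner_j)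

lemma pairing_emb_V [simp]: "pairing (emb_V j u) v = cinner (j u) (j v)"
  by (simp add: emb_V_def)

lemma pairing_A [simp]: "pairing (lax_milgram_ext a u) v = a u v"
  unfolding lax_milgram_ext_def
  by (intro pairing_mk_antidual bounded_antilinearI[where K = "Ca * norm u"]) (auto simp: a bound_a)

lemma norm_emb_H: "norm (emb_H j x) \<le> 2 * Cj * norm x"
  using Cj cmod_cinner_j[of x] by (intro norm_antidual_bound) auto

lemma clin_emb_H: "bounded_clinear (emb_H j)"
proof -
  have "bounded_linear (emb_H j)"
    by (rule bounded_linear_intro[of _ "2 * Cj"])
      (use norm_emb_H in \<open>auto intro!: antidual_eqI simp: pairing_add pairing_scaleR cinner_add_left
        cinner_scaleR_left mult.commute\<close>)
  moreover have "emb_H j (s *\<^sub>C x) = s *\<^sub>C emb_H j x" for s x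
    by (rule antidual_eqI) (simp add: pairing_scaleC cinner_scaleC_left)
  ultimately show ?thesis by (simp add: bounded_clinear_def)
qed

lemma lin_emb_H: "bounded_linear (emb_H j)"
  using clin_emb_H by (simp add: bounded_clinear_def)

sublocale emb_H: bounded_linear "emb_H j" by (rule lin_emb_H)

lemma clin_emb_V: "bounded_clinear (emb_V j)"
  using clin_emb_H clin_j bounded_linear_compose[of "emb_H j" j]
  by (simp add: emb_V_def[abs_def] bounded_clinear_def)

lemma lin_emb_V: "bounded_linear (emb_V j)"
  using clin_emb_V by (simp add: bounded_clinear_def)

sublocale emb_V: bounded_linear "emb_V j" by (rule lin_emb_V)

lemma inj_emb_H: "inj (emb_H j)"
proof (rule injI)
  fix x y assume eq: "emb_H j x = emb_H j y"
  define z where "z = x - y"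
  have "cinner z (j v) = 0" for v
    using arg_cong[OF eq, of "\<lambda>\<phi>. pairing \<phi> v"] by (simp add: z_def cinner_diff_left)
  moreover have "continuous_on UNIV (cinner z)"
    using bounded_antilinear_cinner[of z] linear_continuous_on by (auto simp: bounded_antilinear_def)
  ultimately have "cinner z w = 0" for w
    using continuous_constant_on_closure[of "range j" "cinner z" 0 w] dense_j by auto
  then have "z = 0" by (intro cinner_eq_0_all) simp
  then show "x = y" by (simp add: z_def)
qed

lemma inj_emb_V: "inj (emb_V j)"
  using inj_emb_H inj_j by (auto simp: emb_V_def inj_def)

lemma clin_A: "bounded_clinear (lax_milgram_ext a)"
proof -
  have "norm (lax_milgram_ext a u) \<le> Ca * norm u" for u
    using Ca bound_a[of u] by (intro norm_antidual_bound) auto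
  then have "bounded_linear (lax_milgram_ext a)"
    by (intro bounded_linear_intro[of _ Ca])
      (auto intro!: antidual_eqI simp: pairing_add pairing_scaleR a mult.commute)
  moreover have "lax_milgram_ext a (s *\<^sub>C x) = s *\<^sub>C lax_milgram_ext a x" for s x
    by (rule antidual_eqI) (simp add: pairing_scaleC a)
  ultimately show ?thesis by (simp add: bounded_clinear_def)
qed

lemma lin_A: "bounded_linear (lax_milgram_ext a)"
  using clin_A by (simp add: bounded_clinear_def)

text \<open>\<open>sol p q \<phi>\<close> is the solution \<open>u\<close> of \<open>p u + q A u = \<phi>\<close>; it exists if \<open>q > 0\<close> and \<open>p \<ge> q k\<close>.\<close>

definition form :: "real \<Rightarrow> real \<Rightarrow> 'v \<Rightarrow> 'v \<Rightarrow> complex" where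
  "form p q u v = p * cinner (j u) (j v) + q * a u v"

definition sol :: "real \<Rightarrow> real \<Rightarrow> 'v antidual \<Rightarrow> 'v" where
  "sol p q \<phi> = (SOME u. \<forall>v. form p q u v = pairing \<phi> v)"

lemma sesquilinear_form: "sesquilinear (form p q)"
  by (simp add: sesquilinear_def form_def a j.add j_scaleC cinner_add_left cinner_add_right
      cinner_scaleC_left cinner_scaleC_right algebra_simps)

lemma Re_form: "Re (form p q v v) = p * (norm (j v))\<^sup>2 + q * Re (a v v)"
  by (simp add: form_def Re_cinner_self)

lemma coercive_form:
  assumes "0 < q" shows "Re (form p q v v) \<ge> q * c * (norm v)\<^sup>2 + (p - q * k) * (norm (j v))\<^sup>2"
proof -
  have "q * Re (a v v) \<ge> q * (c * (norm v)\<^sup>2 - k * (norm (j v))\<^sup>2)"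
    using assms coercive[of v] by (intro mult_left_mono) auto
  then show ?thesis by (simp add: Re_form algebra_simps)
qed

lemma coercive_form':
  assumes "0 < q" "q * k \<le> p" shows "Re (form p q v v) \<ge> q * c * (norm v)\<^sup>2"
proof -
  have "0 \<le> (p - q * k) * (norm (j v))\<^sup>2" using assms(2) by (intro mult_nonneg_nonneg) auto
  then show ?thesis using coercive_form[OF assms(1), of v p] by linarith
qed

lemma bound_form: "cmod (form p q u v) \<le> (\<bar>p\<bar> * (2 * Cj * Cj) + \<bar>q\<bar> * Ca) * norm u * norm v"
proof -
  have "cmod (cinner (j u) (j v)) \<le> 2 * Cj * Cj * norm u * norm v"
  proof -
    have "2 * Cj * norm v * norm (j u) \<le> 2 * Cj * norm v * (Cj * norm u)"
      by (rule mult_left_mono[OF norm_j]) (use Cj in simp)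
    then show ?thesis
      by (intro order_trans[OF cmod_cinner_j]) (simp add: mult_ac del: mult_le_cancel_left mult_le_cancel_left_pos)
  qed
  then have "\<bar>p\<bar> * cmod (cinner (j u) (j v)) \<le> \<bar>p\<bar> * (2 * Cj * Cj * norm u * norm v)"
    by (rule mult_left_mono) simp
  moreover have "\<bar>q\<bar> * cmod (a u v) \<le> \<bar>q\<bar> * (Ca * norm u * norm v)"
    by (rule mult_left_mono[OF bound_a]) simp
  ultimately show ?thesis
    unfolding form_def
    by (intro order_trans[OF norm_triangle_ineq]) (simp add: norm_mult algebra_simps)
qed

lemma form_sol:
  assumes "0 < q" "q * k \<le> p" shows "form p q (sol p q \<phi>) v = pairing \<phi> v"
proof -
  have "\<exists>u. \<forall>v. form p q u v = pairing \<phi> v"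
    using assms c coercive_form'[OF assms]
    by (intro lax_milgram_lemma[OF sesquilinear_form bound_form, where c = "q * c"]) auto
  then have "\<forall>v. form p q (sol p q \<phi>) v = pairing \<phi> v" unfolding sol_def by (rule someI_ex)
  then show ?thesis by simp
qed

lemma form_eq_0:
  assumes "0 < q" "q * k \<le> p" "form p q u u = 0" shows "u = 0"
proof -
  have "q * c * (norm u)\<^sup>2 \<le> 0" using coercive_form'[OF assms(1,2), of u] assms(3) by simp
  then show ?thesis using assms(1) c by (auto simp: mult_le_0_iff)
qed

lemma sol_eqI:
  assumes "0 < q" "q * k \<le> p" "\<And>v. form p q u v = pairing \<phi> v" shows "sol p q \<phi> = u"
proof -
  have "form p q (sol p q \<phi> - u) v = 0" for v
    by (simp add: sesquilinearD(7)[OF sesquilinear_form] form_sol assms)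
  from form_eq_0[OF assms(1,2) this] show ?thesis by simp
qed

lemma norm_sol:
  assumes "0 < q" "q * k \<le> p" shows "q * c * norm (sol p q \<phi>) \<le> norm \<phi>"
proof (cases "sol p q \<phi> = 0")
  case False
  have "q * c * (norm (sol p q \<phi>))\<^sup>2 \<le> Re (pairing \<phi> (sol p q \<phi>))"
    using coercive_form'[OF assms, of "sol p q \<phi>"] by (simp add: form_sol assms)
  also have "\<dots> \<le> norm \<phi> * norm (sol p q \<phi>)"
    by (rule order_trans[OF complex_Re_le_cmod norm_pairing])
  finally show ?thesis using False by (simp add: power2_eq_square mult.assoc[symmetric])
qed simp

lemma clin_sol:
  assumes "0 < q" "q * k \<le> p" shows "bounded_clinear (sol p q)"
proof -
  note f = sesquilinearD[OF sesquilinear_form]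
  have "bounded_linear (sol p q)"
  proof (rule bounded_linear_intro[of _ "1 / (q * c)"])
    show "norm (sol p q \<phi>) \<le> norm \<phi> * (1 / (q * c))" for \<phi>
      using norm_sol[OF assms, of \<phi>] assms(1) c by (simp add: pos_le_divide_eq mult.commute)
  qed (auto intro!: sol_eqI assms simp: f form_sol[OF assms] pairing_add pairing_scaleR)
  then show ?thesis
    by (auto simp: bounded_clinear_def f form_sol[OF assms] pairing_scaleC intro!: sol_eqI assms)
qed

text \<open>The graphs of \<open>k + A\<close> in \<open>H\<close> and in the antidual of \<open>V\<close>, with their resolvents \<open>(1 + h (k + A))\<^sup>-\<^sup>1\<close>.\<close>

definition "graph_H = {(x, y + k *\<^sub>R x) | x y. (x, y) \<in> lax_milgram j a}"
definition "graph_D = {(x, y + k *\<^sub>R x) | x y. (x, y) \<in> lax_milgram_ext_graph j a}"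
definition "res_H h x = j (sol (1 + h * k) h (emb_H j x))"
definition "res_D h \<phi> = emb_V j (sol (1 + h * k) h \<phi>)"

text \<open>In terms of \<open>form k 1\<close> the shift disappears: resolvent equations for k + A
  become variational equations to which \<open>form_sol\<close> and \<open>sol_eqI\<close> apply.
  The same is done for the antidual in \<open>graph_D_iff\<close>.\<close>

lemma graph_H_iff: "(x, y) \<in> graph_H \<longleftrightarrow> (\<exists>u. x = j u \<and> (\<forall>v. form k 1 u v = cinner y (j v)))"
proof
  assume "(x, y) \<in> graph_H"
  then show "\<exists>u. x = j u \<and> (\<forall>v. form k 1 u v = cinner y (j v))"
    by (auto simp: graph_H_def lax_milgram_def form_def cinner_add_left cinner_scaleR_left scaleR_conv_of_real)
next
  assume "\<exists>u. x = j u \<and> (\<forall>v. form k 1 u v = cinner y (j v))"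
  then obtain u where u: "x = j u" "\<And>v. form k 1 u v = cinner y (j v)" by blast
  have "a u v = cinner (y - k *\<^sub>R x) (j v)" for v
    using u(2)[of v] by (simp add: u(1) form_def cinner_diff_left cinner_scaleR_left scaleR_conv_of_real algebra_simps)
  then have "(x, y - k *\<^sub>R x) \<in> lax_milgram j a" using u(1) by (auto simp: lax_milgram_def)
  then show "(x, y) \<in> graph_H" by (force simp: graph_H_def)
qed

lemma graph_D_iff: "(x, y) \<in> graph_D \<longleftrightarrow> (\<exists>u. x = emb_V j u \<and> (\<forall>v. form k 1 u v = pairing y v))"
proof
  assume "(x, y) \<in> graph_D"
  then show "\<exists>u. x = emb_V j u \<and> (\<forall>v. form k 1 u v = pairing y v)"
    by (auto simp: graph_D_def lax_milgram_ext_graph_def form_def pairing_add pairing_scaleR scaleR_conv_of_real)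
next
  assume "\<exists>u. x = emb_V j u \<and> (\<forall>v. form k 1 u v = pairing y v)"
  then obtain u where u: "x = emb_V j u" "\<And>v. form k 1 u v = pairing y v" by blast
  have "lax_milgram_ext a u = y - k *\<^sub>R x"
    by (rule antidual_eqI) (simp add: u(2)[symmetric] u(1) form_def pairing_diff pairing_scaleR scaleR_conv_of_real)
  then have "(x, y - k *\<^sub>R x) \<in> lax_milgram_ext_graph j a"
    using u(1) by (auto simp: lax_milgram_ext_graph_def intro!: exI[of _ u])
  then show "(x, y) \<in> graph_D" by (force simp: graph_D_def)
qed

text \<open>The left-hand side is the form of 1 + h (k + A).\<close>

lemma form_step: "form (1 + h * k) h u v = cinner (j u) (j v) + h * form k 1 u v"
  by (simp add: form_def algebra_simps)

text \<open>If z is orthogonal to the range of (k + 1 + A)^(-1), then testing the equation for u =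
  (k + 1 + A)^(-1) z with u itself gives u = 0. Hence z annihilates the range of j, which is
  dense.\<close>

lemma dense_H: "closure (Domain graph_H) = UNIV"
proof -
  let ?S = "range (\<lambda>x. j (sol (k + 1) 1 (emb_H j x)))"
  have lin: "bounded_linear (\<lambda>x. j (sol (k + 1) 1 (emb_H j x)))"
    using clin_sol[of 1 "k + 1"]
    by (intro bounded_linear_compose[OF lin_j] bounded_linear_compose[OF _ lin_emb_H]) (auto simp: bounded_clinear_def)
  have "closure ?S = UNIV"
  proof (rule closure_eq_UNIV_if_orthogonal_trivial)
    show "subspace ?S" using lin by (simp add: bounded_linear.linear linear_subspace_image)
    fix z assume z: "\<And>s. s \<in> ?S \<Longrightarrow> Re (cinner z s) = 0"
    define u where "u = sol (k + 1) 1 (emb_H j z)"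
    have eq: "form (k + 1) 1 u v = cinner z (j v)" for v by (simp add: u_def form_sol)
    have "c * (norm u)\<^sup>2 \<le> 0" using coercive_form'[of 1 "k + 1" u] z[of "j u"] eq[of u] by (simp add: u_def)
    then have "u = 0" using c by (simp add: mult_le_0_iff)
    then have "cinner z (j v) = 0" for v
      using eq[of v] a(5)[of 0 0 v] by (simp add: form_def cinner_zero_left j.zero)
    then have "emb_H j z = emb_H j 0"
      by (intro antidual_eqI) (simp only: pairing_emb_H cinner_zero_left)
    then show "z = 0" by (rule injD[OF inj_emb_H])
  qed
  moreover have "?S \<subseteq> Domain graph_H"
  proof clarify
    fix x
    define u where "u = sol (k + 1) 1 (emb_H j x)"
    have "form (k + 1) 1 u v = cinner x (j v)" for v by (simp add: u_def form_sol)
    then have "form k 1 u v = cinner (x - j u) (j v)" for v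
      by (simp add: form_def cinner_diff_left algebra_simps)
    then have "(j u, x - j u) \<in> graph_H" by (auto simp: graph_H_iff)
    then show "j (sol (k + 1) 1 (emb_H j x)) \<in> Domain graph_H" by (auto simp: u_def)
  qed
  ultimately show ?thesis using closure_mono[of ?S "Domain graph_H"] by blast
qed

text \<open>Transported to V by \<open>riesz\<close>: for z orthogonal to the range, pairing the
  functional of z with z gives the squared H-norm of \<open>j z\<close>, so z = 0.\<close>

lemma dense_D: "closure (range (emb_V j)) = UNIV"
proof -
  have lin: "bounded_linear (\<lambda>u. riesz (emb_V j u))"
    by (intro bounded_linear_compose[OF bounded_linear_riesz lin_emb_V])
  have cl: "closure (range (\<lambda>u. riesz (emb_V j u))) = UNIV"
  proof (rule closure_eq_UNIV_if_orthogonal_trivial)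
    show "subspace (range (\<lambda>u. riesz (emb_V j u)))"
      using lin by (simp add: bounded_linear.linear linear_subspace_image)
    fix z assume z: "\<And>s. s \<in> range (\<lambda>u. riesz (emb_V j u)) \<Longrightarrow> Re (cinner z s) = 0"
    have "Re (cinner (riesz (emb_V j z)) z) = 0" using z Re_cinner_commute by (metis rangeI)
    then have "j z = 0" by (simp add: cinner_riesz Re_cinner_self)
    then show "z = 0" using inj_j j.zero by (metis injD)
  qed
  interpret r: bounded_linear "riesz :: 'v antidual \<Rightarrow> 'v" by (rule bounded_linear_riesz)
  have "\<phi> \<in> closure (range (emb_V j))" for \<phi>
    unfolding closure_approachable
  proof (intro allI impI)
    fix e :: real assume "e > 0"
    moreover have "riesz \<phi> \<in> closure (range (\<lambda>u. riesz (emb_V j u)))" by (simp add: cl)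
    ultimately obtain u where u: "dist (riesz (emb_V j u)) (riesz \<phi>) < e / 2"
      unfolding closure_approachable by (metis half_gt_zero imageE)
    have "dist (emb_V j u) \<phi> < e"
      using norm_le_riesz[of "emb_V j u - \<phi>"] u by (simp add: dist_norm r.diff)
    then show "\<exists>y\<in>range (emb_V j). dist y \<phi> < e" by blast
  qed
  then show ?thesis by blast
qed

lemma Domain_graph_D: "Domain graph_D = range (emb_V j)"
  by (auto simp: graph_D_def lax_milgram_ext_graph_def)

lemma step_size: "0 < h \<Longrightarrow> h * k \<le> 1 + h * k" by simp

lemma clin_res_H: "0 < h \<Longrightarrow> bounded_clinear (res_H h)"
proof -
  assume h: "0 < h"
  have s: "bounded_clinear (sol (1 + h * k) h)" by (rule clin_sol[OF h step_size[OF h]])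
  then have "bounded_linear (res_H h)" unfolding res_H_def[abs_def]
    by (intro bounded_linear_compose[OF lin_j] bounded_linear_compose[OF _ lin_emb_H])
      (simp add: bounded_clinear_def)
  then show ?thesis using s clin_emb_H by (simp add: res_H_def j_scaleC bounded_clinear_def)
qed

lemma clin_res_D: "0 < h \<Longrightarrow> bounded_clinear (res_D h)"
proof -
  assume h: "0 < h"
  have s: "bounded_clinear (sol (1 + h * k) h)" by (rule clin_sol[OF h step_size[OF h]])
  then have "bounded_linear (res_D h)" unfolding res_D_def[abs_def]
    by (intro bounded_linear_compose[OF lin_emb_V]) (simp add: bounded_clinear_def)
  then show ?thesis using s clin_emb_V by (simp add: res_D_def bounded_clinear_def)
qed

lemma resolvent_family_H: "resolvent_family graph_H res_H 1"
proof
  fix h :: real assume h: "0 < h"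
  note hs = h step_size[OF h]
  show "bounded_clinear (res_H h)" by (rule clin_res_H[OF h])
  show "(res_H h x, (x - res_H h x) /\<^sub>R h) \<in> graph_H" for x
    unfolding graph_H_iff res_H_def
  proof (intro exI[of _ "sol (1 + h * k) h (emb_H j x)"] conjI allI refl)
    fix v
    show "form k 1 (sol (1 + h * k) h (emb_H j x)) v
        = cinner ((x - j (sol (1 + h * k) h (emb_H j x))) /\<^sub>R h) (j v)"
      using form_sol[OF hs, of "emb_H j x" v] h
      by (simp add: form_step cinner_scaleR_left cinner_diff_left scaleR_conv_of_real field_simps)
  qed
  show "res_H h (x + h *\<^sub>R y) = x" if "(x, y) \<in> graph_H" for x y
  proof -
    obtain u where u: "x = j u" "\<And>v. form k 1 u v = cinner y (j v)" using \<open>(x, y) \<in> graph_H\<close> graph_H_iff by blast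
    have "sol (1 + h * k) h (emb_H j (x + h *\<^sub>R y)) = u"
      by (rule sol_eqI[OF hs]) (simp add: form_step u cinner_add_left cinner_scaleR_left scaleR_conv_of_real)
    then show ?thesis by (simp add: res_H_def u)
  qed
  \<comment> \<open>Testing with the solution u: the coefficient 1 + hk of the H-term absorbs the
    loss hk of coercivity and leaves exactly the square of the norm of \<open>j u\<close>.\<close>
  have contr: "norm (res_H h x) \<le> norm x" for x
  proof (cases "res_H h x = 0")
    case False
    define u where "u = sol (1 + h * k) h (emb_H j x)"
    have "(norm (j u))\<^sup>2 \<le> Re (form (1 + h * k) h u u)"
    proof -
      have "0 \<le> h * c * (norm u)\<^sup>2" using h c by simp
      then show ?thesis using coercive_form[OF h, of u "1 + h * k"] by simp
    qed
    also have "\<dots> = Re (cinner x (j u))" by (simp add: u_def form_sol hs)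
    also have "\<dots> \<le> norm x * norm (j u)" using abs_Re_cinner_le[of x "j u"] by linarith
    finally show ?thesis using False by (simp add: u_def res_H_def power2_eq_square)
  qed simp
  show "norm ((res_H h ^^ n) x) \<le> 1 * norm x" for n x
    by (induction n) (use contr order_trans in \<open>auto\<close>)
qed (use dense_H in auto)

end

section \<open>Power bounds for the resolvent in the antidual\<close>

text \<open>The continuous analogue: let \<open>y' + B y = 0\<close>, \<open>y(0) = g\<close>, and \<open>z(t) = \<integral>\<^sub>0\<^sup>t y\<close>, so that \<open>y = g - B z\<close>.
  Testing the equation for \<open>z\<close> with \<open>z\<close> bounds \<open>\<integral> \<parallel>z\<parallel>\<^sup>2\<close> by \<open>t \<parallel>g\<parallel>\<^sub>*\<^sup>2\<close>, and testing \<open>y' + B y = 0\<close>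
  with \<open>t\<^sup>2 y\<close> bounds \<open>\<integral> s\<^sup>2 \<parallel>y\<parallel>\<^sup>2\<close> likewise; then \<open>t \<parallel>z(t)\<parallel>\<^sup>2 = \<integral> (s \<parallel>z\<parallel>\<^sup>2)'\<close> bounds \<open>\<parallel>z(t)\<parallel>\<close> by \<open>\<parallel>g\<parallel>\<^sub>*\<close>.
  Below \<open>Y\<close>, \<open>Z\<close> are the norms in \<open>V\<close> of the Euler approximations of \<open>y\<close> and \<open>z\<close>, \<open>q\<close>, \<open>p\<close> their squared norms
  in \<open>H\<close>, and \<open>e\<close> is the dual norm of \<open>y\<close>.\<close>

lemma weighted_energy_bound:
  fixes p q Y Z e :: "nat \<Rightarrow> real" and G h c C :: real
  assumes h: "0 < h" and c: "0 < c" and C: "0 \<le> C" and G: "0 \<le> G"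
    and nonneg: "\<And>n. 0 \<le> p n" "\<And>n. 0 \<le> q n" "\<And>n. 0 \<le> Y n" "\<And>n. 0 \<le> Z n" "\<And>n. 0 \<le> e n"
    and Z0: "Z 0 = 0" and p0: "p 0 = 0"
    and p: "\<And>n. p (Suc n) - p n + h * c * (Z (Suc n))\<^sup>2 \<le> h * (G\<^sup>2 / c)"
    and qe: "\<And>n. q n \<le> e n * Y n"
    and q: "\<And>n. q (Suc n) - q n + 2 * h * c * (Y (Suc n))\<^sup>2 \<le> 0"
    and Y0: "h * c * Y 0 \<le> G"
    and e: "\<And>n. e n \<le> G + C * Z (Suc n)"
    and Z: "\<And>n. Z (Suc n) \<le> Z n + h * Y n"
  shows "e m \<le> (1 + C * sqrt ((10 + 8 * C\<^sup>2 / c\<^sup>2) / c\<^sup>2 + 2 / c\<^sup>2)) * G"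
proof -
  define N where "N = Suc m"
  define w where "w n = h * real (Suc n) * Y n" for n
  have N: "real N \<ge> 1" by (simp add: N_def)
  \<comment> \<open>Hypothesis \<open>p\<close> telescopes, since \<open>p 0\<close> vanishes and p
    is nonnegative.\<close>
  have SZ: "(\<Sum>n<N. (Z (Suc n))\<^sup>2) \<le> real N * (G\<^sup>2 / c\<^sup>2)"
  proof -
    have "p M + h * c * (\<Sum>n<M. (Z (Suc n))\<^sup>2) \<le> real M * (h * (G\<^sup>2 / c))" for M
    proof (induction M)
      case (Suc M) then show ?case using p[of M] by (simp add: algebra_simps add_divide_distrib)
    qed (simp add: p0)
    from this[of N] nonneg(1)[of N]
    have "h * c * (\<Sum>n<N. (Z (Suc n))\<^sup>2) \<le> real N * (h * (G\<^sup>2 / c))" by linarith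
    also have "\<dots> = h * c * (real N * (G\<^sup>2 / c\<^sup>2))" using c by (simp add: power2_eq_square)
    finally show ?thesis using h c by (simp only: mult_le_cancel_left_pos mult_pos_pos)
  qed
  \<comment> \<open>Summation by parts with the discrete weights (n + 1)^2 in place of t^2, whose
    increments are 2n + 3. Hypothesis \<open>q\<close> does not control \<open>Y 0\<close>; its term
    is therefore carried on the right and bounded through \<open>Y0\<close>.\<close>
  have W: "(real (Suc m))\<^sup>2 * q m + 2 * h * c * (\<Sum>n<Suc m. (real (Suc n))\<^sup>2 * (Y n)\<^sup>2)
      \<le> 2 * h * c * (Y 0)\<^sup>2 + q 0 + (\<Sum>n<m. (2 * real n + 3) * q n)" for m
  proof (induction m)
    case (Suc m)
    have "(real (Suc (Suc m)))\<^sup>2 * (q (Suc m) - q m + 2 * h * c * (Y (Suc m))\<^sup>2) \<le> 0"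
      using q[of m] by (simp add: mult_le_0_iff)
    then have 1: "(real (Suc (Suc m)))\<^sup>2 * q (Suc m) + 2 * h * c * ((real (Suc (Suc m)))\<^sup>2 * (Y (Suc m))\<^sup>2)
        \<le> (real (Suc (Suc m)))\<^sup>2 * q m" by (simp add: algebra_simps)
    have 2: "(real (Suc (Suc m)))\<^sup>2 * q m = (real (Suc m))\<^sup>2 * q m + (2 * real m + 3) * q m"
      by (simp add: power2_eq_square algebra_simps)
    show ?case
      unfolding sum.lessThan_Suc[of _ "Suc m"] sum.lessThan_Suc[of "\<lambda>n. (2 * real n + 3) * q n" m] distrib_left
      using 1 2 Suc by linarith
  qed simp
  have w2: "(\<Sum>n<N. (w n)\<^sup>2) = h * (h * (\<Sum>n<N. (real (Suc n))\<^sup>2 * (Y n)\<^sup>2))"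
    by (simp add: w_def sum_distrib_left power_mult_distrib power2_eq_square mult_ac)
  have q_le: "q 0 + (\<Sum>n<m. (2 * real n + 3) * q n) \<le> (\<Sum>n<N. 4 * (real (Suc n) * q n))"
  proof (cases m)
    case 0 then show ?thesis using nonneg(2)[of 0] by (simp add: N_def)
  next
    case (Suc m')
    have "(\<Sum>n<m. (2 * real n + 3) * q n) = 3 * q 0 + (\<Sum>n<m'. (2 * real (Suc n) + 3) * q (Suc n))"
      unfolding Suc by (subst sum.lessThan_Suc_shift) simp
    also have "(\<Sum>n<m'. (2 * real (Suc n) + 3) * q (Suc n)) \<le> (\<Sum>n<m'. 4 * (real (Suc (Suc n)) * q (Suc n)))"
    proof (rule sum_mono)
      fix n
      have "(2 * real (Suc n) + 3) * q (Suc n) \<le> (4 * real (Suc (Suc n))) * q (Suc n)"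
        using nonneg(2) by (intro mult_right_mono) auto
      then show "(2 * real (Suc n) + 3) * q (Suc n) \<le> 4 * (real (Suc (Suc n)) * q (Suc n))"
        by (simp only: mult.assoc)
    qed
    also have "\<dots> \<le> (\<Sum>n<m. 4 * (real (Suc (Suc n)) * q (Suc n)))"
      unfolding Suc using nonneg(2)[of "Suc m'"] by simp
    finally show ?thesis unfolding N_def by (subst sum.lessThan_Suc_shift) simp
  qed
  have "2 * h * c * (\<Sum>n<N. (real (Suc n))\<^sup>2 * (Y n)\<^sup>2) \<le> 2 * h * c * (Y 0)\<^sup>2 + (\<Sum>n<N. 4 * (real (Suc n) * q n))"
  proof -
    have "0 \<le> (real (Suc m))\<^sup>2 * q m" using nonneg(2)[of m] by simp
    then show ?thesis using W[of m] q_le unfolding N_def by linarith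
  qed
  from mult_left_mono[OF this, of h]
  have "h * (2 * h * c * (\<Sum>n<N. (real (Suc n))\<^sup>2 * (Y n)\<^sup>2))
      \<le> h * (2 * h * c * (Y 0)\<^sup>2) + h * (\<Sum>n<N. 4 * (real (Suc n) * q n))"
    using h by (simp only: distrib_left less_imp_le)
  also have "h * (\<Sum>n<N. 4 * (real (Suc n) * q n)) = (\<Sum>n<N. 4 * (h * real (Suc n) * q n))"
    by (simp only: sum_distrib_left mult_ac)
  also have "h * (2 * h * c * (Y 0)\<^sup>2) = 2 * c * (h * Y 0)\<^sup>2"
    by (simp only: power_mult_distrib power2_eq_square mult_ac)
  also have "h * (2 * h * c * (\<Sum>n<N. (real (Suc n))\<^sup>2 * (Y n)\<^sup>2)) = 2 * c * (\<Sum>n<N. (w n)\<^sup>2)"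
    by (simp only: w2 mult_ac)
  also have "2 * c * (h * Y 0)\<^sup>2 \<le> 2 * c * (G\<^sup>2 / c\<^sup>2)"
  proof -
    have "h * Y 0 \<le> G / c" using Y0 c by (simp add: pos_le_divide_eq mult_ac)
    then have "(h * Y 0)\<^sup>2 \<le> (G / c)\<^sup>2" using h nonneg(3) by (intro power_mono) auto
    then have "(h * Y 0)\<^sup>2 \<le> G\<^sup>2 / c\<^sup>2" by (simp only: power_divide)
    then show ?thesis by (rule mult_left_mono) (use c in simp)
  qed
  \<comment> \<open>Young's inequality weighted so that only one of the two copies of c times the
    sum of the squared \<open>w n\<close> on the left is used up.\<close>
  also have "(\<Sum>n<N. 4 * (h * real (Suc n) * q n)) \<le> (\<Sum>n<N. c * (w n)\<^sup>2 + 4 / c * (e n)\<^sup>2)"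
  proof (rule sum_mono)
    fix n
    have "h * real (Suc n) * q n \<le> h * real (Suc n) * (e n * Y n)"
      using h qe by (intro mult_left_mono) auto
    also have "\<dots> = w n * e n" by (simp only: w_def mult_ac)
    finally have "4 * (h * real (Suc n) * q n) \<le> 4 * (w n * e n)" by (rule mult_left_mono) simp
    also have "\<dots> \<le> c * (w n)\<^sup>2 + 4 / c * (e n)\<^sup>2"
    proof -
      have "0 \<le> (c * w n - 2 * e n)\<^sup>2 / c" using c by simp
      also have "\<dots> = c * (w n)\<^sup>2 + 4 / c * (e n)\<^sup>2 - 4 * (w n * e n)"
        using c by (simp add: power2_eq_square field_simps)
      finally show ?thesis by simp
    qed
    finally show "4 * (h * real (Suc n) * q n) \<le> c * (w n)\<^sup>2 + 4 / c * (e n)\<^sup>2" .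
  qed
  also have "\<dots> = c * (\<Sum>n<N. (w n)\<^sup>2) + 4 / c * (\<Sum>n<N. (e n)\<^sup>2)"
    by (simp add: sum.distrib sum_distrib_left)
  finally have 1: "c * (\<Sum>n<N. (w n)\<^sup>2) \<le> 2 * c * (G\<^sup>2 / c\<^sup>2) + 4 / c * (\<Sum>n<N. (e n)\<^sup>2)" by linarith
  have "(\<Sum>n<N. (e n)\<^sup>2) \<le> (\<Sum>n<N. 2 * G\<^sup>2 + 2 * C\<^sup>2 * (Z (Suc n))\<^sup>2)"
  proof (rule sum_mono)
    fix n
    have "(e n)\<^sup>2 \<le> (G + C * Z (Suc n))\<^sup>2" using e nonneg by (intro power_mono) auto
    also have "\<dots> \<le> 2 * G\<^sup>2 + 2 * C\<^sup>2 * (Z (Suc n))\<^sup>2"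
      using sum_squares_ge_zero[of "G - C * Z (Suc n)" 0] by (simp add: power2_eq_square algebra_simps)
    finally show "(e n)\<^sup>2 \<le> 2 * G\<^sup>2 + 2 * C\<^sup>2 * (Z (Suc n))\<^sup>2" .
  qed
  also have "\<dots> = real N * (2 * G\<^sup>2) + 2 * C\<^sup>2 * (\<Sum>n<N. (Z (Suc n))\<^sup>2)"
    by (simp add: sum.distrib sum_distrib_left)
  also have "\<dots> \<le> real N * (2 * G\<^sup>2) + 2 * C\<^sup>2 * (real N * (G\<^sup>2 / c\<^sup>2))"
    using SZ by (intro add_mono mult_left_mono) auto
  finally have "4 / c * (\<Sum>n<N. (e n)\<^sup>2) \<le> 4 / c * (real N * (2 * G\<^sup>2) + 2 * C\<^sup>2 * (real N * (G\<^sup>2 / c\<^sup>2)))"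
    using c by (intro mult_left_mono) auto
  moreover have "2 * c * (G\<^sup>2 / c\<^sup>2) \<le> real N * (2 * c * (G\<^sup>2 / c\<^sup>2))"
    using N c mult_right_mono[of 1 "real N" "2 * c * (G\<^sup>2 / c\<^sup>2)"] by simp
  ultimately have "c * (\<Sum>n<N. (w n)\<^sup>2) \<le> real N * (2 * c * (G\<^sup>2 / c\<^sup>2))
      + 4 / c * (real N * (2 * G\<^sup>2) + 2 * C\<^sup>2 * (real N * (G\<^sup>2 / c\<^sup>2)))"
    using 1 by linarith
  \<comment> \<open>The 10 is 2 from the initial term plus 8 from the G-part of e; the 8 in front of
    \<open>C\<^sup>2\<close> comes from its Z-part.\<close>
  also have "\<dots> = c * (real N * ((10 + 8 * C\<^sup>2 / c\<^sup>2) / c\<^sup>2 * G\<^sup>2))"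
    using c by (simp add: power2_eq_square field_simps)
  finally have Sw: "(\<Sum>n<N. (w n)\<^sup>2) \<le> real N * ((10 + 8 * C\<^sup>2 / c\<^sup>2) / c\<^sup>2 * G\<^sup>2)"
    by (simp only: mult_le_cancel_left_pos[OF c])
  \<comment> \<open>Product rule for n (Z n)^2. The increment is (n + 1) times the difference of the
    squares, at most w n (Z (n + 1) + Z n), plus one (Z n)^2. Young's inequality adds half a square
    of each, whence the 3.\<close>
  have ZN: "real M * (Z M)\<^sup>2 \<le> (\<Sum>n<M. (w n)\<^sup>2 + ((Z (Suc n))\<^sup>2 + 3 * (Z n)\<^sup>2) / 2)" for M
  proof (induction M)
    case (Suc M)
    have "(Z (Suc M) - Z M) * (Z (Suc M) + Z M) \<le> (h * Y M) * (Z (Suc M) + Z M)"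
      using Z[of M] nonneg(4) by (intro mult_right_mono) auto
    then have "real (Suc M) * ((Z (Suc M) - Z M) * (Z (Suc M) + Z M)) \<le> real (Suc M) * ((h * Y M) * (Z (Suc M) + Z M))"
      by (intro mult_left_mono) auto
    also have "\<dots> = w M * (Z (Suc M) + Z M)" by (simp add: w_def)
    also have "\<dots> \<le> (w M)\<^sup>2 + ((Z (Suc M))\<^sup>2 + (Z M)\<^sup>2) / 2"
    proof -
      have "0 \<le> (2 * w M - (Z (Suc M) + Z M))\<^sup>2 + (Z (Suc M) - Z M)\<^sup>2" by simp
      then show ?thesis by (simp add: power2_eq_square field_simps)
    qed
    finally have "real (Suc M) * ((Z (Suc M) - Z M) * (Z (Suc M) + Z M)) \<le> (w M)\<^sup>2 + ((Z (Suc M))\<^sup>2 + (Z M)\<^sup>2) / 2" .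
    moreover have "real (Suc M) * (Z (Suc M))\<^sup>2
        = real (Suc M) * ((Z (Suc M) - Z M) * (Z (Suc M) + Z M)) + real M * (Z M)\<^sup>2 + (Z M)\<^sup>2"
      by (simp add: power2_eq_square algebra_simps)
    ultimately have "real (Suc M) * (Z (Suc M))\<^sup>2 \<le> ((w M)\<^sup>2 + ((Z (Suc M))\<^sup>2 + (Z M)\<^sup>2) / 2)
        + (\<Sum>n<M. (w n)\<^sup>2 + ((Z (Suc n))\<^sup>2 + 3 * (Z n)\<^sup>2) / 2) + (Z M)\<^sup>2"
      using Suc by (simp only: add_mono order_refl)
    then show ?case by (simp add: field_simps)
  qed simp
  have "(\<Sum>n<N. (Z n)\<^sup>2) \<le> (\<Sum>n<N. (Z (Suc n))\<^sup>2)"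
    unfolding N_def using Z0 by (subst sum.lessThan_Suc_shift) simp
  then have "(\<Sum>n<N. (w n)\<^sup>2 + ((Z (Suc n))\<^sup>2 + 3 * (Z n)\<^sup>2) / 2)
      \<le> (\<Sum>n<N. (w n)\<^sup>2) + 2 * (\<Sum>n<N. (Z (Suc n))\<^sup>2)"
    by (simp add: sum.distrib sum_divide_distrib[symmetric] sum_distrib_left[symmetric])
  also have "\<dots> \<le> real N * ((10 + 8 * C\<^sup>2 / c\<^sup>2) / c\<^sup>2 * G\<^sup>2) + 2 * (real N * (G\<^sup>2 / c\<^sup>2))"
    using Sw SZ by (intro add_mono mult_left_mono) auto
  also have "\<dots> = real N * (((10 + 8 * C\<^sup>2 / c\<^sup>2) / c\<^sup>2 + 2 / c\<^sup>2) * G\<^sup>2)" by (simp add: algebra_simps)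
  finally have "real N * (Z N)\<^sup>2 \<le> real N * (((10 + 8 * C\<^sup>2 / c\<^sup>2) / c\<^sup>2 + 2 / c\<^sup>2) * G\<^sup>2)"
    using ZN[of N] by linarith
  moreover have "0 < real N" using N by linarith
  ultimately have "(Z N)\<^sup>2 \<le> ((10 + 8 * C\<^sup>2 / c\<^sup>2) / c\<^sup>2 + 2 / c\<^sup>2) * G\<^sup>2" by (simp only: mult_le_cancel_left_pos)
  from real_sqrt_le_mono[OF this]
  have "Z N \<le> sqrt ((10 + 8 * C\<^sup>2 / c\<^sup>2) / c\<^sup>2 + 2 / c\<^sup>2) * G"
    using nonneg(4) G by (simp only: real_sqrt_abs real_sqrt_mult abs_of_nonneg)
  from mult_left_mono[OF this C] e[of m] show ?thesis
    unfolding N_def distrib_right mult_1_left mult.assoc by linarith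
qed

text \<open>\<open>sg\<close> belongs to the shifted graph, and the factor exp(k t) removes the
  shift. This witness makes the choice in \<open>exp_minus\<close> meaningful.\<close>

lemma exp_minus_semigroup:
  fixes G :: "('b::{complex_normed_vector,banach} \<times> 'b) set"
  assumes "resolvent_family {(x, y + k *\<^sub>R x) | x y. (x, y) \<in> G} J M"
  shows "C0_semigroup (exp_minus G)" "generator (exp_minus G) = {(x, - y) | x y. (x, y) \<in> G}"
proof -
  interpret resolvent_family "{(x, y + k *\<^sub>R x) | x y. (x, y) \<in> G}" J M by fact
  let ?S = "\<lambda>t x. exp (k * t) *\<^sub>R sg t x"
  have "generator ?S = {(x, - y) | x y. (x, y) \<in> G}"
    unfolding generator_exp_shift[OF C0_sg] generator_sg by force
  then have "\<exists>S. C0_semigroup S \<and> generator S = {(x, - y) | x y. (x, y) \<in> G}"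
    using C0_semigroup_exp_shift[OF C0_sg] by blast
  from someI_ex[OF this]
  show "C0_semigroup (exp_minus G)" "generator (exp_minus G) = {(x, - y) | x y. (x, y) \<in> G}"
    unfolding exp_minus_def by blast+
qed

context gelfand_form
begin

text \<open>Here \<open>y n\<close> is the V-representative of the (n + 1)-st power applied to g,
  and \<open>z n\<close> is the Riemann sum of the earlier ones. A bound on the power
  \<open>Suc m\<close> is therefore one on the dual norm with index m in
  \<open>weighted_energy_bound\<close>.\<close>

lemma power_bound_res_D: "\<exists>M\<ge>1. \<forall>h>0. \<forall>n g. norm ((res_D h ^^ n) g) \<le> M * norm g"
proof -
  define C where "C = \<bar>k\<bar> * (2 * Cj * Cj) + \<bar>1\<bar> * Ca"
  define M where "M = 1 + C * sqrt ((10 + 8 * C\<^sup>2 / c\<^sup>2) / c\<^sup>2 + 2 / c\<^sup>2)"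
  let ?b = "form k 1"
  note b = sesquilinearD[OF sesquilinear_form[of k 1]]
  have C: "0 \<le> C" using Cj Ca by (simp add: C_def)
  have bC: "cmod (?b u v) \<le> C * norm u * norm v" for u v unfolding C_def by (rule bound_form)
  have bc: "Re (?b v v) \<ge> c * (norm v)\<^sup>2" for v using coercive_form'[of 1 k v] by simp
  have M1: "M \<ge> 1" using C by (simp add: M_def)
  have "norm ((res_D h ^^ n) g) \<le> M * norm g" if h: "0 < h" for h n g
  proof (cases n)
    case 0
    then show ?thesis using mult_right_mono[OF M1, of "norm g"] by simp
  next
    case (Suc m)
    define y where "y n = sol (1 + h * k) h ((res_D h ^^ n) g)" for n
    define z where "z n = h *\<^sub>R (\<Sum>l<n. y l)" for n
    have res: "(res_D h ^^ Suc n) g = emb_V j (y n)" for n by (simp add: res_D_def y_def)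
    have y: "cinner (j (y n)) (j v) + h * ?b (y n) v = pairing ((res_D h ^^ n) g) v" for n v
      unfolding y_def form_step[symmetric] by (rule form_sol[OF h step_size[OF h]])
    \<comment> \<open>The Euler steps summed up: the discrete form of y + B z = g.\<close>
    have z: "pairing ((res_D h ^^ n) g) v + ?b (z n) v = pairing g v" for n v
    proof (induction n)
      case 0 then show ?case using b(5)[of 0 0 v] by (simp add: z_def)
    next
      case (Suc n)
      have "z (Suc n) = z n + h *\<^sub>R y n" by (simp add: z_def scaleR_add_right)
      then show ?case using Suc unfolding res y[of n v, symmetric] by (simp add: b scaleR_conv_of_real algebra_simps)
    qed
    have z_Suc: "z (Suc n) = z n + h *\<^sub>R y n" for n by (simp add: z_def scaleR_add_right)
    have yz: "cinner (j (y n)) (j v) + ?b (z (Suc n)) v = pairing g v" for n v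
      using z[of "Suc n" v] res[of n] by simp
    have pair: "Re (pairing g v) \<le> norm g * norm v" for v
      by (rule order_trans[OF complex_Re_le_cmod norm_pairing])
    \<comment> \<open>It bounds an increment of squared norms by twice the inner product of the
      increment with the new value, which is what implicit Euler steps are tested with.\<close>
    have young: "Re (cinner x y) \<le> ((norm x)\<^sup>2 + (norm y)\<^sup>2) / 2" for x y :: 'h
    proof -
      have "0 \<le> (norm x - norm y)\<^sup>2" by simp
      then show ?thesis using abs_Re_cinner_le[of x y] by (simp add: power2_diff)
    qed
    have "norm (emb_V j (y m)) \<le> M * norm g"
      unfolding M_def
    proof (rule weighted_energy_bound[where h = h and p = "\<lambda>n. (norm (j (z n)))\<^sup>2" and q = "\<lambda>n. (norm (j (y n)))\<^sup>2"
          and Y = "\<lambda>n. norm (y n)" and Z = "\<lambda>n. norm (z n)" and e = "\<lambda>n. norm (emb_V j (y n))"])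
      fix n
      let ?z = "z (Suc n)" and ?y = "y (Suc n)"
      show "(norm (j ?z))\<^sup>2 - (norm (j (z n)))\<^sup>2 + h * c * (norm ?z)\<^sup>2 \<le> h * ((norm g)\<^sup>2 / c)"
      proof -
        have "Re (cinner (j (y n)) (j ?z)) + Re (?b ?z ?z) = Re (pairing g ?z)"
          using arg_cong[OF yz[of n ?z], of Re] by simp
        then have "Re (cinner (j (y n)) (j ?z)) + c * (norm ?z)\<^sup>2 \<le> norm g * norm ?z"
          using bc[of ?z] pair[of ?z] by linarith
        \<comment> \<open>The weights are chosen so that half of the coercive term remains after
          absorption.\<close>
        also have "norm g * norm ?z \<le> ((norm g)\<^sup>2 / c + c * (norm ?z)\<^sup>2) / 2"
        proof -
          have "0 \<le> (norm g - c * norm ?z)\<^sup>2 / c" using c by simp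
          also have "\<dots> = (norm g)\<^sup>2 / c + c * (norm ?z)\<^sup>2 - 2 * (norm g * norm ?z)"
            using c by (simp add: power2_eq_square field_simps)
          finally show ?thesis by simp
        qed
        finally have 1: "2 * Re (cinner (j (y n)) (j ?z)) + c * (norm ?z)\<^sup>2 \<le> (norm g)\<^sup>2 / c"
          by (simp add: field_simps)
        have "h * Re (cinner (j (y n)) (j ?z)) = Re (cinner (j ?z - j (z n)) (j ?z))"
          by (simp add: z_Suc j.add j.scaleR cinner_scaleR_left)
        also have "\<dots> = (norm (j ?z))\<^sup>2 - Re (cinner (j (z n)) (j ?z))"
          by (simp add: cinner_diff_left Re_cinner_self)
        finally have "(norm (j ?z))\<^sup>2 - (norm (j (z n)))\<^sup>2 \<le> 2 * (h * Re (cinner (j (y n)) (j ?z)))"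
          using young[of "j (z n)" "j ?z"] by (simp add: field_simps)
        then show ?thesis using mult_left_mono[OF 1, of h] h by (simp add: algebra_simps)
      qed
      show "(norm (j (y n)))\<^sup>2 \<le> norm (emb_V j (y n)) * norm (y n)"
        using norm_pairing[of "emb_V j (y n)" "y n"] complex_Re_le_cmod[of "pairing (emb_V j (y n)) (y n)"]
        by (simp add: Re_cinner_self)
      show "(norm (j ?y))\<^sup>2 - (norm (j (y n)))\<^sup>2 + 2 * h * c * (norm ?y)\<^sup>2 \<le> 0"
      proof -
        have "cinner (j ?y) (j ?y) + h * ?b ?y ?y = cinner (j (y n)) (j ?y)"
          using y[of "Suc n" ?y] res[of n] by simp
        from arg_cong[OF this, of Re]
        have "(norm (j ?y))\<^sup>2 + h * Re (?b ?y ?y) = Re (cinner (j (y n)) (j ?y))"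
          by (simp add: Re_cinner_self)
        moreover have "h * (c * (norm ?y)\<^sup>2) \<le> h * Re (?b ?y ?y)"
          using bc h by (intro mult_left_mono) auto
        ultimately show ?thesis using young[of "j (y n)" "j ?y"] by (simp add: field_simps)
      qed
      show "norm (emb_V j (y n)) \<le> norm g + C * norm ?z"
      proof (rule norm_antidual_bound)
        fix v
        have "pairing (emb_V j (y n)) v = pairing g v - ?b ?z v" using yz[of n v] by (simp add: algebra_simps)
        then have "cmod (pairing (emb_V j (y n)) v) \<le> cmod (pairing g v) + cmod (?b ?z v)"
          by (simp add: norm_triangle_ineq4)
        also have "\<dots> \<le> norm g * norm v + C * norm ?z * norm v" by (intro add_mono norm_pairing bC)
        finally show "cmod (pairing (emb_V j (y n)) v) \<le> (norm g + C * norm ?z) * norm v"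
          by (simp add: algebra_simps)
      qed (use C in simp)
      show "norm ?z \<le> norm (z n) + h * norm (y n)"
        using norm_triangle_ineq[of "z n" "h *\<^sub>R y n"] h by (simp add: z_Suc)
    next
      show "h * c * norm (y 0) \<le> norm g"
        unfolding y_def using norm_sol[OF h step_size[OF h], of g] by simp
    qed (use h c C in \<open>auto simp: z_def j.zero\<close>)
    then show ?thesis using res[of m] Suc by simp
  qed
  then show ?thesis using M1 by blast
qed

lemma resolvent_family_D: "\<exists>M. resolvent_family graph_D res_D M"
proof -
  obtain M where M: "M \<ge> 1" "\<And>h n g. h > 0 \<Longrightarrow> norm ((res_D h ^^ n) g) \<le> M * norm g"
    using power_bound_res_D by blast
  have "resolvent_family graph_D res_D M"
  proof
    fix h :: real assume h: "0 < h"
    note hs = h step_size[OF h]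
    show "(res_D h x, (x - res_D h x) /\<^sub>R h) \<in> graph_D" for x
      unfolding graph_D_iff res_D_def
    proof (intro exI[of _ "sol (1 + h * k) h x"] conjI allI refl)
      fix v
      show "form k 1 (sol (1 + h * k) h x) v = pairing ((x - emb_V j (sol (1 + h * k) h x)) /\<^sub>R h) v"
        using form_sol[OF hs, of x v] h
        by (simp add: form_step pairing_scaleR pairing_diff scaleR_conv_of_real field_simps)
    qed
    show "res_D h (x + h *\<^sub>R y) = x" if "(x, y) \<in> graph_D" for x y
    proof -
      obtain u where u: "x = emb_V j u" "\<And>v. form k 1 u v = pairing y v"
        using \<open>(x, y) \<in> graph_D\<close> graph_D_iff by blast
      have "sol (1 + h * k) h (x + h *\<^sub>R y) = u"
        by (rule sol_eqI[OF hs]) (simp add: form_step u pairing_add pairing_scaleR scaleR_conv_of_real)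
      then show ?thesis by (simp add: res_D_def u)
    qed
  qed (use M clin_res_D dense_D Domain_graph_D in auto)
  then show ?thesis ..
qed

abbreviation "S_H \<equiv> exp_minus (lax_milgram j a)"
abbreviation "S_D \<equiv> exp_minus (lax_milgram_ext_graph j a)"

lemma C0_S_H: "C0_semigroup S_H"
  and generator_S_H: "generator S_H = {(x, - y) | x y. (x, y) \<in> lax_milgram j a}"
  using exp_minus_semigroup resolvent_family_H unfolding graph_H_def by blast+

lemma C0_S_D: "C0_semigroup S_D"
  and generator_S_D: "generator S_D = {(x, - y) | x y. (x, y) \<in> lax_milgram_ext_graph j a}"
  using exp_minus_semigroup resolvent_family_D unfolding graph_D_def by blast+

sublocale S_H: c0 S_H by unfold_locales (rule C0_S_H)
sublocale S_D: c0 S_D by unfold_locales (rule C0_S_D)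

end

section \<open>Calculus for Bochner integrals\<close>

lemma bounded_linear_set_integral:
  fixes f :: "'a \<Rightarrow> 'x::{banach,second_countable_topology}" and F :: "'x \<Rightarrow> 'y::{banach,second_countable_topology}"
  assumes F: "bounded_linear F" and f: "set_integrable M A f"
  shows "set_integrable M A (\<lambda>x. F (f x))" "(LINT x:A|M. F (f x)) = F (LINT x:A|M. f x)"
proof -
  interpret bounded_linear F by fact
  have eq: "indicator A x *\<^sub>R F (f x) = F (indicator A x *\<^sub>R f x)" for x by (simp add: scaleR)
  show "set_integrable M A (\<lambda>x. F (f x))"
    using f integrable_bounded_linear[OF F] unfolding set_integrable_def eq by blast
  show "(LINT x:A|M. F (f x)) = F (LINT x:A|M. f x)"
    using f unfolding set_integrable_def set_lebesgue_integral_def eq by (rule integral_bounded_linear[OF F])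
qed

text \<open>Euclidean values let the fundamental theorem for the gauge integral be read off for the
  Lebesgue integral. Identities in the antidual are brought to this case by pairing with a fixed
  vector.\<close>

lemma FTC_lebesgue:
  fixes F f :: "real \<Rightarrow> 'a::euclidean_space"
  assumes "a \<le> b" "\<And>x. x \<in> {a..b} \<Longrightarrow> (F has_vector_derivative f x) (at x within {a..b})"
    and "continuous_on {a..b} f"
  shows "set_integrable lebesgue {a..b} f" "(LINT x:{a..b}|lebesgue. f x) = F b - F a"
proof -
  show f: "set_integrable lebesgue {a..b} f"
    using absolutely_integrable_continuous_real[OF assms(3)] .
  have "(f has_integral (F b - F a)) {a..b}"
    by (rule fundamental_theorem_of_calculus[OF assms(1,2)])
  then show "(LINT x:{a..b}|lebesgue. f x) = F b - F a"
    using set_lebesgue_integral_eq_integral(2)[OF f] by (simp add: integral_unique)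
qed

lemma vector_derivative_lipschitz:
  fixes f :: "real \<Rightarrow> 'a::real_normed_vector"
  assumes "\<And>s. s \<in> {a..b} \<Longrightarrow> (f has_vector_derivative f' s) (at s within {a..b})"
    and "\<And>s. s \<in> {a..b} \<Longrightarrow> norm (f' s) \<le> B" and "s \<in> {a..b}" "r \<in> {a..b}"
  shows "norm (f s - f r) \<le> B * \<bar>s - r\<bar>"
proof -
  have "norm (f s - f r) \<le> B * norm (s - r)"
  proof (rule differentiable_bound[of "{a..b}" f "\<lambda>s h. h *\<^sub>R f' s"])
    show "onorm (\<lambda>h. h *\<^sub>R f' s) \<le> B" if "s \<in> {a..b}" for s
    proof (rule onorm_bound)
      show "norm (h *\<^sub>R f' s) \<le> B * norm h" for h
        using mult_left_mono[OF assms(2)[OF that], of "\<bar>h\<bar>"] by (simp add: mult.commute)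
      show "0 \<le> B" using assms(2)[OF that] norm_ge_zero order_trans by blast
    qed
  qed (use assms in \<open>auto simp: has_vector_derivative_def\<close>)
  then show ?thesis by simp
qed

lemma indefinite_integral_diff:
  fixes f :: "real \<Rightarrow> 'x::{banach,second_countable_topology}"
  assumes f: "set_integrable lebesgue {0..T} f" and st: "0 \<le> s" "s \<le> t" "t \<le> T"
  shows "set_integrable lebesgue {s<..t} f"
    and "(LINT r:{0..t}|lebesgue. f r) - (LINT r:{0..s}|lebesgue. f r) = (LINT r:{s<..t}|lebesgue. f r)"
proof -
  show i: "set_integrable lebesgue {s<..t} f"
    by (rule set_integrable_subset[OF f]) (use st in auto)
  have "set_integrable lebesgue {0..s} f"
    by (rule set_integrable_subset[OF f]) (use st in auto)
  then have "(LINT r:{0..s} \<union> {s<..t}|lebesgue. f r) = (LINT r:{0..s}|lebesgue. f r) + (LINT r:{s<..t}|lebesgue. f r)"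
    using i by (intro set_integral_Un) auto
  moreover have "{0..s} \<union> {s<..t} = {0..t}" using st by auto
  ultimately show "(LINT r:{0..t}|lebesgue. f r) - (LINT r:{0..s}|lebesgue. f r) = (LINT r:{s<..t}|lebesgue. f r)"
    by simp
qed

lemma norm_set_integral_le:
  fixes f :: "real \<Rightarrow> 'x::{banach,second_countable_topology}"
  assumes "set_integrable M A f" "set_integrable M A g" "\<And>x. x \<in> A \<Longrightarrow> norm (f x) \<le> g x"
  shows "norm (LINT x:A|M. f x) \<le> (LINT x:A|M. (g x :: real))"
proof -
  have "norm (LINT x:A|M. f x) \<le> (LINT x:A|M. norm (f x))"
    using assms(1) by (rule set_integral_norm_bound)
  also have "\<dots> \<le> (LINT x:A|M. g x)"
    using assms by (intro set_integral_mono set_integrable_norm)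
  finally show ?thesis .
qed

text \<open>Increments are dominated by those of the indefinite integral of the norm, a real-valued
  gauge integral whose continuity is known.\<close>

lemma continuous_indefinite_integral:
  fixes f :: "real \<Rightarrow> 'x::{banach,second_countable_topology}"
  assumes f: "set_integrable lebesgue {0..T} f"
  shows "continuous_on {0..T} (\<lambda>s. LINT r:{0..s}|lebesgue. f r)"
proof -
  define N where "N s = (LINT r:{0..s}|lebesgue. norm (f r))" for s
  have nf: "set_integrable lebesgue {0..T} (\<lambda>r. norm (f r))" using f by (rule set_integrable_norm)
  have "N s = integral {0..s} (\<lambda>r. norm (f r))" if "s \<in> {0..T}" for s
    unfolding N_def
    by (rule set_lebesgue_integral_eq_integral(2)) (rule set_integrable_subset[OF nf], use that in auto)
  moreover have "continuous_on {0..T} (\<lambda>s. integral {0..s} (\<lambda>r. norm (f r)))"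
    using set_lebesgue_integral_eq_integral(1)[OF nf] by (rule indefinite_integral_continuous_1)
  ultimately have N: "continuous_on {0..T} N"
    using continuous_on_cong[of "{0..T}" "{0..T}" N "\<lambda>s. integral {0..s} (\<lambda>r. norm (f r))"] by simp
  have le: "norm ((LINT r:{0..t}|lebesgue. f r) - (LINT r:{0..s}|lebesgue. f r)) \<le> \<bar>N t - N s\<bar>"
    if "s \<in> {0..T}" "t \<in> {0..T}" for s t
  proof -
    have *: "norm ((LINT r:{0..t}|lebesgue. f r) - (LINT r:{0..s}|lebesgue. f r)) \<le> N t - N s"
      if "0 \<le> s" "s \<le> t" "t \<le> T" for s t
      unfolding N_def indefinite_integral_diff(2)[OF f that] indefinite_integral_diff(2)[OF nf that]
      by (rule set_integral_norm_bound) (rule indefinite_integral_diff(1)[OF f that])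
    show ?thesis using *[of s t] *[of t s] that by (cases "s \<le> t") (auto simp: norm_minus_commute)
  qed
  show ?thesis
    unfolding continuous_on_def
  proof
    fix s assume s: "s \<in> {0..T}"
    have "((\<lambda>t. \<bar>N t - N s\<bar>) \<longlongrightarrow> \<bar>N s - N s\<bar>) (at s within {0..T})"
      using N s by (intro tendsto_intros) (simp add: continuous_on_def)
    then have "((\<lambda>t. \<bar>N t - N s\<bar>) \<longlongrightarrow> 0) (at s within {0..T})" by simp
    then have "((\<lambda>t. (LINT r:{0..t}|lebesgue. f r) - (LINT r:{0..s}|lebesgue. f r)) \<longlongrightarrow> 0) (at s within {0..T})"
      by (rule Lim_null_comparison[rotated]) (use le s in \<open>auto simp: eventually_at_filter\<close>)
    then show "((\<lambda>t. LINT r:{0..t}|lebesgue. f r) \<longlongrightarrow> (LINT r:{0..s}|lebesgue. f r)) (at s within {0..T})"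
      by (rule LIM_zero_cancel)
  qed
qed

text \<open>Here \<open>B\<close> need only be strongly differentiable. The function \<open>Q s = B s (w s) - \<integral>\<^sub>0\<^sup>s B r (g r) dr\<close> is
  differentiable at every point even though \<open>w\<close> is not, because
  \<open>B t (w t - w s) - \<integral>\<^sub>s\<^sup>t B r (g r) dr = \<integral>\<^sub>s\<^sup>t (B t - B r) (g r) dr = o(t - s)\<close>.\<close>

lemma integration_by_parts_operator:
  fixes g w :: "real \<Rightarrow> 'x::{banach,second_countable_topology}" and B \<beta> :: "real \<Rightarrow> 'x \<Rightarrow> complex"
  assumes T: "0 \<le> T" and g: "set_integrable lebesgue {0..T} g"
    and w: "\<And>s. s \<in> {0..T} \<Longrightarrow> w s = w0 + (LINT r:{0..s}|lebesgue. g r)"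
    and B: "\<And>s. s \<in> {0..T} \<Longrightarrow> bounded_linear (B s)"
    and lip: "\<And>s r x. s \<in> {0..T} \<Longrightarrow> r \<in> {0..T} \<Longrightarrow> cmod (B s x - B r x) \<le> L * \<bar>s - r\<bar> * norm x"
    and deriv: "\<And>s x. s \<in> {0..T} \<Longrightarrow> ((\<lambda>s. B s x) has_vector_derivative \<beta> s x) (at s within {0..T})"
    and cont: "continuous_on {0..T} (\<lambda>s. \<beta> s (w s))"
    and Bg: "set_integrable lebesgue {0..T} (\<lambda>s. B s (g s))"
  shows "set_integrable lebesgue {0..T} (\<lambda>s. \<beta> s (w s))"
    and "(LINT s:{0..T}|lebesgue. \<beta> s (w s)) + (LINT s:{0..T}|lebesgue. B s (g s)) = B T (w T) - B 0 (w 0)"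
proof -
  define N where "N s = (LINT r:{0..s}|lebesgue. norm (g r))" for s
  define I where "I s = (LINT r:{0..s}|lebesgue. B r (g r))" for s
  define Q where "Q s = B s (w s) - I s" for s
  have ng: "set_integrable lebesgue {0..T} (\<lambda>r. norm (g r))" using g by (rule set_integrable_norm)
  have N: "continuous_on {0..T} N" unfolding N_def by (rule continuous_indefinite_integral[OF ng])
  \<comment> \<open>Both choices of \<open>\<tau>\<close> are needed: \<open>est\<close> freezes the
    operator at the moving time t, which may be the later or the earlier end of the
    interval.\<close>
  have step: "cmod (B \<tau> (w t - w s) - (I t - I s)) \<le> \<bar>L\<bar> * (t - s) * (N t - N s)"
    if st: "0 \<le> s" "s \<le> t" "t \<le> T" and \<tau>: "\<tau> = s \<or> \<tau> = t" for s t \<tau>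
  proof -
    note gi = indefinite_integral_diff[OF g st] and ngi = indefinite_integral_diff[OF ng st]
      and Bgi = indefinite_integral_diff[OF Bg st]
    have \<tau>T: "\<tau> \<in> {0..T}" using st \<tau> by auto
    note Bt = bounded_linear_set_integral[OF B[OF \<tau>T] gi(1)]
    have "w t - w s = (LINT r:{s<..t}|lebesgue. g r)" using w[of s] w[of t] st gi(2) by simp
    then have "B \<tau> (w t - w s) - (I t - I s) = (LINT r:{s<..t}|lebesgue. B \<tau> (g r) - B r (g r))"
      using Bt Bgi by (simp add: I_def set_integral_diff(2))
    also have "cmod \<dots> \<le> (LINT r:{s<..t}|lebesgue. \<bar>L\<bar> * (t - s) * norm (g r))"
    proof (rule norm_set_integral_le)
      show "set_integrable lebesgue {s<..t} (\<lambda>r. B \<tau> (g r) - B r (g r))"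
        using Bt(1) Bgi(1) by (rule set_integral_diff(1))
      show "set_integrable lebesgue {s<..t} (\<lambda>r. \<bar>L\<bar> * (t - s) * norm (g r))"
        using ngi(1) by (rule set_integrable_mult_right)
      fix r assume r: "r \<in> {s<..t}"
      have "cmod (B \<tau> (g r) - B r (g r)) \<le> L * \<bar>\<tau> - r\<bar> * norm (g r)"
        using r st by (intro lip \<tau>T) auto
      also have "\<dots> \<le> \<bar>L\<bar> * (t - s) * norm (g r)"
        using r \<tau> st by (intro mult_right_mono mult_mono) auto
      finally show "cmod (B \<tau> (g r) - B r (g r)) \<le> \<bar>L\<bar> * (t - s) * norm (g r)" .
    qed
    also have "\<dots> = \<bar>L\<bar> * (t - s) * (N t - N s)" using ngi by (simp add: N_def)
    finally show ?thesis .
  qed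
  have est: "cmod ((Q t - Q s) - (B t (w s) - B s (w s))) \<le> \<bar>L\<bar> * \<bar>t - s\<bar> * \<bar>N t - N s\<bar>"
    if "s \<in> {0..T}" "t \<in> {0..T}" for s t
  proof -
    have eq: "(Q t - Q s) - (B t (w s) - B s (w s)) = B t (w t - w s) - (I t - I s)"
      using linear_simps[OF B[OF that(2)]] by (simp add: Q_def)
    show ?thesis
    proof (cases "s \<le> t")
      case True
      have "\<bar>L\<bar> * (t - s) * (N t - N s) \<le> \<bar>L\<bar> * \<bar>t - s\<bar> * \<bar>N t - N s\<bar>"
        using True mult_left_mono[OF abs_ge_self[of "N t - N s"], of "\<bar>L\<bar> * (t - s)"] by simp
      then show ?thesis unfolding eq using step[of s t t] True that by simp
    next
      case False
      have "\<bar>L\<bar> * (s - t) * (N s - N t) \<le> \<bar>L\<bar> * \<bar>t - s\<bar> * \<bar>N t - N s\<bar>"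
        using False mult_left_mono[OF abs_ge_self[of "N s - N t"], of "\<bar>L\<bar> * (s - t)"]
        by (simp add: abs_minus_commute[of t] abs_minus_commute[of "N t"])
      moreover have "B t (w t - w s) - (I t - I s) = - (B t (w s - w t) - (I s - I t))"
        using linear_simps[OF B[OF that(2)]] by simp
      ultimately show ?thesis
        unfolding eq using step[of t s t] False that by (simp only: norm_minus_cancel) simp
    qed
  qed
  have "(Q has_vector_derivative \<beta> s (w s)) (at s within {0..T})" if s: "s \<in> {0..T}" for s
    unfolding has_vector_derivative_quotient
  proof -
    have "((\<lambda>t. \<bar>L\<bar> * \<bar>N t - N s\<bar>) \<longlongrightarrow> \<bar>L\<bar> * \<bar>N s - N s\<bar>) (at s within {0..T})"
      using N s by (intro tendsto_intros) (simp add: continuous_on_def)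
    then have "((\<lambda>t. \<bar>L\<bar> * \<bar>N t - N s\<bar>) \<longlongrightarrow> 0) (at s within {0..T})" by simp
    then have "((\<lambda>t. ((Q t - Q s) - (B t (w s) - B s (w s))) /\<^sub>R (t - s)) \<longlongrightarrow> 0) (at s within {0..T})"
    proof (rule Lim_null_comparison[rotated], unfold eventually_at_filter, intro always_eventually allI impI)
      fix t assume t: "t \<noteq> s" "t \<in> {0..T}"
      have "norm (((Q t - Q s) - (B t (w s) - B s (w s))) /\<^sub>R (t - s))
          = cmod ((Q t - Q s) - (B t (w s) - B s (w s))) / \<bar>t - s\<bar>"
        unfolding norm_scaleR abs_inverse by (simp only: divide_inverse mult.commute)
      also have "\<dots> \<le> \<bar>L\<bar> * \<bar>N t - N s\<bar>"
        using est[OF s t(2)] t(1) by (simp add: pos_divide_le_eq mult_ac)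
      finally show "norm (((Q t - Q s) - (B t (w s) - B s (w s))) /\<^sub>R (t - s)) \<le> \<bar>L\<bar> * \<bar>N t - N s\<bar>" .
    qed
    from tendsto_add[OF this deriv[OF s, of "w s", unfolded has_vector_derivative_quotient]]
    show "((\<lambda>t. (Q t - Q s) /\<^sub>R (t - s)) \<longlongrightarrow> \<beta> s (w s)) (at s within {0..T})"
      by (simp add: scaleR_diff_right)
  qed
  note FTC = FTC_lebesgue[OF T this cont]
  show "set_integrable lebesgue {0..T} (\<lambda>s. \<beta> s (w s))" by (rule FTC(1))
  have "I 0 = 0"
  proof -
    have "I 0 = integral {0..0} (\<lambda>r. B r (g r))" unfolding I_def
      by (rule set_lebesgue_integral_eq_integral(2)) (rule set_integrable_subset[OF Bg], use T in auto)
    then show ?thesis by simp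
  qed
  then show "(LINT s:{0..T}|lebesgue. \<beta> s (w s)) + (LINT s:{0..T}|lebesgue. B s (g s)) = B T (w T) - B 0 (w 0)"
    using FTC(2) by (simp add: Q_def I_def)
qed

section \<open>Test functions\<close>

definition smooth :: "(real \<Rightarrow> real) \<Rightarrow> bool" where
  "smooth f \<longleftrightarrow> (\<exists>D. D 0 = f \<and> (\<forall>k t. (D k has_real_derivative D (Suc k) t) (at t)))"

lemma smooth_if_closed_under_derivative:
  assumes "\<And>f. f \<in> A \<Longrightarrow> \<exists>f'\<in>A. \<forall>t. (f has_real_derivative f' t) (at t)" and "f \<in> A"
  shows "smooth f"
proof -
  from assms(1) obtain d where d: "\<And>f. f \<in> A \<Longrightarrow> d f \<in> A"
    "\<And>f t. f \<in> A \<Longrightarrow> (f has_real_derivative d f t) (at t)" by metis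
  have "(d ^^ k) f \<in> A" for k by (induction k) (auto intro: d assms(2))
  then show ?thesis unfolding smooth_def
    by (intro exI[of _ "\<lambda>k. (d ^^ k) f"]) (simp add: d(2))
qed

lemma smooth_linear_combination:
  assumes "smooth f" "smooth g" shows "smooth (\<lambda>x. r * f x + s * g x)"
proof -
  obtain D E where "D 0 = f" "\<And>k t. (D k has_real_derivative D (Suc k) t) (at t)"
    "E 0 = g" "\<And>k t. (E k has_real_derivative E (Suc k) t) (at t)"
    using assms unfolding smooth_def by metis
  then show ?thesis unfolding smooth_def
    by (intro exI[of _ "\<lambda>k x. r * D k x + s * E k x"]) (auto intro!: derivative_eq_intros)
qed

lemma smooth_continuous: "smooth f \<Longrightarrow> continuous_on A f"
proof -
  assume "smooth f"
  then obtain D where "\<And>t. (f has_real_derivative D t) (at t)" unfolding smooth_def by blast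
  then show ?thesis by (meson DERIV_continuous_on has_field_derivative_at_within)
qed

text \<open>Derivatives of \<open>flat m\<close> are linear combinations of functions of the same kind, so that
  iterating differentiation never leaves the span of the products \<open>flat m (x - a) * flat n (b - x)\<close>.\<close>

definition flat :: "nat \<Rightarrow> real \<Rightarrow> real" where
  "flat m x = (if x > 0 then exp (- inverse x) * inverse x ^ m else 0)"

lemma flat_nonneg: "0 \<le> flat m x" and flat_pos: "0 < x \<Longrightarrow> 0 < flat m x" and flat_eq_0: "x \<le> 0 \<Longrightarrow> flat m x = 0"
  by (auto simp: flat_def)

lemma flat_tendsto_0: "((\<lambda>x. flat m x) \<longlongrightarrow> 0) (at 0)"
proof -
  have "((\<lambda>x. inverse x ^ m / exp (inverse x)) \<longlongrightarrow> 0) (at_right (0::real))"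
    by (rule filterlim_compose[OF tendsto_power_div_exp_0 filterlim_inverse_at_top_right])
  then have "(flat m \<longlongrightarrow> 0) (at_right 0)"
    by (rule Lim_transform_eventually)
      (auto simp: eventually_at_filter flat_def exp_minus divide_inverse intro!: always_eventually)
  moreover have "(flat m \<longlongrightarrow> 0) (at_left 0)"
    by (rule Lim_transform_eventually[OF tendsto_const])
      (auto simp: eventually_at_filter flat_def intro!: always_eventually)
  ultimately show ?thesis by (simp add: filterlim_split_at)
qed

lemma DERIV_flat: "(flat m has_real_derivative (flat (m + 2) x - m * flat (m + 1) x)) (at x)"
proof -
  consider "x > 0" | "x < 0" | "x = 0" by linarith
  then show ?thesis
  proof cases
    case 1
    have p: "((\<lambda>x. inverse x ^ m) has_real_derivative - (m * inverse x ^ (m + 1))) (at x)"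
      using 1 by (intro DERIV_cong[OF DERIV_power[OF DERIV_inverse]]) (cases m; simp add: mult_ac)+
    have e: "((\<lambda>x. exp (- inverse x)) has_real_derivative exp (- inverse x) * - (- (inverse x ^ Suc (Suc 0)))) (at x)"
      using 1 by (intro DERIV_fun_exp DERIV_minus DERIV_inverse) simp
    have "((\<lambda>x. exp (- inverse x) * inverse x ^ m) has_real_derivative
        (flat (m + 2) x - m * flat (m + 1) x)) (at x)"
      using 1 by (intro DERIV_cong[OF DERIV_mult[OF e p]])
        (simp add: flat_def power_add algebra_simps)
    then show ?thesis
      by (rule has_field_derivative_transform_within_open[of _ _ _ "{0<..}"]) (use 1 in \<open>auto simp: flat_def\<close>)
  next
    case 2
    have "((\<lambda>x. 0) has_real_derivative (flat (m + 2) x - m * flat (m + 1) x)) (at x)"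
      using 2 by (auto simp: flat_def)
    then show ?thesis
      by (rule has_field_derivative_transform_within_open[of _ _ _ "{..<0}"]) (use 2 in \<open>auto simp: flat_def\<close>)
  next
    case 3
    \<comment> \<open>The quotient is \<open>flat (m + 1) h\<close>, which vanishes in the
      limit.\<close>
    have "((\<lambda>h. (flat m h - flat m 0) / (h - 0)) \<longlongrightarrow> 0) (at 0)"
      by (rule Lim_transform_eventually[OF flat_tendsto_0[of "m + 1"]])
        (auto simp: eventually_at_filter flat_def divide_inverse intro!: always_eventually)
    then show ?thesis using 3 by (simp add: has_field_derivative_iff flat_def)
  qed
qed

inductive_set bump_span :: "real \<Rightarrow> real \<Rightarrow> (real \<Rightarrow> real) set" for a b where
  basis: "(\<lambda>x. flat m (x - a) * flat n (b - x)) \<in> bump_span a b"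
| lin: "f \<in> bump_span a b \<Longrightarrow> g \<in> bump_span a b \<Longrightarrow> (\<lambda>x. r * f x + s * g x) \<in> bump_span a b"

lemma bump_span_derivative:
  "f \<in> bump_span a b \<Longrightarrow> \<exists>f'\<in>bump_span a b. \<forall>t. (f has_real_derivative f' t) (at t)"
proof (induction rule: bump_span.induct)
  case (basis m n)
  let ?e = "\<lambda>m n x. flat m (x - a) * flat n (b - x)"
  have 1: "((\<lambda>x. flat m (x - a)) has_real_derivative (flat (m + 2) (t - a) - m * flat (m + 1) (t - a))) (at t)" for t
  proof -
    have "((\<lambda>x. x - a) has_real_derivative 1) (at t)" by (auto intro!: derivative_eq_intros)
    from DERIV_chain2[of "flat m" _ "\<lambda>x. x - a" t 1 UNIV, OF DERIV_flat this] show ?thesis by simp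
  qed
  have 2: "((\<lambda>x. flat n (b - x)) has_real_derivative - (flat (n + 2) (b - t) - n * flat (n + 1) (b - t))) (at t)" for t
  proof -
    have "((\<lambda>x. b - x) has_real_derivative - 1) (at t)" by (auto intro!: derivative_eq_intros)
    from DERIV_chain2[of "flat n" _ "\<lambda>x. b - x" t "- 1" UNIV, OF DERIV_flat this] show ?thesis by simp
  qed
  \<comment> \<open>The redundant factors 1 make the derivative a literal instance of
    \<open>bump_span.lin\<close>.\<close>
  have "(?e m n has_real_derivative
      1 * (1 * ?e (m + 2) n t + (- real m) * ?e (m + 1) n t)
      + 1 * ((- 1) * ?e m (n + 2) t + real n * ?e m (n + 1) t)) (at t)" for t
    by (rule DERIV_cong[OF DERIV_mult[OF 1 2]]) (simp add: algebra_simps)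
  note deriv = this
  have mem: "(\<lambda>t. 1 * (1 * ?e (m + 2) n t + (- real m) * ?e (m + 1) n t)
      + 1 * ((- 1) * ?e m (n + 2) t + real n * ?e m (n + 1) t)) \<in> bump_span a b"
    by (intro bump_span.intros)
  show ?case by (rule bexI[OF _ mem]) (intro allI deriv)
next
  case (lin f g r s)
  then obtain f' g' where "f' \<in> bump_span a b" "g' \<in> bump_span a b"
    "\<And>t. (f has_real_derivative f' t) (at t)" "\<And>t. (g has_real_derivative g' t) (at t)" by blast
  then show ?case
    by (intro bexI[of _ "\<lambda>x. r * f' x + s * g' x"]) (auto intro!: derivative_eq_intros bump_span.lin)
qed

lemma mollifier_exists:
  fixes a \<delta> :: real assumes "0 < \<delta>"
  obtains \<rho> where "smooth \<rho>" "\<And>x. 0 \<le> \<rho> x" "\<And>x. x \<notin> {a..a+\<delta>} \<Longrightarrow> \<rho> x = 0" "(\<rho> has_integral 1) {a..a+\<delta>}"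
proof -
  define b where "b x = flat 0 (x - a) * flat 0 (a + \<delta> - x)" for x
  have "b \<in> bump_span a (a + \<delta>)" unfolding b_def by (rule bump_span.basis)
  then have b: "smooth b" using smooth_if_closed_under_derivative bump_span_derivative by blast
  have cb: "continuous_on A b" for A using b by (rule smooth_continuous)
  have ib: "b integrable_on {a..a+\<delta>}" by (rule integrable_continuous_real[OF cb])
  have b0: "0 \<le> b x" for x by (simp add: b_def flat_nonneg)
  define I where "I = integral {a..a+\<delta>} b"
  have "I \<noteq> 0"
  proof
    assume "I = 0"
    then have "b (a + \<delta> / 2) = 0"
      using integral_eq_0_iff[of a "a + \<delta>" b] cb b0 assms I_def by auto
    then show False using flat_pos[of "\<delta> / 2" 0] assms by (simp add: b_def)
  qed
  then have I: "I > 0" using integral_nonneg[OF ib] b0 I_def by force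
  show thesis
  proof
    show "smooth (\<lambda>x. inverse I * b x + 0 * b x)" by (rule smooth_linear_combination[OF b b])
    show "0 \<le> inverse I * b x + 0 * b x" for x using b0 I by simp
    show "inverse I * b x + 0 * b x = 0" if "x \<notin> {a..a+\<delta>}" for x
      using that by (auto simp: b_def flat_eq_0)
    show "((\<lambda>x. inverse I * b x + 0 * b x) has_integral 1) {a..a+\<delta>}"
      using has_integral_mult_right[OF integrable_integral[OF ib], of "inverse I"] I by (simp add: I_def)
  qed
qed

text \<open>Integral zero is exactly what makes the primitive vanish again to the right of the
  support, so that it is a test function.\<close>

lemma test_function_from_mollifiers:
  assumes \<rho>: "smooth \<rho>" "\<And>x. x \<notin> {a..b} \<Longrightarrow> \<rho> x = 0" and int: "(\<rho> has_integral 0) {a..b}"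
    and ab: "0 < a" "a \<le> b" "b < T"
  shows "\<exists>\<phi>. test_function T \<phi> \<and> (\<forall>t. (\<phi> has_vector_derivative complex_of_real (\<rho> t)) (at t))"
proof -
  \<comment> \<open>Starting at -1 puts the whole support into the interior of the range of
    integration; left of 0 the primitive vanishes.\<close>
  define \<Phi> where "\<Phi> x = integral {- 1..x} \<rho>" for x
  have c: "continuous_on A \<rho>" for A using \<rho>(1) by (rule smooth_continuous)
  have zero: "\<Phi> x = 0" if "x \<notin> {a..b}" for x
  proof (cases "x < a")
    case True
    have "\<Phi> x = integral {- 1..x} (\<lambda>_. 0)" unfolding \<Phi>_def
      by (rule integral_cong) (use True \<rho>(2) in auto)
    then show ?thesis by simp
  next
    case False
    then have "x > b" using that by auto
    have "(\<rho> has_integral 0) {- 1..x}"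
      by (rule has_integral_on_superset[OF int]) (use \<open>x > b\<close> ab \<rho>(2) in auto)
    then show ?thesis unfolding \<Phi>_def by (rule integral_unique)
  qed
  have deriv: "(\<Phi> has_real_derivative \<rho> x) (at x)" for x
  proof (cases "x > - 1")
    case True
    have "(\<Phi> has_vector_derivative \<rho> x) (at x within {- 1..x+1})" unfolding \<Phi>_def
      by (rule integral_has_vector_derivative[OF c]) (use True in auto)
    then have "(\<Phi> has_vector_derivative \<rho> x) (at x)"
      using at_within_interior[of x "{- 1..x+1}"] True by (simp add: interior_atLeastAtMost_real)
    then show ?thesis by (simp add: has_real_derivative_iff_has_vector_derivative)
  next
    case False
    then have "\<rho> x = 0" using \<rho>(2)[of x] ab by auto
    then have "((\<lambda>_. 0) has_real_derivative \<rho> x) (at x)" by simp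
    then show ?thesis
      by (rule has_field_derivative_transform_within_open[of _ _ _ "{..<0}"]) (use False zero ab in auto)
  qed
  obtain D where D: "D 0 = \<rho>" "\<And>k t. (D k has_real_derivative D (Suc k) t) (at t)"
    using \<rho>(1) unfolding smooth_def by blast
  define D' where "D' k t = complex_of_real (case k of 0 \<Rightarrow> \<Phi> t | Suc l \<Rightarrow> D l t)" for k t
  have D': "(D' k has_vector_derivative D' (Suc k) t) (at t)" for k t
  proof -
    have "((\<lambda>t. case k of 0 \<Rightarrow> \<Phi> t | Suc l \<Rightarrow> D l t) has_vector_derivative D k t) (at t)"
      using deriv D by (cases k) (auto simp: has_real_derivative_iff_has_vector_derivative[symmetric])
    from bounded_linear.has_vector_derivative[OF bounded_linear_of_real this]
    show ?thesis unfolding D'_def by simp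
  qed
  have "test_function T (D' 0)" unfolding test_function_def
  proof
    show "\<exists>D. D 0 = D' 0 \<and> (\<forall>k t. (D k has_vector_derivative D (Suc k) t) (at t))"
      using D' by (intro exI[of _ D']) simp
    show "\<exists>c d. 0 < c \<and> d < T \<and> (\<forall>t. t \<notin> {c..d} \<longrightarrow> D' 0 t = 0)"
      by (rule exI[of _ a], rule exI[of _ b]) (use zero ab in \<open>auto simp: D'_def\<close>)
  qed
  moreover have "(D' 0 has_vector_derivative complex_of_real (\<rho> t)) (at t)" for t
    using D'[of 0 t] by (simp add: D'_def D(1))
  ultimately show ?thesis by blast
qed

section \<open>Weak derivatives of scalar functions\<close>

lemma test_function_C1:
  assumes "test_function T \<phi>"
  obtains d where "\<And>t. (\<phi> has_vector_derivative d t) (at t)" "continuous_on A d"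
    "\<And>t. t \<notin> {0<..<T} \<Longrightarrow> \<phi> t = 0" "\<And>t. vector_derivative \<phi> (at t) = d t"
proof -
  obtain D p q where D: "D 0 = \<phi>" "\<And>k t. (D k has_vector_derivative D (Suc k) t) (at t)"
    and pq: "0 < p" "q < T" "\<And>t. t \<notin> {p..q} \<Longrightarrow> \<phi> t = 0"
    using assms unfolding test_function_def by auto
  have d: "(\<phi> has_vector_derivative D 1 t) (at t)" for t using D(2)[of 0] D(1) by simp
  show thesis
  proof
    show "(\<phi> has_vector_derivative D 1 t) (at t)" for t by (rule d)
    show "continuous_on A (D 1)"
      using D(2)[of 1] by (intro continuous_at_imp_continuous_on ballI has_vector_derivative_continuous)
    show "\<phi> t = 0" if "t \<notin> {0<..<T}" for t using that pq by (intro pq(3)) auto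
    show "vector_derivative \<phi> (at t) = D 1 t" for t using d by (rule vector_derivative_at)
  qed
qed

lemma integral_mollifier_near:
  fixes d :: "real \<Rightarrow> complex"
  assumes \<rho>: "smooth \<rho>" "\<And>x. 0 \<le> \<rho> x" "(\<rho> has_integral 1) {a..a+\<delta>}"
    and d: "continuous_on {a..a+\<delta>} d" and near: "\<And>x. x \<in> {a..a+\<delta>} \<Longrightarrow> cmod (d x - z) \<le> \<epsilon>"
  shows "cmod (integral {a..a+\<delta>} (\<lambda>x. \<rho> x *\<^sub>R d x) - z) \<le> \<epsilon>"
proof -
  have c: "continuous_on A \<rho>" for A using \<rho>(1) by (rule smooth_continuous)
  have i: "(\<lambda>x. \<rho> x *\<^sub>R d x) integrable_on {a..a+\<delta>}"
    by (intro integrable_continuous_real continuous_intros c d)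
  have z: "((\<lambda>x. \<rho> x *\<^sub>R z) has_integral z) {a..a+\<delta>}"
    using has_integral_scaleR_left[OF \<rho>(3), of z] by simp
  have "integral {a..a+\<delta>} (\<lambda>x. \<rho> x *\<^sub>R d x) - z = integral {a..a+\<delta>} (\<lambda>x. \<rho> x *\<^sub>R (d x - z))"
    using has_integral_diff[OF integrable_integral[OF i] z]
    by (simp add: scaleR_diff_right integral_unique)
  also have "cmod \<dots> \<le> integral {a..a+\<delta>} (\<lambda>x. \<rho> x * \<epsilon>)"
  proof (rule integral_norm_bound_integral)
    show "(\<lambda>x. \<rho> x *\<^sub>R (d x - z)) integrable_on {a..a+\<delta>}"
      by (intro integrable_continuous_real continuous_intros c d)
    show "(\<lambda>x. \<rho> x * \<epsilon>) integrable_on {a..a+\<delta>}"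
      by (intro integrable_continuous_real continuous_intros c)
    show "cmod (\<rho> x *\<^sub>R (d x - z)) \<le> \<rho> x * \<epsilon>" if "x \<in> {a..a+\<delta>}" for x
      using mult_left_mono[OF near[OF that] \<rho>(2)[of x]] \<rho>(2)[of x] by simp
  qed
  also have "\<dots> = \<epsilon>"
    by (rule integral_unique) (use has_integral_mult_left[OF \<rho>(3), of \<epsilon>] in simp)
  finally show ?thesis .
qed

text \<open>Testing with a primitive of the difference of two mollifiers, one just right of s and
  one just right of t, shows that the averages of d near both points coincide.\<close>

lemma constant_if_weak_derivative_0:
  fixes d :: "real \<Rightarrow> complex"
  assumes T: "0 < T" and d: "continuous_on {0..T} d"
    and weak: "\<And>\<phi>. test_function T \<phi> \<Longrightarrow> (LINT t:{0..T}|lebesgue. vector_derivative \<phi> (at t) * d t) = 0"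
    and st: "s \<in> {0..T}" "t \<in> {0..T}"
  shows "d s = d t"
proof -
  have inner: "d s = d t" if st: "0 < s" "s < t" "t < T" for s t
  proof -
    have "cmod (d s - d t) \<le> 2 * \<epsilon>" if e: "0 < \<epsilon>" for \<epsilon>
    proof -
      have near: "\<exists>\<delta>>0. \<forall>x\<in>{0..T}. dist x a < \<delta> \<longrightarrow> dist (d x) (d a) < \<epsilon>" if "a \<in> {0..T}" for a
        using d that e unfolding continuous_on_iff by blast
      obtain \<delta>1 where \<delta>1: "\<delta>1 > 0" "\<And>x. x \<in> {0..T} \<Longrightarrow> dist x s < \<delta>1 \<Longrightarrow> dist (d x) (d s) < \<epsilon>"
        using near[of s] st by auto
      obtain \<delta>2 where \<delta>2: "\<delta>2 > 0" "\<And>x. x \<in> {0..T} \<Longrightarrow> dist x t < \<delta>2 \<Longrightarrow> dist (d x) (d t) < \<epsilon>"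
        using near[of t] st by auto
      define \<delta> where "\<delta> = min (min \<delta>1 \<delta>2) (T - t) / 2"
      have \<delta>: "\<delta> > 0" "\<delta> < \<delta>1" "\<delta> < \<delta>2" "t + \<delta> < T" using \<delta>1 \<delta>2 st by (auto simp: \<delta>_def min_def field_simps)
      obtain \<rho> where \<rho>: "smooth \<rho>" "\<And>x. 0 \<le> \<rho> x" "\<And>x. x \<notin> {s..s+\<delta>} \<Longrightarrow> \<rho> x = 0" "(\<rho> has_integral 1) {s..s+\<delta>}"
        using mollifier_exists[OF \<delta>(1)] by blast
      obtain \<sigma> where \<sigma>: "smooth \<sigma>" "\<And>x. 0 \<le> \<sigma> x" "\<And>x. x \<notin> {t..t+\<delta>} \<Longrightarrow> \<sigma> x = 0" "(\<sigma> has_integral 1) {t..t+\<delta>}"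
        using mollifier_exists[OF \<delta>(1)] by blast
      have "smooth (\<lambda>x. 1 * \<rho> x + (- 1) * \<sigma> x)" by (rule smooth_linear_combination[OF \<rho>(1) \<sigma>(1)])
      then have sm: "smooth (\<lambda>x. \<rho> x - \<sigma> x)" by simp
      have "(\<rho> has_integral 1) {s..t+\<delta>}" "(\<sigma> has_integral 1) {s..t+\<delta>}"
        by (rule has_integral_on_superset[OF \<rho>(4)] has_integral_on_superset[OF \<sigma>(4)],
            use st \<rho>(3) \<sigma>(3) in auto)+
      then have "((\<lambda>x. \<rho> x - \<sigma> x) has_integral (1 - 1)) {s..t+\<delta>}" by (rule has_integral_diff)
      then have "((\<lambda>x. \<rho> x - \<sigma> x) has_integral 0) {s..t+\<delta>}" by simp
      then have "\<exists>\<phi>. test_function T \<phi> \<and> (\<forall>x. (\<phi> has_vector_derivative complex_of_real (\<rho> x - \<sigma> x)) (at x))"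
        by (rule test_function_from_mollifiers[OF sm, rotated]) (use \<rho>(3) \<sigma>(3) st \<delta> in auto)
      then obtain \<phi> where \<phi>: "test_function T \<phi>" "\<And>x. (\<phi> has_vector_derivative complex_of_real (\<rho> x - \<sigma> x)) (at x)"
        by blast
      have c: "continuous_on A \<rho>" "continuous_on A \<sigma>" for A using \<rho>(1) \<sigma>(1) by (auto intro: smooth_continuous)
      have super: "integral {0..T} (\<lambda>x. f x *\<^sub>R d x) = integral {a..a+\<delta>} (\<lambda>x. f x *\<^sub>R d x)"
        if f: "\<And>x. x \<notin> {a..a+\<delta>} \<Longrightarrow> f x = 0" "0 \<le> a" "a + \<delta> \<le> T" "continuous_on {a..a+\<delta>} f" for f a
      proof (rule integral_unique, rule has_integral_on_superset[OF integrable_integral])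
        show "(\<lambda>x. f x *\<^sub>R d x) integrable_on {a..a+\<delta>}"
          using f by (intro integrable_continuous_real continuous_intros continuous_on_subset[OF d]) auto
      qed (use f in auto)
      have "(LINT x:{0..T}|lebesgue. vector_derivative \<phi> (at x) * d x) = (LINT x:{0..T}|lebesgue. (\<rho> x - \<sigma> x) *\<^sub>R d x)"
        using vector_derivative_at[OF \<phi>(2)] by (simp add: scaleR_conv_of_real)
      also have "\<dots> = integral {0..T} (\<lambda>x. (\<rho> x - \<sigma> x) *\<^sub>R d x)"
        by (intro set_lebesgue_integral_eq_integral(2) absolutely_integrable_continuous_real continuous_intros c d)
      also have "\<dots> = integral {0..T} (\<lambda>x. \<rho> x *\<^sub>R d x) - integral {0..T} (\<lambda>x. \<sigma> x *\<^sub>R d x)"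
        unfolding scaleR_diff_left
        by (intro integral_diff integrable_continuous_real continuous_intros c d)
      also have "integral {0..T} (\<lambda>x. \<rho> x *\<^sub>R d x) = integral {s..s+\<delta>} (\<lambda>x. \<rho> x *\<^sub>R d x)"
        by (rule super) (use \<rho>(3) st \<delta> c in auto)
      also have "integral {0..T} (\<lambda>x. \<sigma> x *\<^sub>R d x) = integral {t..t+\<delta>} (\<lambda>x. \<sigma> x *\<^sub>R d x)"
        by (rule super) (use \<sigma>(3) st \<delta> c in auto)
      finally have eq: "integral {s..s+\<delta>} (\<lambda>x. \<rho> x *\<^sub>R d x) = integral {t..t+\<delta>} (\<lambda>x. \<sigma> x *\<^sub>R d x)"
        using weak[OF \<phi>(1)] by simp
      have "cmod (integral {s..s+\<delta>} (\<lambda>x. \<rho> x *\<^sub>R d x) - d s) \<le> \<epsilon>"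
      proof (rule integral_mollifier_near[OF \<rho>(1,2,4)])
        show "continuous_on {s..s+\<delta>} d" by (rule continuous_on_subset[OF d]) (use st \<delta> in auto)
        fix x assume "x \<in> {s..s+\<delta>}"
        then have "dist (d x) (d s) < \<epsilon>" using st \<delta> by (intro \<delta>1(2)) (auto simp: dist_real_def)
        then show "cmod (d x - d s) \<le> \<epsilon>" by (simp add: dist_norm)
      qed
      moreover have "cmod (integral {t..t+\<delta>} (\<lambda>x. \<sigma> x *\<^sub>R d x) - d t) \<le> \<epsilon>"
      proof (rule integral_mollifier_near[OF \<sigma>(1,2,4)])
        show "continuous_on {t..t+\<delta>} d" by (rule continuous_on_subset[OF d]) (use st \<delta> in auto)
        fix x assume "x \<in> {t..t+\<delta>}"
        then have "dist (d x) (d t) < \<epsilon>" using st \<delta> by (intro \<delta>2(2)) (auto simp: dist_real_def)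
        then show "cmod (d x - d t) \<le> \<epsilon>" by (simp add: dist_norm)
      qed
      moreover have "d s - d t = (integral {t..t+\<delta>} (\<lambda>x. \<sigma> x *\<^sub>R d x) - d t)
          - (integral {s..s+\<delta>} (\<lambda>x. \<rho> x *\<^sub>R d x) - d s)" using eq by simp
      ultimately show ?thesis
        using norm_triangle_ineq4[of "integral {t..t+\<delta>} (\<lambda>x. \<sigma> x *\<^sub>R d x) - d t"
            "integral {s..s+\<delta>} (\<lambda>x. \<rho> x *\<^sub>R d x) - d s"] by simp
    qed
    note le = this
    have "cmod (d s - d t) \<le> 0"
    proof (rule field_le_epsilon)
      fix e :: real assume "0 < e"
      then show "cmod (d s - d t) \<le> 0 + e" using le[of "e / 2"] by simp
    qed
    then show ?thesis by simp
  qed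
  \<comment> \<open>The mollifiers need room inside the open interval, so the endpoints are reached
    by continuity.\<close>
  have "d x = d (T / 2)" if "x \<in> {0..T}" for x
  proof (rule continuous_constant_on_closure[of "{0<..<T}"])
    show "d x = d (T / 2)" if "x \<in> {0<..<T}" for x
    proof (cases x "T / 2" rule: linorder_cases)
      case less then show ?thesis using that T by (intro inner) auto
    next
      case greater then show ?thesis using that T by (intro inner[symmetric]) auto
    next
      case equal then show ?thesis by (rule arg_cong)
    qed
  qed (use T d that in auto)
  then show ?thesis using st by metis
qed

text \<open>Scalar instance of \<open>integration_by_parts_operator\<close>, the operators being
  multiplication by values of the test function; the boundary terms vanish with it.\<close>

lemma weak_derivative_test_identity:
  fixes g w :: "real \<Rightarrow> complex"
  assumes T: "0 \<le> T" and g: "set_integrable lebesgue {0..T} g"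
    and w: "\<And>s. s \<in> {0..T} \<Longrightarrow> w s = w0 + (LINT r:{0..s}|lebesgue. g r)" and \<phi>: "test_function T \<phi>"
  shows "set_integrable lebesgue {0..T} (\<lambda>t. \<phi> t * g t)"
    and "set_integrable lebesgue {0..T} (\<lambda>t. vector_derivative \<phi> (at t) * w t)"
    and "(LINT t:{0..T}|lebesgue. vector_derivative \<phi> (at t) * w t) + (LINT t:{0..T}|lebesgue. \<phi> t * g t) = 0"
proof -
  obtain d where d: "\<And>t. (\<phi> has_vector_derivative d t) (at t)" "continuous_on {0..T} d"
    "\<And>t. t \<notin> {0<..<T} \<Longrightarrow> \<phi> t = 0" "\<And>t. vector_derivative \<phi> (at t) = d t"
    using test_function_C1[OF \<phi>, of "{0..T}"] by metis
  have c\<phi>: "continuous_on A \<phi>" for A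
    using d(1) by (intro continuous_at_imp_continuous_on ballI has_vector_derivative_continuous)
  have cw: "continuous_on {0..T} w"
    using continuous_on_add[OF continuous_on_const continuous_indefinite_integral[OF g], of w0]
      continuous_on_cong[OF refl, of "{0..T}" w "\<lambda>s. w0 + (LINT r:{0..s}|lebesgue. g r)"] w by simp
  have "bounded (d ` {0..T})" by (rule compact_imp_bounded[OF compact_continuous_image[OF d(2)]]) simp
  then obtain L where "\<forall>x\<in>d ` {0..T}. cmod x \<le> L" unfolding bounded_iff by blast
  then have L: "\<And>t. t \<in> {0..T} \<Longrightarrow> cmod (d t) \<le> L" by blast
  show pg: "set_integrable lebesgue {0..T} (\<lambda>t. \<phi> t * g t)"
  proof -
    have "bounded (\<phi> ` {0..T})" by (rule compact_imp_bounded[OF compact_continuous_image[OF c\<phi>]]) simp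
    then obtain K where "\<forall>x\<in>\<phi> ` {0..T}. cmod x \<le> K" unfolding bounded_iff by blast
    then have K: "\<And>t. t \<in> {0..T} \<Longrightarrow> cmod (\<phi> t) \<le> K" by blast
    have m: "\<phi> \<in> borel_measurable lebesgue"
      by (rule measurable_completion) (simp add: borel_measurable_continuous_onI[OF c\<phi>])
    show ?thesis
    proof (rule set_integrable_bound[of _ _ "\<lambda>t. complex_of_real K * g t"])
      show "set_integrable lebesgue {0..T} (\<lambda>t. complex_of_real K * g t)" using g by simp
      have "(\<lambda>x. \<phi> x * (indicator {0..T} x *\<^sub>R g x)) \<in> borel_measurable lebesgue"
        using g m by (intro borel_measurable_times) (auto simp: set_integrable_def)
      then show "set_borel_measurable lebesgue {0..T} (\<lambda>t. \<phi> t * g t)"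
        by (simp add: set_borel_measurable_def)
      show "AE x in lebesgue. x \<in> {0..T} \<longrightarrow> cmod (\<phi> x * g x) \<le> cmod (complex_of_real K * g x)"
        using K by (auto simp: norm_mult intro!: AE_I2 mult_right_mono order_trans[OF K abs_ge_self])
    qed
  qed
  have lip: "cmod (\<phi> s * x - \<phi> r * x) \<le> L * \<bar>s - r\<bar> * norm x" if "s \<in> {0..T}" "r \<in> {0..T}" for s r x
  proof -
    have "cmod (\<phi> s - \<phi> r) \<le> L * \<bar>s - r\<bar>"
      by (rule vector_derivative_lipschitz[where f' = d])
        (use d(1) L that in \<open>auto intro: has_vector_derivative_at_within\<close>)
    from mult_right_mono[OF this, of "norm x"] show ?thesis by (simp add: norm_mult left_diff_distrib[symmetric])
  qed
  have deriv: "((\<lambda>s. \<phi> s * x) has_vector_derivative d s * x) (at s within {0..T})" for s x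
    using has_vector_derivative_mult_left[OF has_vector_derivative_at_within[OF d(1)]] by simp
  have cont: "continuous_on {0..T} (\<lambda>s. d s * w s)" by (intro continuous_intros d cw)
  note parts = integration_by_parts_operator[where B = "\<lambda>s x. \<phi> s * x" and \<beta> = "\<lambda>s x. d s * x",
      OF T g w bounded_linear_mult_right lip deriv cont pg]
  show "set_integrable lebesgue {0..T} (\<lambda>t. vector_derivative \<phi> (at t) * w t)"
    using parts(1) by (simp add: d(4))
  show "(LINT t:{0..T}|lebesgue. vector_derivative \<phi> (at t) * w t) + (LINT t:{0..T}|lebesgue. \<phi> t * g t) = 0"
    using parts(2) d(3)[of 0] d(3)[of T] by (simp add: d(4))
qed

text \<open>Subtracting the indefinite integral of g leaves a continuous function with vanishing
  weak derivative.\<close>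

lemma du_Bois_Reymond:
  fixes u g :: "real \<Rightarrow> complex"
  assumes T: "0 < T" and u: "continuous_on {0..T} u" and g: "set_integrable lebesgue {0..T} g"
    and weak: "\<And>\<phi>. test_function T \<phi> \<Longrightarrow>
      (LINT t:{0..T}|lebesgue. vector_derivative \<phi> (at t) * u t) + (LINT t:{0..T}|lebesgue. \<phi> t * g t) = 0"
    and t: "t \<in> {0..T}"
  shows "u t = u 0 + (LINT r:{0..t}|lebesgue. g r)"
proof -
  define w where "w s = 0 + (LINT r:{0..s}|lebesgue. g r)" for s
  have cw: "continuous_on {0..T} w" unfolding w_def by (intro continuous_intros continuous_indefinite_integral g)
  have "u t - w t = u 0 - w 0"
  proof (rule constant_if_weak_derivative_0[OF T])
    show "continuous_on {0..T} (\<lambda>t. u t - w t)" by (intro continuous_intros u cw)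
    fix \<phi> assume \<phi>: "test_function T \<phi>"
    note id = weak_derivative_test_identity[OF less_imp_le[OF T] g w_def \<phi>]
    obtain d where d: "continuous_on {0..T} d" "\<And>t. vector_derivative \<phi> (at t) = d t"
      using test_function_C1[OF \<phi>, of "{0..T}"] by metis
    have i: "set_integrable lebesgue {0..T} (\<lambda>t. vector_derivative \<phi> (at t) * u t)"
      unfolding d(2) by (intro absolutely_integrable_continuous_real continuous_intros d u)
    have "(LINT t:{0..T}|lebesgue. vector_derivative \<phi> (at t) * u t)
        = (LINT t:{0..T}|lebesgue. vector_derivative \<phi> (at t) * w t)"
      using id(3) weak[OF \<phi>] by (metis add_right_cancel)
    then show "(LINT t:{0..T}|lebesgue. vector_derivative \<phi> (at t) * (u t - w t)) = 0"
      unfolding right_diff_distrib set_integral_diff(2)[OF i id(2)] by simp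
  qed (use t T in auto)
  moreover have "w 0 = 0"
  proof -
    have "(LINT r:{0..0}|lebesgue. g r) = integral {0..0} g"
      by (rule set_lebesgue_integral_eq_integral(2)) (rule set_integrable_subset[OF g], use T in auto)
    then show ?thesis by (simp add: w_def)
  qed
  ultimately show ?thesis by (simp add: w_def algebra_simps)
qed

section \<open>Square integrable functions and regular distributions\<close>

text \<open>Completeness of Lebesgue measure: a preimage changes only inside a null set, all of
  whose subsets are measurable.\<close>

lemma lebesgue_measurable_cong_AE:
  fixes f g :: "real \<Rightarrow> 'b::topological_space"
  assumes f: "f \<in> borel_measurable lebesgue" and eq: "AE x in lebesgue. f x = g x"
  shows "g \<in> borel_measurable lebesgue"
proof (rule measurableI)
  obtain N where N: "{x \<in> space lebesgue. f x \<noteq> g x} \<subseteq> N" "N \<in> null_sets lebesgue"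
    using eq by (auto elim: AE_E simp: null_sets_def)
  fix A :: "'b set" assume A: "A \<in> sets borel"
  have fA: "f -` A \<inter> space lebesgue \<in> sets lebesgue" using f A by (rule measurable_sets)
  have "g -` A \<inter> N \<in> null_sets lebesgue" by (rule null_sets_completion_subset[OF Int_lower2 N(2)])
  then have "((f -` A \<inter> space lebesgue) - N) \<union> (g -` A \<inter> N) \<in> sets lebesgue"
    using fA N(2) by auto
  moreover have "((f -` A \<inter> space lebesgue) - N) \<union> (g -` A \<inter> N) = g -` A \<inter> space lebesgue"
  proof -
    have "f x = g x" if "x \<notin> N" for x using N(1) that by auto
    then show ?thesis by auto
  qed
  ultimately show "g -` A \<inter> space lebesgue \<in> sets lebesgue" by simp
qed simp

lemma set_integral_cong_AE_lebesgue:
  fixes f g :: "real \<Rightarrow> 'b::{banach,second_countable_topology}"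
  assumes f: "set_integrable lebesgue A f" and eq: "AE x in lebesgue. x \<in> A \<longrightarrow> f x = g x"
  shows "set_integrable lebesgue A g" "(LINT x:A|lebesgue. g x) = (LINT x:A|lebesgue. f x)"
proof -
  have ae: "AE x in lebesgue. indicator A x *\<^sub>R f x = indicator A x *\<^sub>R g x"
    using eq by eventually_elim (auto simp: indicator_def)
  have fm: "(\<lambda>x. indicator A x *\<^sub>R f x) \<in> borel_measurable lebesgue"
    using f by (auto simp: set_integrable_def)
  note gm = lebesgue_measurable_cong_AE[OF fm ae]
  show "set_integrable lebesgue A g"
    using f integrable_cong_AE[OF fm gm ae] by (simp add: set_integrable_def)
  show "(LINT x:A|lebesgue. g x) = (LINT x:A|lebesgue. f x)"
    using integral_cong_AE[OF fm gm ae] by (simp add: set_lebesgue_integral_def)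
qed

text \<open>The spaces are defined on the open interval, while continuity and integration by parts
  use the closed one; the two endpoints form a null set.\<close>

lemma AE_lebesgue_on_interval:
  "(AE t in lebesgue_on {0<..<T::real}. P t) \<longleftrightarrow> (AE t in lebesgue. t \<in> {0..T} \<longrightarrow> P t)"
proof -
  have "(AE t in lebesgue_on {0<..<T}. P t) \<longleftrightarrow> (AE t in lebesgue. t \<in> {0<..<T} \<longrightarrow> P t)"
    by (rule AE_restrict_space_iff) simp
  also have "\<dots> \<longleftrightarrow> (AE t in lebesgue. t \<in> {0..T} \<longrightarrow> P t)"
  proof -
    have ne: "AE t in lebesgue. t \<noteq> c" for c :: real
      using AE_not_in[of "{c}" lebesgue] by (simp add: null_sets_def)
    from ne[of 0] ne[of T] have "AE t in lebesgue. (t \<in> {0<..<T} \<longrightarrow> P t) \<longleftrightarrow> (t \<in> {0..T} \<longrightarrow> P t)"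
      by eventually_elim auto
    note ae = this
    show ?thesis
    proof
      assume "AE t in lebesgue. t \<in> {0<..<T} \<longrightarrow> P t"
      with ae show "AE t in lebesgue. t \<in> {0..T} \<longrightarrow> P t" by eventually_elim auto
    next
      assume "AE t in lebesgue. t \<in> {0..T} \<longrightarrow> P t"
      with ae show "AE t in lebesgue. t \<in> {0<..<T} \<longrightarrow> P t" by eventually_elim auto
    qed
  qed
  finally show ?thesis .
qed

lemma set_integrable_open_interval:
  fixes f :: "real \<Rightarrow> 'b::{banach,second_countable_topology}"
  shows "set_integrable lebesgue {0<..<T} f \<longleftrightarrow> set_integrable lebesgue {0..T} f"
    and "(LINT t:{0<..<T}|lebesgue. f t) = (LINT t:{0..T}|lebesgue. f t)"
  by (intro set_integrable_discrete_difference[of "{0, T}"] set_integral_discrete_difference[of "{0, T}"]; auto)+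

lemma L2_iff:
  "g \<in> L2 T \<longleftrightarrow> set_borel_measurable lebesgue {0<..<T} g \<and> set_integrable lebesgue {0..T} (\<lambda>t. (norm (g t))\<^sup>2)"
  unfolding L2_def set_integrable_open_interval(1)[symmetric] set_borel_measurable_def
  by (simp add: borel_measurable_restrict_space_iff integrable_restrict_space set_integrable_def)

lemma regular_distr_eq: "regular_distr T g \<phi> = (LINT t:{0..T}|lebesgue. \<phi> t *\<^sub>C g t)"
  unfolding regular_distr_def set_integrable_open_interval(2)[symmetric]
  unfolding set_lebesgue_integral_def by (rule integral_restrict_space) simp

lemma set_integrable_const: "set_integrable lebesgue {0..T::real} (\<lambda>_. c :: real)"
  by (rule absolutely_integrable_continuous_real) simp

lemma set_borel_measurable_open_interval:
  fixes g :: "real \<Rightarrow> 'b::{banach,second_countable_topology}"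
  shows "set_integrable lebesgue {0..T} g \<Longrightarrow> set_borel_measurable lebesgue {0<..<T} g"
  using set_integrable_open_interval(1)[of T g] by (auto simp: set_integrable_def set_borel_measurable_def)

lemma L2_set_integrable: "g \<in> L2 T \<Longrightarrow> set_integrable lebesgue {0..T} g"
proof -
  assume g: "g \<in> L2 T"
  have "set_integrable lebesgue {0..T} (\<lambda>t. 1 + (norm (g t))\<^sup>2)"
    using g set_integrable_const[of T 1] by (intro set_integral_add(1)) (auto simp: L2_iff)
  then have "set_integrable lebesgue {0<..<T} (\<lambda>t. 1 + (norm (g t))\<^sup>2)"
    by (simp add: set_integrable_open_interval)
  then have "set_integrable lebesgue {0<..<T} g"
  proof (rule set_integrable_bound)
    show "set_borel_measurable lebesgue {0<..<T} g" using g by (simp add: L2_iff)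
    have "norm (g t) \<le> norm (1 + (norm (g t))\<^sup>2)" for t
    proof -
      have "0 \<le> (norm (g t) - 1)\<^sup>2" by simp
      then have "2 * norm (g t) \<le> 1 + (norm (g t))\<^sup>2" by (simp add: power2_eq_square algebra_simps)
      then have "norm (g t) \<le> 1 + (norm (g t))\<^sup>2" using norm_ge_zero[of "g t"] by linarith
      then show ?thesis by (rule order_trans) (simp only: real_norm_def abs_ge_self)
    qed
    then show "AE t in lebesgue. t \<in> {0<..<T} \<longrightarrow> norm (g t) \<le> norm (1 + (norm (g t))\<^sup>2)" by simp
  qed
  then show ?thesis by (simp add: set_integrable_open_interval)
qed

lemma L2I:
  assumes g: "set_integrable lebesgue {0..T} g" and G: "set_integrable lebesgue {0..T} G"
    and le: "\<And>t. t \<in> {0..T} \<Longrightarrow> (norm (g t))\<^sup>2 \<le> (G t :: real)"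
  shows "g \<in> L2 T"
  unfolding L2_iff
proof
  show "set_borel_measurable lebesgue {0<..<T} g" by (rule set_borel_measurable_open_interval[OF g])
  show "set_integrable lebesgue {0..T} (\<lambda>t. (norm (g t))\<^sup>2)"
  proof (rule set_integrable_bound[OF G])
    have "(\<lambda>x. indicator {0..T} x *\<^sub>R g x) \<in> borel_measurable lebesgue"
      using g unfolding set_integrable_def by (rule borel_measurable_integrable)
    then have "(\<lambda>x. (norm (indicator {0..T} x *\<^sub>R g x))\<^sup>2) \<in> borel_measurable lebesgue"
      by (rule measurable_compose) (intro borel_measurable_continuous_onI continuous_intros)
    also have "(\<lambda>x. (norm (indicator {0..T} x *\<^sub>R g x))\<^sup>2) = (\<lambda>x. indicator {0..T} x *\<^sub>R (norm (g x))\<^sup>2)"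
      by (auto simp: indicator_def)
    finally show "set_borel_measurable lebesgue {0..T} (\<lambda>t. (norm (g t))\<^sup>2)"
      by (simp add: set_borel_measurable_def)
    show "AE t in lebesgue. t \<in> {0..T} \<longrightarrow> norm ((norm (g t))\<^sup>2) \<le> norm (G t)"
      using le order_trans[OF _ abs_ge_self] by (intro AE_I2) auto
  qed
qed

lemma set_integrable_continuous:
  fixes g :: "real \<Rightarrow> 'b::{banach,second_countable_topology}"
  assumes "continuous_on {0..T} g" shows "set_integrable lebesgue {0..T} g"
proof (rule set_integrable_bound)
  show "set_integrable lebesgue {0..T} (\<lambda>t. norm (g t))"
    by (rule absolutely_integrable_continuous_real) (intro continuous_intros assms)
  have "(\<lambda>x. indicator {0..T} x *\<^sub>R g x) \<in> borel_measurable borel"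
    by (rule borel_measurable_continuous_on_indicator) (use assms in auto)
  then show "set_borel_measurable lebesgue {0..T} g"
    unfolding set_borel_measurable_def by (intro measurable_completion) simp
qed simp

lemma L2_continuous: "continuous_on {0..T} g \<Longrightarrow> g \<in> L2 T"
  by (rule L2I[OF set_integrable_continuous absolutely_integrable_continuous_real[of 0 T "\<lambda>t. (norm (g t))\<^sup>2"]])
    (auto intro!: continuous_intros)

lemma L2_bounded_linear:
  fixes F :: "'a::{banach,second_countable_topology} \<Rightarrow> 'b::{banach,second_countable_topology}"
  assumes F: "bounded_linear F" and g: "g \<in> L2 T" shows "(\<lambda>t. F (g t)) \<in> L2 T"
proof -
  obtain K where K: "\<And>x. norm (F x) \<le> norm x * K" using bounded_linear.bounded[OF F] by blast
  show ?thesis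
  proof (rule L2I)
    show "set_integrable lebesgue {0..T} (\<lambda>t. F (g t))"
      by (rule bounded_linear_set_integral(1)[OF F L2_set_integrable[OF g]])
    show "set_integrable lebesgue {0..T} (\<lambda>t. K\<^sup>2 * (norm (g t))\<^sup>2)" using g by (simp add: L2_iff)
    show "(norm (F (g t)))\<^sup>2 \<le> K\<^sup>2 * (norm (g t))\<^sup>2" for t
      using power_mono[OF K[of "g t"], of 2] by (simp add: power_mult_distrib mult.commute)
  qed
qed

lemma L2_diff:
  assumes f: "f \<in> L2 T" and g: "g \<in> L2 T" shows "(\<lambda>t. f t - g t) \<in> L2 T"
proof (rule L2I)
  show "set_integrable lebesgue {0..T} (\<lambda>t. f t - g t)"
    by (intro set_integral_diff(1) L2_set_integrable f g)
  show "set_integrable lebesgue {0..T} (\<lambda>t. 2 * (norm (f t))\<^sup>2 + 2 * (norm (g t))\<^sup>2)"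
    using f g by (intro set_integral_add(1)) (auto simp: L2_iff)
  show "(norm (f t - g t))\<^sup>2 \<le> 2 * (norm (f t))\<^sup>2 + 2 * (norm (g t))\<^sup>2" for t
  proof -
    have "(norm (f t - g t))\<^sup>2 \<le> (norm (f t) + norm (g t))\<^sup>2" by (intro power_mono norm_triangle_ineq4) simp
    moreover have "0 \<le> (norm (f t) - norm (g t))\<^sup>2" by simp
    ultimately show ?thesis by (simp add: power2_eq_square algebra_simps)
  qed
qed

text \<open>Reduces measurability of a complex multiple to real multiples and to the fixed
  continuous map of multiplication by the imaginary unit.\<close>

lemma scaleC_decompose: "c *\<^sub>C x = Re c *\<^sub>R x + Im c *\<^sub>R (\<i> *\<^sub>C (x::'b::complex_normed_vector))"
proof -
  have "c = complex_of_real (Re c) + complex_of_real (Im c) * \<i>" by (simp add: complex_eq_iff)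
  then show ?thesis by (metis scaleC_add_left scaleC_of_real scaleC_scaleC)
qed

lemma set_integrable_scaleC:
  fixes g :: "real \<Rightarrow> 'b::{complex_normed_vector,banach,second_countable_topology}"
  assumes g: "set_integrable lebesgue {0..T} g" and \<phi>: "continuous_on UNIV \<phi>"
  shows "set_integrable lebesgue {0..T} (\<lambda>t. \<phi> t *\<^sub>C g t)"
proof -
  have "bounded (\<phi> ` {0..T})"
    by (intro compact_imp_bounded compact_continuous_image continuous_on_subset[OF \<phi>]) auto
  then obtain K where K: "\<And>t. t \<in> {0..T} \<Longrightarrow> cmod (\<phi> t) \<le> K" unfolding bounded_iff by blast
  have m: "(\<lambda>t. Re (\<phi> t)) \<in> borel_measurable lebesgue" "(\<lambda>t. Im (\<phi> t)) \<in> borel_measurable lebesgue"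
    by (intro measurable_completion; simp; intro borel_measurable_continuous_onI continuous_intros \<phi>)+
  have gm: "(\<lambda>t. indicator {0..T} t *\<^sub>R g t) \<in> borel_measurable lebesgue"
    using g by (auto simp: set_integrable_def)
  have "continuous_on UNIV (\<lambda>x::'b. \<i> *\<^sub>C x)" by (rule linear_continuous_on[OF bounded_linear_scaleC])
  from measurable_compose[OF gm borel_measurable_continuous_onI[OF this]]
  have igm: "(\<lambda>t. \<i> *\<^sub>C (indicator {0..T} t *\<^sub>R g t)) \<in> borel_measurable lebesgue" .
  show ?thesis
  proof (rule set_integrable_bound)
    show "set_integrable lebesgue {0..T} (\<lambda>t. K *\<^sub>R g t)" using g by simp
    have "(\<lambda>t. Re (\<phi> t) *\<^sub>R (indicator {0..T} t *\<^sub>R g t) + Im (\<phi> t) *\<^sub>R (\<i> *\<^sub>C (indicator {0..T} t *\<^sub>R g t))) \<in> borel_measurable lebesgue"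
      using m gm igm by measurable
    also have "(\<lambda>t. Re (\<phi> t) *\<^sub>R (indicator {0..T} t *\<^sub>R g t) + Im (\<phi> t) *\<^sub>R (\<i> *\<^sub>C (indicator {0..T} t *\<^sub>R g t)))
        = (\<lambda>t. indicator {0..T} t *\<^sub>R (\<phi> t *\<^sub>C g t))"
      by (auto simp: scaleC_decompose[of "\<phi> _"] indicator_def linear_simps[OF bounded_linear_scaleC])
    finally show "set_borel_measurable lebesgue {0..T} (\<lambda>t. \<phi> t *\<^sub>C g t)"
      by (simp add: set_borel_measurable_def)
    show "AE t in lebesgue. t \<in> {0..T} \<longrightarrow> norm (\<phi> t *\<^sub>C g t) \<le> norm (K *\<^sub>R g t)"
    proof (intro AE_I2 impI)
      fix t assume "t \<in> {0..T}"
      then have "cmod (\<phi> t) * norm (g t) \<le> \<bar>K\<bar> * norm (g t)"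
        using K by (intro mult_right_mono order_trans[OF K abs_ge_self]) auto
      then show "norm (\<phi> t *\<^sub>C g t) \<le> norm (K *\<^sub>R g t)" by (simp add: norm_scaleC)
    qed
  qed
qed

lemma bounded_linear_pairing: "bounded_linear (\<lambda>\<phi>. pairing \<phi> v)"
  by (rule bounded_linear_intro[of _ "norm v"]) (auto simp: pairing_add pairing_scaleR norm_pairing)

lemma pairing_set_integral:
  fixes g :: "real \<Rightarrow> 'v::{complex_inner,second_countable_topology} antidual"
  assumes "set_integrable M A g"
  shows "set_integrable M A (\<lambda>t. pairing (g t) v)" "pairing (LINT t:A|M. g t) v = (LINT t:A|M. pairing (g t) v)"
  using bounded_linear_set_integral[OF bounded_linear_pairing assms] by simp_all

lemma pairing_regular_distr:
  fixes g :: "real \<Rightarrow> 'v::{complex_inner,second_countable_topology} antidual"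
  assumes "set_integrable lebesgue {0..T} g" and "continuous_on UNIV \<phi>"
  shows "pairing (regular_distr T g \<phi>) v = (LINT t:{0..T}|lebesgue. \<phi> t * pairing (g t) v)"
  unfolding regular_distr_eq pairing_set_integral(2)[OF set_integrable_scaleC[OF assms]] by (simp add: pairing_scaleC)

lemma pairing_uminus: "pairing (- \<phi>) v = - pairing \<phi> v"
  by (rule linear_neg[OF bounded_linear.linear[OF bounded_linear_pairing]])

lemma test_function_continuous:
  assumes "test_function T \<phi>"
  shows "continuous_on A \<phi>" "continuous_on A (\<lambda>t. vector_derivative \<phi> (at t))"
proof -
  obtain d where d: "\<And>t. (\<phi> has_vector_derivative d t) (at t)" "continuous_on A d"
    "\<And>t. vector_derivative \<phi> (at t) = d t"
    using test_function_C1[OF assms, of A] by metis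
  show "continuous_on A \<phi>"
    using d(1) by (intro continuous_at_imp_continuous_on ballI has_vector_derivative_continuous)
  show "continuous_on A (\<lambda>t. vector_derivative \<phi> (at t))" using d(2,3) by simp
qed

text \<open>Pairing with each v of V commutes with the integral and reduces the claim to
  \<open>du_Bois_Reymond\<close>.\<close>

lemma indefinite_integral_of_weak_derivative:
  fixes u g :: "real \<Rightarrow> 'v::{complex_inner,second_countable_topology} antidual"
  assumes T: "0 < T" and u: "continuous_on {0..T} u" and g: "set_integrable lebesgue {0..T} g"
    and weak: "\<And>\<phi>. test_function T \<phi> \<Longrightarrow> distr_deriv (regular_distr T u) \<phi> = regular_distr T g \<phi>"
    and t: "t \<in> {0..T}"
  shows "u t = u 0 + (LINT r:{0..t}|lebesgue. g r)"
proof (rule antidual_eqI)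
  fix v
  have ui: "set_integrable lebesgue {0..T} u" by (rule set_integrable_continuous[OF u])
  have gt: "set_integrable lebesgue {0..t} g" by (rule set_integrable_subset[OF g]) (use t in auto)
  have "pairing (u t) v = pairing (u 0) v + (LINT r:{0..t}|lebesgue. pairing (g r) v)"
  proof (rule du_Bois_Reymond[OF T _ pairing_set_integral(1)[OF g] _ t])
    show "continuous_on {0..T} (\<lambda>t. pairing (u t) v)"
      by (rule bounded_linear.continuous_on[OF bounded_linear_pairing u])
    fix \<phi> assume \<phi>: "test_function T \<phi>"
    note c = test_function_continuous[OF \<phi>, of UNIV]
    show "(LINT t:{0..T}|lebesgue. vector_derivative \<phi> (at t) * pairing (u t) v)
        + (LINT t:{0..T}|lebesgue. \<phi> t * pairing (g t) v) = 0"
      unfolding pairing_regular_distr[OF ui c(2), symmetric] pairing_regular_distr[OF g c(1), symmetric]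
        weak[OF \<phi>, symmetric] distr_deriv_def pairing_uminus by simp
  qed
  then show "pairing (u t) v = pairing (u 0 + (LINT r:{0..t}|lebesgue. g r)) v"
    by (simp add: pairing_add pairing_set_integral[OF gt])
qed

text \<open>Measurability comes from joint continuity of the semigroup: the integrand is a
  continuous function of the measurable pair of s and f s.\<close>

lemma C0_semigroup_set_integrable:
  fixes S :: "real \<Rightarrow> 'b::{complex_normed_vector,banach,second_countable_topology} \<Rightarrow> 'b"
  assumes S: "C0_semigroup S" and t: "0 \<le> t" and f: "set_integrable lebesgue {0..t} f"
  shows "set_integrable lebesgue {0..t} (\<lambda>s. S (t - s) (f s))"
proof -
  interpret c0 S by unfold_locales fact
  obtain K where K: "K \<ge> 1" "\<And>s x. s \<in> {0..t} \<Longrightarrow> norm (S s x) \<le> K * norm x" using bound[of t] by blast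
  \<comment> \<open>The maximum with 0 extends the map continuously to all times, where the
    semigroup itself is not controlled.\<close>
  define H where "H z = S (max 0 (t - fst z)) (snd z)" for z
  have "continuous_on UNIV H" unfolding continuous_on_def H_def
    by (intro ballI tendsto_S tendsto_max tendsto_const tendsto_diff tendsto_fst tendsto_snd tendsto_ident_at) auto
  then have H: "H \<in> borel_measurable borel" by (rule borel_measurable_continuous_onI)
  define F where "F s = indicator {0..t} s *\<^sub>R f s" for s
  have "F \<in> borel_measurable lebesgue" using f by (auto simp: F_def[abs_def] set_integrable_def)
  moreover have "(\<lambda>s. s) \<in> borel_measurable lebesgue" by (rule measurable_completion) simp
  ultimately have "(\<lambda>s. (s, F s)) \<in> borel_measurable lebesgue" by (intro borel_measurable_Pair)
  from measurable_compose[OF this H] have HF: "(\<lambda>s. H (s, F s)) \<in> borel_measurable lebesgue" .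
  show ?thesis
  proof (rule set_integrable_bound)
    show "set_integrable lebesgue {0..t} (\<lambda>s. K *\<^sub>R f s)" using f by simp
    have "(\<lambda>s. indicator {0..t} s *\<^sub>R H (s, F s)) \<in> borel_measurable lebesgue"
      using HF by (intro borel_measurable_scaleR borel_measurable_indicator) auto
    also have "(\<lambda>s. indicator {0..t} s *\<^sub>R H (s, F s)) = (\<lambda>s. indicator {0..t} s *\<^sub>R S (t - s) (f s))"
      by (auto simp: H_def F_def indicator_def max_def)
    finally show "set_borel_measurable lebesgue {0..t} (\<lambda>s. S (t - s) (f s))"
      by (simp add: set_borel_measurable_def)
    show "AE s in lebesgue. s \<in> {0..t} \<longrightarrow> norm (S (t - s) (f s)) \<le> norm (K *\<^sub>R f s)"
      using K by (intro AE_I2) auto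
  qed
qed

section \<open>Duhamel's formula\<close>

context gelfand_form
begin

definition "R \<phi> = emb_V j (sol k 1 \<phi>)"

lemma form_sol_k: "form k 1 (sol k 1 \<phi>) v = pairing \<phi> v"
  by (rule form_sol) auto

lemma lin_sol_k: "bounded_linear (sol k 1)"
  using clin_sol[of 1 k] by (simp add: bounded_clinear_def)

lemma lin_R: "bounded_linear R"
  unfolding R_def[abs_def] by (rule bounded_linear_compose[OF lin_emb_V lin_sol_k])

sublocale R: bounded_linear R by (rule lin_R)

lemma inj_R: "inj R"
proof (rule injI)
  fix \<phi> \<psi> assume "R \<phi> = R \<psi>"
  then have "sol k 1 \<phi> = sol k 1 \<psi>" using inj_emb_V by (auto simp: R_def dest: injD)
  then show "\<phi> = \<psi>" using form_sol_k by (intro antidual_eqI) metis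
qed

lemma A_sol: "lax_milgram_ext a (sol k 1 \<phi>) = \<phi> - k *\<^sub>R R \<phi>"
proof (rule antidual_eqI)
  fix v show "pairing (lax_milgram_ext a (sol k 1 \<phi>)) v = pairing (\<phi> - k *\<^sub>R R \<phi>) v"
    using form_sol_k[of \<phi> v, symmetric]
    by (simp add: R_def pairing_diff pairing_scaleR form_def scaleR_conv_of_real)
qed

text \<open>It trades A v(s), known for almost every s, for an expression in w(s) =
  \<open>emb_V j (v s)\<close>, which is continuous in s. This is what makes the integrand in
  \<open>duhamel\<close> collapse to its f-part.\<close>

lemma R_A: "R (lax_milgram_ext a u) = emb_V j u - k *\<^sub>R R (emb_V j u)"
proof -
  have "sol k 1 (lax_milgram_ext a u + k *\<^sub>R emb_V j u) = u"
    by (rule sol_eqI) (auto simp: form_def pairing_add pairing_scaleR scaleR_conv_of_real)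
  then have "R (lax_milgram_ext a u + k *\<^sub>R emb_V j u) = emb_V j u" by (simp add: R_def)
  then show ?thesis by (simp add: R.add R.scaleR algebra_simps)
qed

lemma generator_S_D_eq: "generator S_D = {(emb_V j u, - lax_milgram_ext a u) | u. True}"
  by (subst generator_S_D) (auto simp: lax_milgram_ext_graph_def)

lemma generator_R: "(R x, k *\<^sub>R R x - x) \<in> generator S_D"
  unfolding generator_S_D_eq using A_sol[of x] by (force simp: R_def)

lemma R_S_D: "0 \<le> t \<Longrightarrow> S_D t (R x) = R (S_D t x)"
proof (rule S_D.resolvent_commute[where l = k])
  fix x y assume "(x, y) \<in> generator S_D"
  then obtain u where u: "x = emb_V j u" "y = - lax_milgram_ext a u"
    unfolding generator_S_D_eq by auto
  have "R (k *\<^sub>R x - y) = k *\<^sub>R R (emb_V j u) + R (lax_milgram_ext a u)"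
    by (simp add: u R.add R.scaleR)
  then show "R (k *\<^sub>R x - y) = x" by (simp add: R_A u)
qed (rule generator_R)

lemma duhamel:
  assumes t: "0 \<le> t" and f: "set_integrable lebesgue {0..t} f" and g: "set_integrable lebesgue {0..t} g"
    and w: "\<And>s. s \<in> {0..t} \<Longrightarrow> w s = w0 + (LINT r:{0..s}|lebesgue. g r)"
    and eq: "AE s in lebesgue. s \<in> {0..t} \<longrightarrow> w s = emb_V j (v s) \<and> g s = f s - lax_milgram_ext a (v s)"
  shows "w t = S_D t (w 0) + (LINT s:{0..t}|lebesgue. S_D (t - s) (f s))"
proof -
  \<comment> \<open>The derivative in s of \<open>S_D (t - s) (R x)\<close>; it is defined for every
    x, since R maps into the domain.\<close>
  define \<beta> where "\<beta> s x = S_D (t - s) (x - k *\<^sub>R R x)" for s x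
  obtain K where K: "K \<ge> 1" "\<And>s x. s \<in> {0..t} \<Longrightarrow> norm (S_D s x) \<le> K * norm x"
    using S_D.bound[of t] by blast
  obtain KR where KR: "\<And>x. norm (R x) \<le> norm x * KR" using R.bounded by blast
  have lin: "bounded_linear (\<lambda>x. S_D (t - s) (R x))" "bounded_linear (\<beta> s)" if "s \<in> {0..t}" for s
    unfolding \<beta>_def[abs_def] using that
    by (auto intro!: bounded_linear_compose[OF S_D.lin] lin_R bounded_linear_sub bounded_linear_ident
        bounded_linear_compose[OF bounded_linear_scaleR_right lin_R])
  have deriv: "((\<lambda>s. S_D (t - s) (R x)) has_vector_derivative \<beta> s x) (at s within {0..t})" if s: "s \<in> {0..t}" for s x
  proof -
    have "((\<lambda>\<sigma>. S_D \<sigma> (R x)) has_vector_derivative S_D (t - s) (k *\<^sub>R R x - x)) (at (t - s) within (\<lambda>r. t - r) ` {0..t})"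
      by (rule has_vector_derivative_within_subset[OF S_D.deriv_S[OF generator_R]]) (use s in auto)
    moreover have "((\<lambda>r. t - r) has_vector_derivative -1) (at s within {0..t})"
      by (auto intro!: derivative_eq_intros)
    ultimately have "((\<lambda>s. S_D (t - s) (R x)) has_vector_derivative - S_D (t - s) (k *\<^sub>R R x - x)) (at s within {0..t})"
      using vector_diff_chain_within[of "\<lambda>r. t - r" "-1" s "{0..t}"] by (auto simp: o_def)
    moreover have "- S_D (t - s) (k *\<^sub>R R x - x) = \<beta> s x"
      using linear_simps[OF S_D.lin[of "t - s"]] s by (simp add: \<beta>_def)
    ultimately show ?thesis by simp
  qed
  have w_cont: "continuous_on {0..t} w"
    using continuous_on_add[OF continuous_on_const continuous_indefinite_integral[OF g], of w0]
      continuous_on_cong[OF refl, of "{0..t}" w "\<lambda>s. w0 + (LINT r:{0..s}|lebesgue. g r)"] w by simp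
  note orbit = C0_semigroup_set_integrable[OF C0_S_D t]
  note fR = bounded_linear_set_integral[OF lin_R orbit[OF f]]
  note gR = bounded_linear_set_integral[OF lin_R orbit[OF g]]
  have "R (w t) = R (S_D t (w 0) + (LINT s:{0..t}|lebesgue. S_D (t - s) (f s)))"
  proof (rule antidual_eqI)
    fix y :: 'v
    let ?P = "\<lambda>\<phi>. pairing \<phi> y"
    note P = bounded_linear_pairing[of y]
    \<comment> \<open>Pairing with y makes the integration by parts scalar; letting y range over V
      recovers the identity in the antidual.\<close>
    define B where "B s x = ?P (S_D (t - s) (R x))" for s x
    have cg: "set_integrable lebesgue {0..t} (\<lambda>s. B s (g s))"
      by (rule set_integral_cong_AE_lebesgue(1)[OF bounded_linear_set_integral(1)[OF P gR(1)]])
        (auto simp: B_def R_S_D)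
    have linB: "bounded_linear (B s)" if "s \<in> {0..t}" for s
      unfolding B_def by (rule bounded_linear_compose[OF P lin(1)[OF that]])
    have derivB: "((\<lambda>s. B s x) has_vector_derivative ?P (\<beta> s x)) (at s within {0..t})" if "s \<in> {0..t}" for s x
      unfolding B_def by (rule bounded_linear.has_vector_derivative[OF P deriv[OF that]])
    have lip: "cmod (B s x - B r x) \<le> (K * (1 + k * KR) * norm y) * \<bar>s - r\<bar> * norm x" if "s \<in> {0..t}" "r \<in> {0..t}" for s r x
    proof -
      have "cmod (B s x - B r x) \<le> (K * ((1 + k * KR) * norm x) * norm y) * \<bar>s - r\<bar>"
      proof (rule vector_derivative_lipschitz[OF derivB])
        fix s assume s: "s \<in> {0..t}"
        have "norm (x - k *\<^sub>R R x) \<le> norm x + k * norm (R x)"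
          using norm_triangle_ineq4[of x "k *\<^sub>R R x"] k by simp
        also have "\<dots> \<le> norm x + k * (norm x * KR)" by (intro add_left_mono mult_left_mono KR k)
        also have "\<dots> = (1 + k * KR) * norm x" by (simp add: algebra_simps)
        finally have 1: "norm (x - k *\<^sub>R R x) \<le> (1 + k * KR) * norm x" .
        have "norm (\<beta> s x) \<le> K * norm (x - k *\<^sub>R R x)" unfolding \<beta>_def by (rule K(2)) (use s in auto)
        also have "\<dots> \<le> K * ((1 + k * KR) * norm x)" using 1 K(1) by (intro mult_left_mono) auto
        finally have "norm (\<beta> s x) * norm y \<le> K * ((1 + k * KR) * norm x) * norm y"
          by (rule mult_right_mono) simp
        then show "cmod (?P (\<beta> s x)) \<le> K * ((1 + k * KR) * norm x) * norm y"
          using norm_pairing order_trans by blast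
      qed (use that in auto)
      then show ?thesis by (simp only: mult_ac)
    qed
    have cont: "continuous_on {0..t} (\<lambda>s. ?P (\<beta> s (w s)))"
    proof (rule bounded_linear.continuous_on[OF P], unfold continuous_on_def, intro ballI)
      fix s assume s: "s \<in> {0..t}"
      have "(w \<longlongrightarrow> w s) (at s within {0..t})" using w_cont s by (simp add: continuous_on_def)
      then show "((\<lambda>s. \<beta> s (w s)) \<longlongrightarrow> \<beta> s (w s)) (at s within {0..t})"
        unfolding \<beta>_def using s
        by (intro S_D.tendsto_S tendsto_intros R.tendsto) (auto simp: eventually_at_filter)
    qed
    have parts: "set_integrable lebesgue {0..t} (\<lambda>s. ?P (\<beta> s (w s)))"
      "(LINT s:{0..t}|lebesgue. ?P (\<beta> s (w s))) + (LINT s:{0..t}|lebesgue. B s (g s)) = B t (w t) - B 0 (w 0)"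
      by (rule integration_by_parts_operator[where B = B and \<beta> = "\<lambda>s x. ?P (\<beta> s x)",
            OF t g w linB lip derivB cont cg]; assumption)+
    \<comment> \<open>By \<open>R_A\<close>, R (f - A v) = R f - w + k R w, and the terms in w
      cancel against those of \<open>\<beta>\<close>.\<close>
    have "AE s in lebesgue. s \<in> {0..t} \<longrightarrow> ?P (\<beta> s (w s)) + B s (g s) = ?P (R (S_D (t - s) (f s)))"
      using eq
    proof eventually_elim
      case (elim s)
      show ?case
      proof
        assume s: "s \<in> {0..t}"
        with elim have ws: "w s = emb_V j (v s)" and gs: "g s = f s - lax_milgram_ext a (v s)" by auto
        interpret St: bounded_linear "S_D (t - s)" using s by (intro S_D.lin) auto
        have "\<beta> s (w s) + S_D (t - s) (R (g s)) = S_D (t - s) (R (f s))"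
          unfolding \<beta>_def St.add[symmetric] gs R.diff R_A ws by simp
        then show "?P (\<beta> s (w s)) + B s (g s) = ?P (R (S_D (t - s) (f s)))"
          unfolding B_def pairing_add[symmetric] using s by (simp add: R_S_D)
      qed
    qed
    from set_integral_cong_AE_lebesgue(2)[OF set_integral_add(1)[OF parts(1) cg] this]
    have "(LINT s:{0..t}|lebesgue. ?P (R (S_D (t - s) (f s)))) = B t (w t) - B 0 (w 0)"
      unfolding set_integral_add(2)[OF parts(1) cg] parts(2) .
    then have "?P (R (w t)) = ?P (S_D t (R (w 0))) + ?P (R (LINT s:{0..t}|lebesgue. S_D (t - s) (f s)))"
      using bounded_linear_set_integral(2)[OF P fR(1)] fR(2) by (simp add: B_def)
    then show "?P (R (w t)) = ?P (R (S_D t (w 0) + (LINT s:{0..t}|lebesgue. S_D (t - s) (f s))))"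
      using t by (simp add: R.add pairing_add R_S_D)
  qed
  then show ?thesis by (rule injD[OF inj_R])
qed

end

section \<open>Regularity of orbits with initial value in \<open>H\<close>\<close>

lemma bounded_bilinear_Re_cinner: "bounded_bilinear (\<lambda>x y::'a::complex_inner. Re (cinner x y))"
proof
  show "\<exists>K. \<forall>x y::'a. norm (Re (cinner x y)) \<le> norm x * norm y * K"
    using abs_Re_cinner_le by (intro exI[of _ 1]) auto
qed (simp_all add: cinner_add_left cinner_add_right cinner_scaleR_left cinner_scaleR_right)

context gelfand_form
begin

lemma lax_milgramE:
  assumes "(x, f) \<in> lax_milgram j a"
  obtains u where "x = j u" "\<And>v. a u v = cinner f (j v)"
  using assms unfolding lax_milgram_def by auto

lemma lax_milgram_diff:
  assumes "(x, f) \<in> lax_milgram j a" "(y, g) \<in> lax_milgram j a"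
  shows "(x - y, f - g) \<in> lax_milgram j a"
proof -
  obtain u where u: "x = j u" "\<And>v. a u v = cinner f (j v)" using assms(1) by (rule lax_milgramE) blast
  obtain w where w: "y = j w" "\<And>v. a w v = cinner g (j v)" using assms(2) by (rule lax_milgramE) blast
  have "a (u - w) v = cinner (f - g) (j v)" for v by (simp add: a u w cinner_diff_left)
  moreover have "x - y = j (u - w)" by (simp add: u w j.diff)
  ultimately show ?thesis by (auto simp: lax_milgram_def)
qed

lemma dense_Domain_lax_milgram: "closure (Domain (lax_milgram j a)) = UNIV"
proof -
  have "Domain graph_H = Domain (lax_milgram j a)" by (auto simp: graph_H_def)
  then show ?thesis using dense_H by simp
qed

lemma generator_S_H_I: "(x, f) \<in> lax_milgram j a \<Longrightarrow> (x, - f) \<in> generator S_H"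
  by (subst generator_S_H) blast

lemma generator_S_H_E: "(x, y) \<in> generator S_H \<Longrightarrow> (x, - y) \<in> lax_milgram j a"
  by (subst (asm) generator_S_H) auto

section \<open>Compatibility of the semigroups on H and on the antidual\<close>

lemma generator_emb_H:
  assumes "(x, y) \<in> generator S_H" shows "(emb_H j x, emb_H j y) \<in> generator S_D"
proof -
  obtain u where u: "x = j u" "\<And>v. a u v = cinner (- y) (j v)"
    using generator_S_H_E[OF assms] by (rule lax_milgramE) blast
  have "lax_milgram_ext a u = emb_H j (- y)" by (rule antidual_eqI) (simp add: u del: emb_H.neg)
  then have "emb_H j y = - lax_milgram_ext a u" by (simp add: emb_H.neg)
  then show ?thesis unfolding generator_S_D_eq u(1) emb_V_def by blast
qed

text \<open>From an initial value in the domain of A in H, the embedded orbit solves the equation of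
  \<open>S_D\<close>, so \<open>orbit_unique\<close> applies; continuity and density do the
  rest.\<close>

lemma emb_H_S_H:
  assumes t: "0 \<le> t" shows "emb_H j (S_H t x) = S_D t (emb_H j x)"
proof -
  define F where "F x = emb_H j (S_H t x) - S_D t (emb_H j x)" for x
  have lin: "bounded_linear F" unfolding F_def
    by (intro bounded_linear_sub bounded_linear_compose[OF lin_emb_H S_H.lin[OF t]]
        bounded_linear_compose[OF S_D.lin[OF t] lin_emb_H])
  have "F x = 0" if x: "x \<in> Domain (lax_milgram j a)" for x
  proof -
    obtain f where f: "(x, - f) \<in> generator S_H" using x generator_S_H_I by blast
    have "emb_H j (S_H t x) = S_D t (emb_H j (S_H 0 x))"
    proof (rule S_D.orbit_unique[OF t, where y' = "\<lambda>s. emb_H j (S_H s (- f))"])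
      fix s assume s: "s \<in> {0..t}"
      show "((\<lambda>s. emb_H j (S_H s x)) has_vector_derivative emb_H j (S_H s (- f))) (at s within {0..t})"
        by (rule bounded_linear.has_vector_derivative[OF lin_emb_H
              has_vector_derivative_within_subset[OF S_H.deriv_S[OF f]]]) (use s in auto)
      show "(emb_H j (S_H s x), emb_H j (S_H s (- f))) \<in> generator S_D"
        by (rule generator_emb_H[OF S_H.generator_S[OF f]]) (use s in simp)
    qed
    then show ?thesis by (simp add: F_def)
  qed
  then have "F x = 0"
    using continuous_constant_on_closure[of "Domain (lax_milgram j a)" F 0 x]
      linear_continuous_on[OF lin] dense_Domain_lax_milgram by auto
  then show ?thesis by (simp add: F_def)
qed

text \<open>The \<open>V\<close>-valued representative of \<open>S_H s x\<close> for \<open>x\<close> in the domain with \<open>A x = f\<close>.\<close>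

definition orbit_V :: "'h \<Rightarrow> 'h \<Rightarrow> real \<Rightarrow> 'v" where
  "orbit_V x f s = sol k 1 (emb_H j (k *\<^sub>R S_H s x + S_H s f))"

lemma orbit_V:
  assumes xf: "(x, f) \<in> lax_milgram j a" and s: "0 \<le> s"
  shows "j (orbit_V x f s) = S_H s x" and "a (orbit_V x f s) v = cinner (S_H s f) (j v)"
proof -
  have "(S_H s x, S_H s (- f)) \<in> generator S_H"
    by (rule S_H.generator_S[OF generator_S_H_I[OF xf] s])
  then have "(S_H s x, S_H s f) \<in> lax_milgram j a"
    using generator_S_H_E linear_simps[OF S_H.lin[OF s]] by fastforce
  then obtain u where u: "S_H s x = j u" "\<And>v. a u v = cinner (S_H s f) (j v)"
    by (rule lax_milgramE) blast
  have "orbit_V x f s = u" unfolding orbit_V_def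
    by (rule sol_eqI) (simp_all add: form_def u cinner_add_left cinner_scaleR_left scaleR_conv_of_real
        del: emb_H.add)
  then show "j (orbit_V x f s) = S_H s x" "a (orbit_V x f s) v = cinner (S_H s f) (j v)"
    using u by auto
qed

lemma continuous_orbit_V: "continuous_on {0..T} (orbit_V x f)"
proof -
  have "continuous_on {0..T} (\<lambda>s. S_H s y)" for y
    by (rule continuous_on_subset[OF S_H.continuous_orbit]) auto
  then show ?thesis unfolding orbit_V_def[abs_def]
    by (intro bounded_linear.continuous_on[OF lin_sol_k] bounded_linear.continuous_on[OF lin_emb_H] continuous_intros)
qed

lemma orbit_V_energy:
  assumes T: "0 \<le> T"
  shows "\<exists>C\<ge>0. \<forall>(x, f)\<in>lax_milgram j a. (LINT s:{0..T}|lebesgue. (norm (orbit_V x f s))\<^sup>2) \<le> C * (norm x)\<^sup>2"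
proof -
  obtain K where K: "K \<ge> 1" "\<And>s x. s \<in> {0..T} \<Longrightarrow> norm (S_H s x) \<le> K * norm x"
    using S_H.bound[of T] by blast
  \<comment> \<open>Obtained by integrating 2c |v|^2 <= 2k |y|^2 - (|y|^2)', with v measured in V
    and y in H: the 1 comes from the initial value, the other summand from the bound K on
    [0,T].\<close>
  define C where "C = (1 + 2 * k * K\<^sup>2 * T) / (2 * c)"
  have "(LINT s:{0..T}|lebesgue. (norm (orbit_V x f s))\<^sup>2) \<le> C * (norm x)\<^sup>2"
    if xf: "(x, f) \<in> lax_milgram j a" for x f
  proof -
    let ?y = "\<lambda>s. S_H s x" and ?v = "orbit_V x f"
    define q where "q s = Re (cinner (?y s) (?y s))" for s
    define q' where "q' s = Re (cinner (?y s) (S_H s (- f))) + Re (cinner (S_H s (- f)) (?y s))" for s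
    have cont: "continuous_on {0..T} (\<lambda>s. S_H s y)" for y
      by (rule continuous_on_subset[OF S_H.continuous_orbit]) auto
    have dq: "(q has_vector_derivative q' s) (at s within {0..T})" if s: "s \<in> {0..T}" for s
    proof -
      have dy: "(?y has_vector_derivative S_H s (- f)) (at s within {0..T})"
        by (rule has_vector_derivative_within_subset[OF S_H.deriv_S[OF generator_S_H_I[OF xf]]]) (use s in auto)
      show ?thesis unfolding q_def[abs_def] q'_def
        by (rule bounded_bilinear.has_vector_derivative[OF bounded_bilinear_Re_cinner dy dy])
    qed
    have cq': "continuous_on {0..T} q'" unfolding q'_def[abs_def]
      by (intro continuous_on_add bounded_bilinear.continuous_on[OF bounded_bilinear_Re_cinner] cont)
    have FTC: "set_integrable lebesgue {0..T} q'" "(LINT s:{0..T}|lebesgue. q' s) = q T - q 0"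
      by (rule FTC_lebesgue[OF T dq cq']; assumption)+
    have i: "set_integrable lebesgue {0..T} (\<lambda>s. 2 * c * (norm (?v s))\<^sup>2)"
      by (intro absolutely_integrable_continuous_real continuous_intros continuous_orbit_V)
    have le: "2 * c * (norm (?v s))\<^sup>2 \<le> 2 * k * K\<^sup>2 * (norm x)\<^sup>2 - q' s" if s: "s \<in> {0..T}" for s
    proof -
      have s0: "0 \<le> s" using s by simp
      have "Re (a (?v s) (?v s)) = Re (cinner (S_H s f) (?y s))"
        by (simp add: orbit_V[OF xf s0])
      moreover have "S_H s (- f) = - S_H s f"
        by (rule linear_neg[OF bounded_linear.linear[OF S_H.lin[OF s0]]])
      then have "q' s = - 2 * Re (cinner (S_H s f) (?y s))"
        unfolding q'_def Re_cinner_commute[of "?y s"]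
        using cinner_diff_left[of 0 "S_H s f" "?y s"] by (simp add: cinner_zero_left)
      ultimately have "2 * c * (norm (?v s))\<^sup>2 \<le> 2 * (k * (norm (?y s))\<^sup>2) - q' s"
        using coercive[of "?v s"] by (simp add: orbit_V[OF xf s0])
      also have "k * (norm (?y s))\<^sup>2 \<le> k * (K * norm x)\<^sup>2"
        using K(2)[OF s, of x] k by (intro mult_left_mono power_mono) auto
      finally show ?thesis by (simp add: power_mult_distrib)
    qed
    have ic: "set_integrable lebesgue {0..T} (\<lambda>s. 2 * k * K\<^sup>2 * (norm x)\<^sup>2)" by (rule set_integrable_const)
    have "(LINT s:{0..T}|lebesgue. 2 * c * (norm (?v s))\<^sup>2)
        \<le> (LINT s:{0..T}|lebesgue. 2 * k * K\<^sup>2 * (norm x)\<^sup>2 - q' s)"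
      by (rule set_integral_mono[OF i set_integral_diff(1)[OF ic FTC(1)] le])
    also have "\<dots> = (LINT s:{0..T}|lebesgue. 2 * k * K\<^sup>2 * (norm x)\<^sup>2) - (q T - q 0)"
      unfolding set_integral_diff(2)[OF ic FTC(1)] FTC(2) ..
    also have "(LINT s:{0..T}|lebesgue. 2 * k * K\<^sup>2 * (norm x)\<^sup>2) = T * (2 * k * K\<^sup>2 * (norm x)\<^sup>2)"
      unfolding set_lebesgue_integral_eq_integral(2)[OF ic] using T by (simp add: integral_const_real)
    finally have "2 * c * (LINT s:{0..T}|lebesgue. (norm (?v s))\<^sup>2) \<le> T * (2 * k * K\<^sup>2 * (norm x)\<^sup>2) - (q T - q 0)"
      by (simp only: set_integral_mult_right)
    also have "\<dots> \<le> (1 + 2 * k * K\<^sup>2 * T) * (norm x)\<^sup>2"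
      by (simp add: q_def Re_cinner_self algebra_simps)
    finally have "(LINT s:{0..T}|lebesgue. (norm (?v s))\<^sup>2) * (2 * c) \<le> (1 + 2 * k * K\<^sup>2 * T) * (norm x)\<^sup>2"
      by (simp only: mult_ac)
    then show ?thesis using c unfolding C_def by (simp add: pos_le_divide_eq)
  qed
  moreover have "C \<ge> 0" using c k T by (simp add: C_def)
  ultimately show ?thesis by blast
qed

text \<open>Telescoping differences of approximants from the domain. With ratio 1/4 the squared
  norms decay like 16^(-n), so the energies still decay like 8^(-n) after multiplication by the
  weights 2^n.\<close>

lemma orbit_approximation:
  obtains d f :: "nat \<Rightarrow> 'h" and B where "\<And>n. (d n, f n) \<in> lax_milgram j a" "d sums x"
    "\<And>n. norm (d n) \<le> B * (1 / 4) ^ n"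
proof -
  have "\<exists>d f. (d, f) \<in> lax_milgram j a \<and> norm (d - x) \<le> (1 / 4) ^ n" for n :: nat
  proof -
    have "x \<in> closure (Domain (lax_milgram j a))" by (simp add: dense_Domain_lax_milgram)
    moreover have "(1 / 4 :: real) ^ n > 0" by simp
    ultimately obtain d where "d \<in> Domain (lax_milgram j a)" "dist d x < (1 / 4) ^ n"
      unfolding closure_approachable by blast
    then show ?thesis by (auto simp: dist_norm intro: less_imp_le)
  qed
  then obtain d f where df: "\<And>n. (d n, f n) \<in> lax_milgram j a" and dx: "\<And>n. norm (d n - x) \<le> (1 / 4) ^ n"
    by metis
  define D F where "D n = (case n of 0 \<Rightarrow> d 0 | Suc m \<Rightarrow> d (Suc m) - d m)"
    and "F n = (case n of 0 \<Rightarrow> f 0 | Suc m \<Rightarrow> f (Suc m) - f m)" for n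
  have "(D n, F n) \<in> lax_milgram j a" for n
    unfolding D_def F_def by (cases n) (auto intro: df lax_milgram_diff)
  moreover have "D sums x"
  proof -
    have sum: "(\<Sum>i<Suc n. D i) = d n" for n by (induction n) (simp_all add: D_def)
    have "(\<lambda>n. d n - x) \<longlonglongrightarrow> 0"
      by (rule Lim_null_comparison[OF always_eventually LIMSEQ_power_zero[of "1 / 4 :: real"]]) (use dx in auto)
    then have "d \<longlonglongrightarrow> x" by (rule LIM_zero_cancel)
    then have "(\<lambda>n. \<Sum>i<Suc n. D i) \<longlonglongrightarrow> x" by (simp only: sum)
    then show ?thesis unfolding sums_def by (rule LIMSEQ_imp_Suc)
  qed
  moreover have "norm (D n) \<le> max 5 (norm (d 0)) * (1 / 4) ^ n" for n
  proof (cases n)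
    case 0 then show ?thesis by (simp add: D_def)
  next
    case (Suc m)
    have "norm (D n) \<le> norm (d (Suc m) - x) + norm (d m - x)"
      using norm_triangle_ineq4[of "d (Suc m) - x" "d m - x"] by (simp add: D_def Suc)
    also have "\<dots> \<le> (1 / 4) ^ Suc m + (1 / 4) ^ m" by (intro add_mono dx)
    also have "\<dots> = 5 * (1 / 4) ^ n" by (simp add: Suc)
    also have "\<dots> \<le> max 5 (norm (d 0)) * (1 / 4) ^ n" by (intro mult_right_mono) auto
    finally show ?thesis .
  qed
  ultimately show thesis by (rule that)
qed

text \<open>Cauchy-Schwarz against the weights 2^(-n), whose sum is 2. It turns finiteness of a
  weighted sum of squares, available for almost every time, into convergence in V and a square
  integrable majorant at once.\<close>

lemma summable_norm_from_weighted_squares: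
  fixes v :: "nat \<Rightarrow> 'a::banach"
  assumes G: "summable (\<lambda>n. 2 ^ n * (norm (v n))\<^sup>2)"
  shows "summable (\<lambda>n. norm (v n))" "(norm (suminf v))\<^sup>2 \<le> 2 * (\<Sum>n. 2 ^ n * (norm (v n))\<^sup>2)"
proof -
  have geo: "(\<lambda>n. (1 / 2 :: real) ^ n) sums 2" using geometric_sums[of "1 / 2 :: real"] by simp
  have pw: "(1 / 2 :: real) ^ n * 2 ^ n = 1" for n :: nat by (simp add: power_one_over)
  show s: "summable (\<lambda>n. norm (v n))"
  proof (rule summable_comparison_test')
    show "summable (\<lambda>n. (1 / 2) ^ n + 2 ^ n * (norm (v n))\<^sup>2)"
      using geo G by (intro summable_add) (auto dest: sums_summable)
    fix n
    have "0 \<le> (1 / 2) ^ n * (1 - 2 ^ n * norm (v n))\<^sup>2" by simp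
    also have "\<dots> = (1 / 2) ^ n - 2 * ((1 / 2) ^ n * 2 ^ n) * norm (v n)
        + ((1 / 2) ^ n * 2 ^ n) * (2 ^ n * (norm (v n))\<^sup>2)"
      by (simp add: power2_eq_square algebra_simps)
    finally show "norm (norm (v n)) \<le> (1 / 2) ^ n + 2 ^ n * (norm (v n))\<^sup>2"
      unfolding pw mult_1_right mult_1_left real_norm_def abs_norm_cancel using norm_ge_zero[of "v n"] by linarith
  qed
  have le: "(\<Sum>n<N. norm (v n))\<^sup>2 \<le> 2 * (\<Sum>n. 2 ^ n * (norm (v n))\<^sup>2)" for N
  proof -
    have "(\<Sum>n<N. norm (v n))\<^sup>2 = (\<Sum>n<N. sqrt ((1 / 2) ^ n) * (sqrt (2 ^ n) * norm (v n)))\<^sup>2"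
      by (simp add: real_sqrt_mult[symmetric] mult.assoc[symmetric] pw)
    also have "\<dots> \<le> (\<Sum>n<N. (sqrt ((1 / 2) ^ n))\<^sup>2) * (\<Sum>n<N. (sqrt (2 ^ n) * norm (v n))\<^sup>2)"
      by (rule Cauchy_Schwarz_ineq_sum)
    also have "\<dots> = (\<Sum>n<N. (1 / 2) ^ n) * (\<Sum>n<N. 2 ^ n * (norm (v n))\<^sup>2)"
      by (simp add: power_mult_distrib)
    also have "\<dots> \<le> 2 * (\<Sum>n. 2 ^ n * (norm (v n))\<^sup>2)"
      using sum_le_suminf[OF sums_summable[OF geo], of "{..<N}"] sum_le_suminf[OF G, of "{..<N}"] sums_unique[OF geo]
      by (intro mult_mono) (auto intro!: sum_nonneg)
    finally show ?thesis .
  qed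
  have "(\<lambda>N. (\<Sum>n<N. norm (v n))\<^sup>2) \<longlonglongrightarrow> (\<Sum>n. norm (v n))\<^sup>2"
    by (intro tendsto_power summable_LIMSEQ s)
  then have "(\<Sum>n. norm (v n))\<^sup>2 \<le> 2 * (\<Sum>n. 2 ^ n * (norm (v n))\<^sup>2)"
    by (rule LIMSEQ_le_const2) (use le in blast)
  moreover have "(norm (suminf v))\<^sup>2 \<le> (\<Sum>n. norm (v n))\<^sup>2"
    by (intro power_mono summable_norm s) simp
  ultimately show "(norm (suminf v))\<^sup>2 \<le> 2 * (\<Sum>n. 2 ^ n * (norm (v n))\<^sup>2)" by linarith
qed

text \<open>The V-valued orbits of the approximating differences are summed pointwise almost
  everywhere. Since j is continuous, it maps their sum to the sum of the orbits in H, which is the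
  orbit of x.\<close>

lemma orbit_in_L2_V:
  assumes T: "0 \<le> T"
  shows "\<exists>v\<in>L2 T. AE t in lebesgue. t \<in> {0..T} \<longrightarrow> S_H t x = j (v t)"
proof -
  obtain d f B where df: "\<And>n. (d n, f n) \<in> lax_milgram j a" and dx: "d sums x"
    and dB: "\<And>n. norm (d n) \<le> B * (1 / 4) ^ n"
    by (rule orbit_approximation[of x]) blast
  obtain C where C: "C \<ge> 0" "\<And>n. (LINT s:{0..T}|lebesgue. (norm (orbit_V (d n) (f n) s))\<^sup>2) \<le> C * (norm (d n))\<^sup>2"
    using orbit_V_energy[OF T] df by blast
  define v where "v n t = orbit_V (d n) (f n) t" for n t
  \<comment> \<open>The weighted energy density of the n-th difference, cut off outside
    [0,T].\<close>
  define h where "h n t = indicator {0..T} t * (2 ^ n * (norm (v n t))\<^sup>2)" for n t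
  have cv: "continuous_on {0..T} (v n)" for n unfolding v_def[abs_def] by (rule continuous_orbit_V)
  have vi: "set_integrable lebesgue {0..T} (\<lambda>t. (norm (v n t))\<^sup>2)" for n
    by (intro absolutely_integrable_continuous_real continuous_intros cv)
  have hi: "integrable lebesgue (h n)" for n
    using set_integrable_mult_right[of "2 ^ n", OF vi[of n]] by (simp add: set_integrable_def h_def[abs_def])
  have h0: "0 \<le> h n t" for n t by (simp add: h_def)
  have h_le: "(\<integral>t. h n t \<partial>lebesgue) \<le> (C * B\<^sup>2) * (1 / 8) ^ n" for n
  proof -
    have "(\<integral>t. h n t \<partial>lebesgue) = 2 ^ n * (LINT t:{0..T}|lebesgue. (norm (v n t))\<^sup>2)"
      by (simp add: h_def set_lebesgue_integral_def mult.left_commute[of "indicator _ _"])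
    also have "\<dots> \<le> 2 ^ n * (C * (norm (d n))\<^sup>2)" using C(2)[of n] by (simp add: v_def)
    also have "\<dots> \<le> 2 ^ n * (C * (B * (1 / 4) ^ n)\<^sup>2)"
      using C(1) dB[of n] by (intro mult_left_mono power_mono) auto
    also have "\<dots> = (C * B\<^sup>2) * (2 * (1 / 4)\<^sup>2) ^ n"
      by (simp only: power_mult_distrib power_mult[symmetric] mult_ac)
    finally show ?thesis by (simp add: power2_eq_square)
  qed
  have sum_h: "summable (\<lambda>n. \<integral>t. h n t \<partial>lebesgue)"
    by (rule summable_comparison_test'[of "\<lambda>n. (C * B\<^sup>2) * (1 / 8) ^ n" 0])
      (use h_le h0 in \<open>auto intro!: summable_mult summable_geometric simp: integral_nonneg\<close>)
  \<comment> \<open>Summation and integration are exchanged by monotone convergence; a finite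
    integral then gives summability for almost every t.\<close>
  have "(\<integral>\<^sup>+ t. (\<Sum>n. ennreal (h n t)) \<partial>lebesgue) = (\<Sum>n. \<integral>\<^sup>+ t. ennreal (h n t) \<partial>lebesgue)"
    using hi by (intro nn_integral_suminf) auto
  also have "\<dots> = (\<Sum>n. ennreal (\<integral>t. h n t \<partial>lebesgue))"
    using hi h0 by (simp add: nn_integral_eq_integral)
  also have "\<dots> = ennreal (\<Sum>n. \<integral>t. h n t \<partial>lebesgue)"
    using sum_h h0 by (intro suminf_ennreal2) (auto simp: integral_nonneg)
  finally have "(\<integral>\<^sup>+ t. (\<Sum>n. ennreal (h n t)) \<partial>lebesgue) \<noteq> \<infinity>" by simp
  then have "AE t in lebesgue. (\<Sum>n. ennreal (h n t)) \<noteq> \<infinity>"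
    using hi by (intro nn_integral_PInf_AE) auto
  then have ae: "AE t in lebesgue. summable (\<lambda>n. h n t)"
    by eventually_elim (use h0 in \<open>auto intro: summable_suminf_not_top\<close>)
  have "integrable lebesgue (\<lambda>t. \<Sum>n. h n t)"
    using hi ae sum_h h0 by (intro integrable_suminf) auto
  then have G: "integrable lebesgue (\<lambda>t. 2 * (\<Sum>n. h n t))" by simp
  define w where "w t = (\<Sum>n. v n t)" for t
  have le: "AE t in lebesgue. t \<in> {0..T} \<longrightarrow> (norm (w t))\<^sup>2 \<le> 2 * (\<Sum>n. h n t)"
    using ae
  proof eventually_elim
    case (elim t)
    show ?case
      using summable_norm_from_weighted_squares(2)[of "\<lambda>n. v n t"] elim by (auto simp: h_def w_def)
  qed
  have eq: "AE t in lebesgue. t \<in> {0..T} \<longrightarrow> S_H t x = j (w t)"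
    using ae
  proof eventually_elim
    case (elim t)
    show ?case
    proof
      assume t: "t \<in> {0..T}"
      then have "summable (\<lambda>n. norm (v n t))"
        using summable_norm_from_weighted_squares(1)[of "\<lambda>n. v n t"] elim by (auto simp: h_def)
      then have "(\<lambda>n. v n t) sums w t" unfolding w_def by (rule summable_sums[OF summable_norm_cancel])
      then have "(\<lambda>n. j (v n t)) sums j (w t)" by (rule j.sums)
      moreover have "j (v n t) = S_H t (d n)" for n unfolding v_def using orbit_V(1)[OF df] t by simp
      ultimately have jw: "(\<lambda>n. S_H t (d n)) sums j (w t)" by simp
      have "(\<lambda>n. S_H t (d n)) sums S_H t x"
        using t by (intro bounded_linear.sums[OF S_H.lin dx]) simp
      then show "S_H t x = j (w t)" using jw by (rule sums_unique2)
    qed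
  qed
  have "w \<in> L2 T" unfolding L2_iff
  proof
    have m: "(\<lambda>t. indicator A t *\<^sub>R v n t) \<in> borel_measurable lebesgue" if "A = {0<..<T} \<or> A = {0..T}" for n A
      using set_integrable_continuous[OF cv[of n]] set_integrable_open_interval(1)[of T "v n"] that
      by (auto simp: set_integrable_def)
    have "(\<lambda>t. indicator A t *\<^sub>R w t) \<in> borel_measurable lebesgue" if "A = {0<..<T} \<or> A = {0..T}" for A
    proof -
      have "(\<lambda>t. \<Sum>n. indicator A t *\<^sub>R v n t) \<in> borel_measurable lebesgue"
        by (rule borel_measurable_suminf) (rule m[OF that])
      moreover have "(\<lambda>t. \<Sum>n. indicator A t *\<^sub>R v n t) = (\<lambda>t. indicator A t *\<^sub>R w t)"
        by (auto simp: w_def indicator_def)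
      ultimately show ?thesis by simp
    qed
    note wm = this
    show "set_borel_measurable lebesgue {0<..<T} w" using wm by (simp add: set_borel_measurable_def)
    show "set_integrable lebesgue {0..T} (\<lambda>t. (norm (w t))\<^sup>2)"
    proof (rule set_integrable_bound)
      show "set_integrable lebesgue {0..T} (\<lambda>t. 2 * (\<Sum>n. h n t))"
        using integrable_mult_indicator[OF _ G, of "{0..T}"] by (simp add: set_integrable_def)
      have "(\<lambda>t. (norm (indicator {0..T} t *\<^sub>R w t))\<^sup>2) \<in> borel_measurable lebesgue"
        by (rule measurable_compose[OF wm]) (auto intro!: borel_measurable_continuous_onI continuous_intros)
      also have "(\<lambda>t. (norm (indicator {0..T} t *\<^sub>R w t))\<^sup>2) = (\<lambda>t. indicator {0..T} t *\<^sub>R (norm (w t))\<^sup>2)"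
        by (auto simp: indicator_def)
      finally show "set_borel_measurable lebesgue {0..T} (\<lambda>t. (norm (w t))\<^sup>2)"
        by (simp add: set_borel_measurable_def)
      show "AE t in lebesgue. t \<in> {0..T} \<longrightarrow> norm ((norm (w t))\<^sup>2) \<le> norm (2 * (\<Sum>n. h n t))"
        using le by eventually_elim (use order_trans[OF _ abs_ge_self] in auto)
    qed
  qed
  with eq show ?thesis by blast
qed

end

section \<open>The solution space\<close>

lemma L2_cong:
  assumes "f \<in> L2 T" "\<And>t. t \<in> {0..T} \<Longrightarrow> f t = g t" shows "g \<in> L2 T"
proof -
  have "(\<lambda>t. indicator {0<..<T} t *\<^sub>R f t) = (\<lambda>t. indicator {0<..<T} t *\<^sub>R g t)"
    using assms(2) by (intro ext) (auto simp: indicator_def)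
  moreover have "(\<lambda>t. indicator {0..T} t *\<^sub>R (norm (f t))\<^sup>2) = (\<lambda>t. indicator {0..T} t *\<^sub>R (norm (g t))\<^sup>2)"
    using assms(2) by (intro ext) (auto simp: indicator_def)
  ultimately show ?thesis
    using assms(1) by (simp only: L2_iff set_borel_measurable_def set_integrable_def)
qed

lemma regular_distr_cong:
  "(\<And>t. t \<in> {0..T} \<Longrightarrow> f t = g t) \<Longrightarrow> regular_distr T f \<phi> = regular_distr T g \<phi>"
  unfolding regular_distr_eq by (rule set_lebesgue_integral_cong) auto

lemma regular_distr_diff:
  assumes "set_integrable lebesgue {0..T} f" "set_integrable lebesgue {0..T} g" "continuous_on UNIV \<phi>"
  shows "regular_distr T (\<lambda>t. f t - g t) \<phi> = regular_distr T f \<phi> - regular_distr T g \<phi>"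
  unfolding regular_distr_eq
    set_integral_diff(2)[OF set_integrable_scaleC[OF assms(1,3)] set_integrable_scaleC[OF assms(2,3)], symmetric]
  by (simp add: linear_simps[OF bounded_linear_scaleC])

lemma X_spaceI:
  assumes "v \<in> L2 T" "AE t in lebesgue_on {0<..<T}. u t = emb_V j (v t)"
    and "continuous_on {0..T} h" "\<And>t. t \<in> {0..T} \<Longrightarrow> u t = emb_H j (h t)"
    and "u \<in> L2 T" "g \<in> L2 T" "\<And>\<phi>. test_function T \<phi> \<Longrightarrow> distr_deriv (regular_distr T u) \<phi> = regular_distr T g \<phi>"
  shows "u \<in> X_space j T"
  using assms unfolding X_space_def H1_def by blast

context gelfand_form
begin

lemma X_space_diff:
  assumes u: "u \<in> X_space j T" and w: "w \<in> X_space j T" and z: "\<And>t. t \<in> {0..T} \<Longrightarrow> z t = u t - w t"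
  shows "z \<in> X_space j T"
proof -
  obtain uv uh ug where uv: "uv \<in> L2 T" "AE t in lebesgue_on {0<..<T}. u t = emb_V j (uv t)"
    and uh: "continuous_on {0..T} uh" "\<And>t. t \<in> {0..T} \<Longrightarrow> u t = emb_H j (uh t)"
    and ug: "u \<in> L2 T" "ug \<in> L2 T" "\<And>\<phi>. test_function T \<phi> \<Longrightarrow> distr_deriv (regular_distr T u) \<phi> = regular_distr T ug \<phi>"
    using u unfolding X_space_def H1_def by blast
  obtain wv wh wg where wv: "wv \<in> L2 T" "AE t in lebesgue_on {0<..<T}. w t = emb_V j (wv t)"
    and wh: "continuous_on {0..T} wh" "\<And>t. t \<in> {0..T} \<Longrightarrow> w t = emb_H j (wh t)"
    and wg: "w \<in> L2 T" "wg \<in> L2 T" "\<And>\<phi>. test_function T \<phi> \<Longrightarrow> distr_deriv (regular_distr T w) \<phi> = regular_distr T wg \<phi>"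
    using w unfolding X_space_def H1_def by blast
  show ?thesis
  proof (rule X_spaceI)
    show "AE t in lebesgue_on {0<..<T}. z t = emb_V j (uv t - wv t)"
      using uv(2)[unfolded AE_lebesgue_on_interval] wv(2)[unfolded AE_lebesgue_on_interval]
      unfolding AE_lebesgue_on_interval by eventually_elim (auto simp: z emb_V.diff)
    show "(\<lambda>t. uv t - wv t) \<in> L2 T" by (rule L2_diff[OF uv(1) wv(1)])
    show "continuous_on {0..T} (\<lambda>t. uh t - wh t)" by (intro continuous_intros uh wh)
    show "z t = emb_H j (uh t - wh t)" if "t \<in> {0..T}" for t using that by (simp add: z uh(2) wh(2) emb_H.diff)
    show "z \<in> L2 T" by (rule L2_cong[OF L2_diff[OF ug(1) wg(1)]]) (simp add: z)
    show "(\<lambda>t. ug t - wg t) \<in> L2 T" by (rule L2_diff[OF ug(2) wg(2)])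
    show "distr_deriv (regular_distr T z) \<phi> = regular_distr T (\<lambda>t. ug t - wg t) \<phi>"
      if \<phi>: "test_function T \<phi>" for \<phi>
    proof -
      have "regular_distr T z \<psi> = regular_distr T u \<psi> - regular_distr T w \<psi>" if "continuous_on UNIV \<psi>" for \<psi>
        unfolding regular_distr_diff[OF L2_set_integrable[OF ug(1)] L2_set_integrable[OF wg(1)] that, symmetric]
        by (rule regular_distr_cong) (rule z)
      then have "distr_deriv (regular_distr T z) \<phi> = distr_deriv (regular_distr T u) \<phi> - distr_deriv (regular_distr T w) \<phi>"
        using test_function_continuous(2)[OF \<phi>] by (simp add: distr_deriv_def)
      then show ?thesis
        using regular_distr_diff[OF L2_set_integrable[OF ug(2)] L2_set_integrable[OF wg(2)] test_function_continuous(1)[OF \<phi>]]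
        by (simp add: ug(3)[OF \<phi>] wg(3)[OF \<phi>])
    qed
  qed
qed

lemma R_scaleC: "R (s *\<^sub>C \<phi>) = s *\<^sub>C R \<phi>"
  using clin_sol[of 1 k] clin_emb_V by (simp add: R_def bounded_clinear_def)

lemma R_regular_distr:
  assumes "set_integrable lebesgue {0..T} g" "continuous_on UNIV \<phi>"
  shows "R (regular_distr T g \<phi>) = regular_distr T (\<lambda>t. R (g t)) \<phi>"
  unfolding regular_distr_eq bounded_linear_set_integral(2)[OF lin_R set_integrable_scaleC[OF assms], symmetric]
  by (simp add: R_scaleC)

text \<open>Only \<open>R (S_D t w0)\<close> is differentiable in \<open>t\<close>; injectivity of \<open>R\<close> transfers the identity to the orbit itself.\<close>

lemma weak_derivative_orbit:
  assumes T: "0 < T" and v: "v \<in> L2 T" and wv: "AE t in lebesgue. t \<in> {0..T} \<longrightarrow> S_D t w0 = emb_V j (v t)"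
    and \<phi>: "test_function T \<phi>"
  shows "distr_deriv (regular_distr T (\<lambda>t. S_D t w0)) \<phi> = regular_distr T (\<lambda>t. - lax_milgram_ext a (v t)) \<phi>"
proof (rule injD[OF inj_R], rule antidual_eqI)
  fix y :: 'v
  define w where "w t = S_D t w0" for t
  define g where "g t = - lax_milgram_ext a (v t)" for t
  have g: "set_integrable lebesgue {0..T} g" unfolding g_def[abs_def]
    by (intro L2_set_integrable L2_bounded_linear[OF bounded_linear_minus[OF lin_A] v])
  have cw: "continuous_on {0..T} w" unfolding w_def[abs_def]
    by (rule continuous_on_subset[OF S_D.continuous_orbit]) auto
  have cRw: "continuous_on {0..T} (\<lambda>t. R (w t))" by (rule R.continuous_on[OF cw])
  have wi: "set_integrable lebesgue {0..T} w" by (rule set_integrable_continuous[OF cw])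
  note c\<phi> = test_function_continuous[OF \<phi>, of UNIV]
  note P = bounded_linear_pairing[of y]
  let ?p = "\<lambda>t. pairing (k *\<^sub>R R (w t) - w t) y"
  have cp: "continuous_on {0..T} ?p"
    by (intro bounded_linear.continuous_on[OF P] continuous_intros cRw cw)
  have pi: "set_integrable lebesgue {0..T} ?p" by (rule absolutely_integrable_continuous_real[OF cp])
  have deriv: "((\<lambda>t. pairing (R (w t)) y) has_vector_derivative ?p t) (at t within {0..s})" if t: "t \<in> {0..s}" for t s
  proof -
    have "((\<lambda>t. S_D t (R w0)) has_vector_derivative S_D t (k *\<^sub>R R w0 - w0)) (at t within {0..s})"
      by (rule has_vector_derivative_within_subset[OF S_D.deriv_S[OF generator_R]]) (use t in auto)
    moreover have "S_D t (k *\<^sub>R R w0 - w0) = k *\<^sub>R R (w t) - w t"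
    proof -
      interpret St: bounded_linear "S_D t" using t by (intro S_D.lin) simp
      show ?thesis using R_S_D[of t w0] t by (simp add: St.diff St.scaleR w_def)
    qed
    ultimately have "((\<lambda>t. S_D t (R w0)) has_vector_derivative k *\<^sub>R R (w t) - w t) (at t within {0..s})" by simp
    then have "((\<lambda>t. R (w t)) has_vector_derivative k *\<^sub>R R (w t) - w t) (at t within {0..s})"
      by (rule has_vector_derivative_transform[rotated 2]) (use t R_S_D in \<open>auto simp: w_def\<close>)
    then show ?thesis by (rule bounded_linear.has_vector_derivative[OF P])
  qed
  have Rw: "pairing (R (w s)) y = pairing (R (w 0)) y + (LINT t:{0..s}|lebesgue. ?p t)" if s: "s \<in> {0..T}" for s
  proof -
    have "(LINT t:{0..s}|lebesgue. ?p t) = pairing (R (w s)) y - pairing (R (w 0)) y"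
      by (rule FTC_lebesgue(2)) (use s deriv in \<open>auto intro!: continuous_on_subset[OF cp]\<close>)
    then show ?thesis by simp
  qed
  \<comment> \<open>By \<open>R_A\<close>, R (-A v) is k R w - w wherever w =
    \<open>emb_V j (v t)\<close>; this is the derivative of R w.\<close>
  have "AE t in lebesgue. t \<in> {0..T} \<longrightarrow> \<phi> t * pairing (R (g t)) y = \<phi> t * ?p t"
    using wv
  proof eventually_elim
    case (elim t)
    then show ?case by (auto simp: w_def g_def R.neg R_A)
  qed
  moreover have "set_integrable lebesgue {0..T} (\<lambda>t. \<phi> t * pairing (R (g t)) y)"
    using bounded_linear_set_integral(1)[OF P set_integrable_scaleC[OF bounded_linear_set_integral(1)[OF lin_R g] c\<phi>(1)]]
    by (simp add: pairing_scaleC)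
  ultimately have eq: "(LINT t:{0..T}|lebesgue. \<phi> t * ?p t) = (LINT t:{0..T}|lebesgue. \<phi> t * pairing (R (g t)) y)"
    by (intro set_integral_cong_AE_lebesgue(2))
  have "pairing (R (distr_deriv (regular_distr T w) \<phi>)) y
      = - pairing (regular_distr T (\<lambda>t. R (w t)) (\<lambda>t. vector_derivative \<phi> (at t))) y"
    unfolding distr_deriv_def R.neg pairing_uminus R_regular_distr[OF wi c\<phi>(2)] ..
  also have "\<dots> = - (LINT t:{0..T}|lebesgue. vector_derivative \<phi> (at t) * pairing (R (w t)) y)"
    unfolding pairing_regular_distr[OF bounded_linear_set_integral(1)[OF lin_R wi] c\<phi>(2)] ..
  also have "\<dots> = (LINT t:{0..T}|lebesgue. \<phi> t * ?p t)"
    by (rule minus_unique, rule weak_derivative_test_identity(3)[OF less_imp_le[OF T] pi Rw \<phi>])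
  also have "\<dots> = pairing (R (regular_distr T g \<phi>)) y"
    unfolding eq R_regular_distr[OF g c\<phi>(1)]
      pairing_regular_distr[OF bounded_linear_set_integral(1)[OF lin_R g] c\<phi>(1)] ..
  finally show "pairing (R (distr_deriv (regular_distr T (\<lambda>t. S_D t w0)) \<phi>)) y
      = pairing (R (regular_distr T (\<lambda>t. - lax_milgram_ext a (v t)) \<phi>)) y"
    by (simp only: w_def[abs_def] g_def[abs_def])
qed

lemma orbit_in_X_space:
  assumes T: "0 < T" shows "(\<lambda>t. emb_H j (S_H t x)) \<in> X_space j T"
proof -
  obtain v where v: "v \<in> L2 T" "AE t in lebesgue. t \<in> {0..T} \<longrightarrow> S_H t x = j (v t)"
    using orbit_in_L2_V[of T x] T by auto
  have ae: "AE t in lebesgue. t \<in> {0..T} \<longrightarrow> emb_H j (S_H t x) = emb_V j (v t)"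
    using v(2) by eventually_elim (auto simp: emb_V_def)
  have ch: "continuous_on {0..T} (\<lambda>t. S_H t x)"
    by (rule continuous_on_subset[OF S_H.continuous_orbit]) auto
  have L2: "(\<lambda>t. emb_H j (S_H t x)) \<in> L2 T"
    by (rule L2_continuous[OF emb_H.continuous_on[OF ch]])
  have g: "(\<lambda>t. - lax_milgram_ext a (v t)) \<in> L2 T"
    by (rule L2_bounded_linear[OF bounded_linear_minus[OF lin_A] v(1)])
  have "distr_deriv (regular_distr T (\<lambda>t. emb_H j (S_H t x))) \<phi> = regular_distr T (\<lambda>t. - lax_milgram_ext a (v t)) \<phi>"
    if \<phi>: "test_function T \<phi>" for \<phi>
  proof -
    have "AE t in lebesgue. t \<in> {0..T} \<longrightarrow> S_D t (emb_H j x) = emb_V j (v t)"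
      using ae by eventually_elim (simp add: emb_H_S_H)
    from weak_derivative_orbit[OF T v(1) this \<phi>]
    show ?thesis
      unfolding distr_deriv_def
      by (subst regular_distr_cong[where g = "\<lambda>t. S_D t (emb_H j x)"]) (simp_all add: emb_H_S_H)
  qed
  then show ?thesis
    unfolding X_space_def H1_def AE_lebesgue_on_interval using v(1) ae ch L2 g by blast
qed

text \<open>The square integrable representative v replaces the values of
  \<open>inv (emb_V j)\<close>, which are arbitrary on a null set. Then f - A v is an integrable
  weak derivative of u, and \<open>duhamel\<close> applies on each [0,t].\<close>

lemma cauchy_solution_duhamel:
  assumes T: "0 < T" and f: "f \<in> L2 T" and u: "u \<in> X_space j T" and sol: "cauchy_solution j a T f u0 u"
    and t: "t \<in> {0..T}"
  shows "set_integrable lebesgue {0..t} (\<lambda>s. S_D (t - s) (f s))"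
    and "u t = emb_H j (S_H t u0) + (LINT s:{0..t}|lebesgue. S_D (t - s) (f s))"
proof -
  obtain v h where v: "v \<in> L2 T" "AE t in lebesgue_on {0<..<T}. u t = emb_V j (v t)"
    and h: "continuous_on {0..T} h" "\<And>t. t \<in> {0..T} \<Longrightarrow> u t = emb_H j (h t)" and uL2: "u \<in> L2 T"
    using u unfolding X_space_def H1_def by blast
  have uv: "AE t in lebesgue. t \<in> {0..T} \<longrightarrow> u t = emb_V j (v t)"
    using v(2) by (simp only: AE_lebesgue_on_interval)
  have fi: "set_integrable lebesgue {0..T} f" by (rule L2_set_integrable[OF f])
  have Ai: "set_integrable lebesgue {0..T} (\<lambda>t. lax_milgram_ext a (v t))"
    by (rule L2_set_integrable[OF L2_bounded_linear[OF lin_A v(1)]])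
  define g where "g t = f t - lax_milgram_ext a (v t)" for t
  have g: "set_integrable lebesgue {0..T} g" unfolding g_def[abs_def] by (rule set_integral_diff(1)[OF fi Ai])
  have cu: "continuous_on {0..T} u"
    using continuous_on_cong[OF refl, of "{0..T}" u "\<lambda>t. emb_H j (h t)"] h emb_H.continuous_on[OF h(1)] by simp
  have weak: "distr_deriv (regular_distr T u) \<phi> = regular_distr T g \<phi>" if \<phi>: "test_function T \<phi>" for \<phi>
  proof -
    note c = test_function_continuous(1)[OF \<phi>, of UNIV]
    have "AE t in lebesgue. t \<in> {0..T} \<longrightarrow>
        \<phi> t *\<^sub>C lax_milgram_ext a (v t) = \<phi> t *\<^sub>C lax_milgram_ext a (inv (emb_V j) (u t))"
      using uv by eventually_elim (simp add: inv_f_f[OF inj_emb_V])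
    then have "regular_distr T (\<lambda>t. lax_milgram_ext a (inv (emb_V j) (u t))) \<phi>
        = regular_distr T (\<lambda>t. lax_milgram_ext a (v t)) \<phi>"
      unfolding regular_distr_eq by (rule set_integral_cong_AE_lebesgue(2)[OF set_integrable_scaleC[OF Ai c]])
    then have "distr_deriv (regular_distr T u) \<phi> + regular_distr T (\<lambda>t. lax_milgram_ext a (v t)) \<phi> = regular_distr T f \<phi>"
      using sol \<phi> unfolding cauchy_solution_def by metis
    then show ?thesis unfolding g_def[abs_def] regular_distr_diff[OF fi Ai c] by (simp add: eq_diff_eq)
  qed
  have ut: "u s = u 0 + (LINT r:{0..s}|lebesgue. g r)" if "s \<in> {0..T}" for s
    by (rule indefinite_integral_of_weak_derivative[OF T cu g weak that])
  have sub: "{0..t} \<subseteq> {0..T}" and t0: "0 \<le> t" using t by auto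
  have ft: "set_integrable lebesgue {0..t} f" and gt: "set_integrable lebesgue {0..t} g"
    using set_integrable_subset[OF fi _ sub] set_integrable_subset[OF g _ sub] by auto
  show "set_integrable lebesgue {0..t} (\<lambda>s. S_D (t - s) (f s))"
    by (rule C0_semigroup_set_integrable[OF C0_S_D t0 ft])
  have "u t = S_D t (u 0) + (LINT s:{0..t}|lebesgue. S_D (t - s) (f s))"
  proof (rule duhamel[OF t0 ft gt])
    show "u s = u 0 + (LINT r:{0..s}|lebesgue. g r)" if "s \<in> {0..t}" for s using ut sub that by blast
    show "AE s in lebesgue. s \<in> {0..t} \<longrightarrow> u s = emb_V j (v s) \<and> g s = f s - lax_milgram_ext a (v s)"
      using uv by eventually_elim (use sub in \<open>auto simp: g_def\<close>)
  qed
  moreover have "u 0 = emb_H j u0" using sol by (simp add: cauchy_solution_def)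
  ultimately show "u t = emb_H j (S_H t u0) + (LINT s:{0..t}|lebesgue. S_D (t - s) (f s))"
    using emb_H_S_H[OF t0] by simp
qed

end

theorem proposition2:
  fixes j :: "'v::{complex_hilbert, second_countable_topology}
      \<Rightarrow> 'h::{complex_hilbert, second_countable_topology}"
    and a :: "'v \<Rightarrow> 'v \<Rightarrow> complex"
    and T :: real
    and u\<^sub>0 :: 'h
    and f u :: "real \<Rightarrow> 'v antidual"
  assumes "gelfand_triple j"
    and "sesquilinear a" and "bounded_form a" and "coercive_form j a"
    and "0 < T"
    and "f \<in> L2 T"
    and "u \<in> X_space j T" and "cauchy_solution j a T f u\<^sub>0 u"
  shows "(\<forall>t\<in>{0..T}.
        set_integrable lebesgue {0..t} (\<lambda>s. exp_minus (lax_milgram_ext_graph j a) (t - s) (f s)) \<and>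
        u t = emb_H j (exp_minus (lax_milgram j a) t u\<^sub>0) + (LINT s:{0..t}|lebesgue. exp_minus (lax_milgram_ext_graph j a) (t - s) (f s))) \<and>
      u \<in> X_space j T \<and>
      (\<lambda>t. emb_H j (exp_minus (lax_milgram j a) t u\<^sub>0)) \<in> X_space j T \<and>
      (\<lambda>t. LINT s:{0..t}|lebesgue. exp_minus (lax_milgram_ext_graph j a) (t - s) (f s)) \<in> X_space j T"
proof -
  obtain Ca where Ca: "Ca > 0" "\<And>u v. cmod (a u v) \<le> Ca * norm u * norm v"
    using assms(3) unfolding bounded_form_def by blast
  obtain c k where c: "c > 0" "\<And>v. Re (a v v) \<ge> c * (norm v)\<^sup>2 - k * (norm (j v))\<^sup>2"
    using assms(4) unfolding coercive_form_def by blast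
  have j: "bounded_clinear j" "inj j" "closure (range j) = UNIV"
    using assms(1) by (auto simp: gelfand_triple_def)
  then obtain Cj where Cj: "Cj > 0" "\<And>v. norm (j v) \<le> norm v * Cj"
    using bounded_linear.pos_bounded[of j] unfolding bounded_clinear_def by blast
  \<comment> \<open>Enlarging k preserves the coercivity estimate, so k can be taken
    nonnegative.\<close>
  interpret gelfand_form j a Ca c "max k 0" Cj
  proof
    fix v
    have "k * (norm (j v))\<^sup>2 \<le> max k 0 * (norm (j v))\<^sup>2" by (intro mult_right_mono) auto
    then show "Re (a v v) \<ge> c * (norm v)\<^sup>2 - max k 0 * (norm (j v))\<^sup>2" using c(2)[of v] by linarith
    show "norm (j v) \<le> Cj * norm v" using Cj(2)[of v] by (simp add: mult.commute)
  qed (use Ca c Cj j assms(2) in auto)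
  note duhamel = cauchy_solution_duhamel[OF assms(5-8)]
  have "(\<lambda>t. LINT s:{0..t}|lebesgue. exp_minus (lax_milgram_ext_graph j a) (t - s) (f s)) \<in> X_space j T"
    by (rule X_space_diff[OF assms(7) orbit_in_X_space[OF assms(5), of u\<^sub>0]]) (simp add: duhamel(2))
  then show ?thesis using duhamel assms(7) orbit_in_X_space[OF assms(5)] by blast
qed

end
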